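(* Let $X=\mathbb{R}\times\mathbb{Z}(2)$, let $n\ge 2$, and let $a_j,b_j$, $j=1,2,\dots,n$, be topological automorphisms of $X$ (identified with nonzero real numbers) satisfying $b_ia_i^{-1}+b_ja_j^{-1}\neq 0$ for all $i,j$. Let $\xi_j$, $j=1,\dots,n$, be independent random variables with values in $X$ and distributions $\mu_j$. Assume that the conditional distribution of the linear form $L_2=b_1\xi_1+\dots+b_n\xi_n$ given $L_1=a_1\xi_1+\dots+a_n\xi_n$ is symmetric. Then the following alternative holds: either 1. all distributions $\mu_j$ belong to the class $\Lambda$, and at least one of the distributions $\mu_j$ is represented in the form $\mu_j=\gamma_j*m_{\mathbb{Z}(2)}$, where $\gamma_j\in\Gamma(\mathbb{R})$; or 2. all distributions $\mu_j$ belong to the class $\Theta$, and their characteristic functions do not vanish.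
   Context: $\mathbb{Z}(2)=\{0,1\}$ is the group of residue classes modulo 2. Elements of $X=\mathbb{R}\times\mathbb{Z}(2)$ are written $(t,k)$. The character group $Y$ of $X$ is identified with $\mathbb{R}\times\mathbb{Z}(2)$, with elements $(s,l)$ and pairing $((t,k),(s,l))=e^{its}(-1)^{kl}$. Every topological automorphism of $X$ has the form $(t,k)\mapsto(at,k)$ with $a\in\mathbb{R}$, $a\ne0$, and is identified with the real number $a$. For a probability distribution $\mu$ on $X$, its characteristic function is $\hat\mu(y)=\int_X (x,y)\,d\mu(x)$, $y\in Y$; $*$ denotes convolution. The conditional distribution of $L_2$ given $L_1$ is symmetric if, equivalently, the pairs $(L_1,L_2)$ and $(L_1,-L_2)$ are identically distributed. $\mathbb{R}$ and $\mathbb{Z}(2)$ are regarded as the subgroups $\mathbb{R}\times\{0\}$ and $\{0\}\times\mathbb{Z}(2)$ of $X$. $\Gamma(\mathbb{R})$ is the set of Gaussian distributions on $\mathbb{R}$ (possibly degenerate), regarded as distributions on $X$. $m_{\mathbb{Z}(2)}$ is the Haar (uniform) probability distribution on $\mathbb{Z}(2)$. Class $\Lambda$: a probability distribution $\mu$ on $X$ belongs to $\Lambda$ if the distribution $\mu_{\mathbb{R}}(E)=\mu(E\times\mathbb{Z}(2))$ ($E\subset\mathbb{R}$ Borel) is Gaussian (possibly degenerate) on $\mathbb{R}$. Class $\Theta$: a probability distribution $\mu$ on $X$ belongs to $\Theta$ if $$\hat\mu(s,0)=\exp\{-\sigma s^2+i\beta s\},\qquad \hat\mu(s,1)=\kappa\exp\{-\sigma'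 s^2+i\beta' s\},\qquad s\in\mathbb{R},$$ with $\sigma,\sigma'\ge0$, $\beta,\beta',\kappa\in\mathbb{R}$, where either $0<\sigma'<\sigma$ and $0<|\kappa|\le\sqrt{\sigma'/\sigma}\,\exp\left\{-\frac{(\beta-\beta')^2}{4(\sigma-\sigma')}\right\}$, or $\sigma=\sigma'$, $\beta=\beta'$ and $|\kappa|\le1$. *)

theory Defs
  imports "HOL-Probability.Probability" "HOL-Library.Z2"
begin

section \<open>The group \<open>\<real> \<times> \<int>(2)\<close>\<close>

text \<open>
  The group of residues modulo 2 is the additive group of the library's two-element field
  \<^typ>\<open>bit\<close>, here given the discrete topology.  The group structure, the topology and the
  Borel \<open>\<sigma>\<close>-algebra of the product are then those supplied by the library.
\<close>

instantiation bit :: discrete_topology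
begin

definition open_bit :: "bit set \<Rightarrow> bool"
  where "open_bit A \<longleftrightarrow> True"

instance
  by standard (simp_all add: open_bit_def)

end

instance bit :: finite
proof
  have "(UNIV :: bit set) = {0, 1}"
    by (auto intro: bit_not_zero_iff[THEN iffD1])
  then show "finite (UNIV :: bit set)"
    by (metis finite.emptyI finite.insertI)
qed

instance bit :: second_countable_topology
proof
  let ?B = "range (\<lambda>k::bit. {k})"
  have "generate_topology ?B (\<Union>x\<in>S. {x})" for S
    by (intro generate_topology_Union) (auto intro: generate_topology.intros)
  then have "open = generate_topology ?B"
    by (auto simp: open_bit_def)
  moreover have "countable ?B" by simp
  ultimately show "\<exists>B::bit set set. countable B \<and> open = generate_topology B" by blast
qed

type_synonym real_z2 = "real \<times> bit"


section \<open>Topological automorphisms\<close>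

definition topological_automorphism ::
    "('a::{topological_space, ab_group_add} \<Rightarrow> 'a) \<Rightarrow> bool" where
  "topological_automorphism f \<longleftrightarrow>
     (\<forall>x y. f (x + y) = f x + f y) \<and> (\<exists>g. homeomorphism UNIV UNIV f g)"

definition dilation :: "real \<Rightarrow> real_z2 \<Rightarrow> real_z2" where
  "dilation a = (\<lambda>(t, k). (a * t, k))"

lemma topological_automorphism_dilation:
  assumes "a \<noteq> 0"
  shows "topological_automorphism (dilation a)"
proof -
  have "homeomorphism UNIV UNIV (dilation a) (dilation (1 / a))"
    unfolding dilation_def
    by (rule homeomorphismI)
       (auto simp: case_prod_beta assms intro!: continuous_intros)
  then show ?thesis
    unfolding topological_automorphism_def by (auto simp: dilation_def algebra_simps)
qed

lemma continuous_additive_real: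
  fixes f :: "real \<Rightarrow> real"
  assumes add: "\<And>x y. f (x + y) = f x + f y" and cont: "continuous_on UNIV f"
  shows "f x = f 1 * x"
proof -
  interpret f: Modules.additive f by standard (rule add)
  have nat: "f (of_nat n * x) = of_nat n * f x" for n x
    by (induction n) (simp_all add: f.zero add algebra_simps)
  have int: "f (of_int k * x) = of_int k * f x" for k x
    by (cases k rule: int_cases2) (simp_all add: nat f.minus)
  have rat: "f q - f 1 * q = 0" if q: "q \<in> \<rat>" for q
  proof -
    obtain m n where n: "n \<noteq> 0" and qmn: "q = of_int m / of_int n"
      using q by (metis Rats_cases' less_irrefl)
    have "of_int n * f q = f (of_int n * q)" by (simp add: int)
    also have "\<dots> = f (of_int m * 1)" using n qmn by simp
    also have "\<dots> = of_int m * f 1" by (rule int)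
    finally have "f q = of_int m * f 1 / of_int n" using n by (simp add: field_simps)
    then show ?thesis by (simp add: qmn)
  qed
  have "f x - f 1 * x = 0"
    by (rule continuous_constant_on_closure[where S = "\<rat>"])
       (auto simp: Rats_closure_real rat intro!: continuous_intros cont)
  then show ?thesis by simp
qed

text \<open>
  This justifies identifying topological automorphisms of \<open>\<real> \<times> \<int>(2)\<close> with nonzero real numbers.
\<close>

lemma topological_automorphism_iff:
  "topological_automorphism f \<longleftrightarrow> (\<exists>a. a \<noteq> 0 \<and> f = dilation a)"
proof
  assume f: "topological_automorphism f"
  then obtain g where add: "\<And>x y. f (x + y) = f x + f y" and hom: "homeomorphism UNIV UNIV f g"
    unfolding topological_automorphism_def by blast
  have inj: "inj f"
    using hom by (metis homeomorphism_apply1 injI UNIV_I)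
  have cont: "continuous_on UNIV f"
    using hom by (rule homeomorphism_cont1)
  interpret f: Modules.additive f by standard (rule add)
  define a where "a = fst (f (1, 0))"
  have emb: "continuous_on UNIV (\<lambda>t::real. f (t, 0))"
    by (rule continuous_on_compose2[OF cont]) (auto intro!: continuous_intros)
  have fst_f: "fst (f (t, 0)) = a * t" for t
    unfolding a_def
    by (rule continuous_additive_real[where f = "\<lambda>t. fst (f (t, 0))"])
       (use emb in \<open>auto simp flip: add simp: fst_add[symmetric] intro!: continuous_intros\<close>)
  have double: "z + z = 0" for z :: bit
    by (cases z) simp_all
  have snd_f: "snd (f (t, 0)) = 0" for t
  proof -
    have "f (t, 0) = f (t / 2, 0) + f (t / 2, 0)"
      by (simp flip: add)
    then show ?thesis by (simp add: double)
  qed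
  have ft: "f (t, 0) = (a * t, 0)" for t
    using fst_f[of t] snd_f[of t] by (simp add: prod_eq_iff)
  have "f (0, 1) + f (0, 1) = f 0"
    by (simp flip: add add: double zero_prod_def)
  then have "fst (f (0, 1)) + fst (f (0, 1)) = 0"
    by (simp add: f.zero flip: fst_add)
  then have "fst (f (0, 1)) = 0" by simp
  moreover have "f (0, 1) \<noteq> 0"
    using injD[OF inj, of "(0, 1)" 0] f.zero by (auto simp: zero_prod_def)
  ultimately have f1: "f (0, 1) = (0, 1)"
    by (auto simp: prod_eq_iff)
  have "f = dilation a"
  proof
    fix x :: real_z2
    obtain t k where x: "x = (t, k)" by (cases x)
    have "f (t, k) = f (t, 0) + f (0, k)" by (simp flip: add)
    moreover have "f (0, k) = (0, k)"
      by (cases k) (simp_all add: f1 ft)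
    ultimately show "f x = dilation a x"
      by (simp add: x ft dilation_def)
  qed
  moreover have "a \<noteq> 0"
    using injD[OF inj, of "(1, 0)" "(0, 0)"] by (auto simp: ft)
  ultimately show "\<exists>a. a \<noteq> 0 \<and> f = dilation a" by blast
qed (auto intro: topological_automorphism_dilation)


section \<open>Probability distributions and characteristic functions\<close>

definition prob_distribution :: "'a::topological_space measure \<Rightarrow> bool" where
  "prob_distribution \<mu> \<longleftrightarrow> prob_space \<mu> \<and> sets \<mu> = sets borel"

definition pairing :: "real_z2 \<Rightarrow> real_z2 \<Rightarrow> complex" where
  "pairing = (\<lambda>(t, k) (s, l). iexp (t * s) * (if k * l = 1 then - 1 else 1))"

definition char_fun :: "real_z2 measure \<Rightarrow> real_z2 \<Rightarrow> complex" where
  "char_fun \<mu> y = (CLINT x|\<mu>. pairing x y)"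

text \<open>The library's \<^const>\<open>convolution\<close> is restricted to Euclidean spaces.\<close>

definition group_convolution ::
    "'a::{topological_space, ab_group_add} measure \<Rightarrow> 'a measure \<Rightarrow> 'a measure" where
  "group_convolution \<mu> \<nu> = distr (\<mu> \<Otimes>\<^sub>M \<nu>) borel (\<lambda>(x, y). x + y)"

text \<open>
  Symmetry of the conditional distribution of \<open>L\<^sub>2\<close> given \<open>L\<^sub>1\<close>, expressed through the equality of
  the joint distributions of \<open>(L\<^sub>1, L\<^sub>2)\<close> and \<open>(L\<^sub>1, - L\<^sub>2)\<close>.
\<close>

definition conditionally_symmetric ::
    "'w measure \<Rightarrow> ('w \<Rightarrow> 'a::{topological_space, ab_group_add}) \<Rightarrow> ('w \<Rightarrow> 'a) \<Rightarrow> bool" where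
  "conditionally_symmetric M L\<^sub>2 L\<^sub>1 \<longleftrightarrow>
     distr M borel (\<lambda>\<omega>. (L\<^sub>1 \<omega>, L\<^sub>2 \<omega>)) = distr M borel (\<lambda>\<omega>. (L\<^sub>1 \<omega>, - L\<^sub>2 \<omega>))"


section \<open>Gaussian distributions and the classes \<open>\<Lambda>\<close> and \<open>\<Theta>\<close>\<close>

definition gaussian :: "real measure \<Rightarrow> bool" where
  "gaussian \<nu> \<longleftrightarrow>
     (\<exists>m. \<nu> = return borel m) \<or> (\<exists>m \<sigma>. 0 < \<sigma> \<and> \<nu> = density lborel (normal_density m \<sigma>))"

text \<open>\<open>\<Gamma>(\<real>)\<close>, with \<open>\<real>\<close> regarded as the subgroup \<open>\<real> \<times> {0}\<close>.\<close>

definition Gamma_R :: "real_z2 measure set" where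
  "Gamma_R = {distr \<nu> borel (\<lambda>t. (t, 0)) | \<nu>. gaussian \<nu>}"

definition haar_Z2 :: "real_z2 measure" where
  "haar_Z2 = distr (uniform_count_measure (UNIV :: bit set)) borel (\<lambda>k. (0, k))"

definition class_Lambda :: "real_z2 measure set" where
  "class_Lambda = {\<mu>. prob_distribution \<mu> \<and> gaussian (distr \<mu> borel fst)}"

definition class_Theta :: "real_z2 measure set" where
  "class_Theta = {\<mu>. prob_distribution \<mu> \<and>
     (\<exists>\<sigma> \<sigma>' \<beta> \<beta>' \<kappa> :: real. 0 \<le> \<sigma> \<and> 0 \<le> \<sigma>' \<and>
        (\<forall>s. char_fun \<mu> (s, 0) = exp (- \<sigma> * s\<^sup>2 + \<i> * \<beta> * s)) \<and>
        (\<forall>s. char_fun \<mu> (s, 1) = \<kappa> * exp (- \<sigma>' * s\<^sup>2 + \<i> * \<beta>' * s)) \<and>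
        (0 < \<sigma>' \<and> \<sigma>' < \<sigma> \<and> 0 < \<bar>\<kappa>\<bar> \<and>
           \<bar>\<kappa>\<bar> \<le> sqrt (\<sigma>' / \<sigma>) * exp (- (\<beta> - \<beta>')\<^sup>2 / (4 * (\<sigma> - \<sigma>')))
         \<or> \<sigma> = \<sigma>' \<and> \<beta> = \<beta>' \<and> \<bar>\<kappa>\<bar> \<le> 1))}"

end

theory Submission
  imports Defs "HOL-Complex_Analysis.Complex_Analysis" "HOL-Real_Asymp.Real_Asymp"
begin

text \<open>
  With \<open>X\<^sub>j = a\<^sub>j t\<^sub>j\<close>, \<open>c\<^sub>j = b\<^sub>j / a\<^sub>j\<close> for \<open>\<xi>\<^sub>j = (t\<^sub>j, k\<^sub>j)\<close>, conditional symmetry says that both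
  \<open>F\<^sub>j(s) = E exp (i s X\<^sub>j)\<close> and \<open>G\<^sub>j(s) = E (-1)^k\<^sub>j exp (i s X\<^sub>j)\<close> solve Heyde's equation
  \<open>\<Prod> f\<^sub>j(s + c\<^sub>j t) = \<Prod> f\<^sub>j(s - c\<^sub>j t)\<close>.

  For \<open>F\<close>, the logarithms near \<open>0\<close>, summed over equal \<open>c\<^sub>j\<close>, are polynomials. A characteristic
  function that equals an entire function near \<open>0\<close> has all exponential moments (bound the even
  moments by finite differences), so it is the exponential of that polynomial everywhere, and the
  ridge property bounds the degree by 2 (Marcinkiewicz). Cramer's argument passes to the single
  \<open>F\<^sub>j\<close>: entire, without zeros and of order at most 2, hence the exponential of a quadratic polynomial.

  Since \<open>|G\<^sub>j(z)| \<le> F\<^sub>j(i Im z)\<close>, each \<open>G\<^sub>j\<close> is entire of order at most 2. If \<open>G\<^sub>j(z) = 0\<close>, the equation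
  on the line \<open>s + c\<^sub>j t = z\<close> gives \<open>\<Prod> G\<^sub>i(z - (c\<^sub>i + c\<^sub>j) t) = 0\<close> for all \<open>t\<close>, and \<open>c\<^sub>i + c\<^sub>j \<noteq> 0\<close> makes
  some \<open>G\<^sub>i\<close> vanish identically, which means \<open>\<mu>\<^sub>i = \<gamma> * m\<close>. Otherwise every \<open>G\<^sub>j\<close> is a multiple of the
  exponential of a quadratic polynomial, and comparing \<open>|E (-1)^k \<phi>(X)| \<le> E \<phi>(X)\<close> for Gaussian \<open>\<phi>\<close>
  gives the constraints of the class \<open>\<Theta>\<close>.
\<close>

section \<open>Entire functions of order at most two\<close>

text \<open>Negation on \<real> \<times> Z(2) fixes the second coordinate, so conditional symmetry
  reverses the real parameter of \<open>L2\<close> and leaves the sign (-1)^k alone; this is why F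
  and G obey literally the same equation. They cannot be treated alike, though: F has the value 1 at
  0, hence a logarithm near 0, while G may vanish there or identically. So everything local is done
  for F, and G inherits from F only exponential moments, and with them holomorphy and growth. The
  local step starts from mere continuity and gains derivatives by integrating the equation along
  lines. Moments are likewise obtained from differences, since differentiating under the expectation
  would presuppose them. Several j may share one value of c, and the equation sees only the product
  of their F; Cramer's theorem separates them. The bound for \<kappa> in class \<Theta> is the
  infimum of the Gaussian density with parameters \<sigma>, \<beta> divided by the one with
  \<sigma>', \<beta>' (each of variance twice its first parameter).\<close>

lemma entire_quadratic_of_Re_bound:
  fixes g :: "complex \<Rightarrow> complex" and C :: real
  assumes hol: "g holomorphic_on UNIV" and bd: "\<And>z. Re (g z) \<le> C * (1 + norm z ^ 2)"
  obtains c0 c1 c2 where "\<And>z. g z = c0 + c1 * z + c2 * z ^ 2"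
proof -
  \<comment> \<open>Subtracting \<open>g 0\<close> gives \<open>h 0 = 0\<close>, as the Schwarz
    lemma requires; the summand 1 in \<open>K\<close> makes the bound strict.\<close>
  define h where "h z = g z - g 0" for z
  define K where "K = \<bar>C\<bar> + norm (g 0) + 1"
  have K: "K > 0" unfolding K_def by (intro add_nonneg_pos) auto
  have holh: "h holomorphic_on UNIV" unfolding h_def by (intro holomorphic_intros hol)
  have Reh: "Re (h z) < K * (1 + norm z ^ 2)" for z
  proof -
    have "Re (h z) \<le> C * (1 + norm z ^ 2) + norm (g 0)"
      using bd[of z] abs_Re_le_cmod[of "g 0"] unfolding h_def by simp
    also have "\<dots> < (\<bar>C\<bar> + norm (g 0) + 1) * (1 + norm z ^ 2)"
    proof -
      have "C * (1 + norm z ^ 2) \<le> \<bar>C\<bar> * (1 + norm z ^ 2)" by (intro mult_right_mono) auto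
      moreover have "norm (g 0) * 1 \<le> norm (g 0) * (1 + norm z ^ 2)" by (intro mult_left_mono) auto
      moreover have "(0::real) < 1 + norm z ^ 2" by (simp add: add_pos_nonneg)
      ultimately show ?thesis unfolding distrib_right mult_1_left mult_1_right by linarith
    qed
    finally show ?thesis unfolding K_def .
  qed
  text \<open>Borel--Caratheodory: \<open>h / (2A - h)\<close> maps the disc of radius \<open>2R\<close> into the unit disc when
    \<open>Re h < A\<close> there.\<close>
  have normh: "norm (h z) \<le> 2 * (K * (1 + 4 * norm z ^ 2))" for z
  proof (cases "z = 0")
    case True
    then show ?thesis using K by (simp add: h_def)
  next
    case False
    define R where "R = norm z"
    have R: "R > 0" using False by (simp add: R_def)
    define A where "A = K * (1 + 4 * R ^ 2)"
    have A: "A > 0" unfolding A_def using K by (intro mult_pos_pos) (auto simp: add_pos_nonneg)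
    \<comment> \<open>The point of norm 1/2 that corresponds to \<open>z\<close> in the disc of
      radius \<open>2 * R\<close>. Schwarz gives norm at most 1/2 for \<open>\<phi> w0\<close>,
      hence \<open>norm (h z) \<le> (2 * A + norm (h z)) / 2\<close>, which is a bound by
      \<open>2 * A\<close>.\<close>
    define w0 where "w0 = z / (2 * of_real R)"
    have w0: "norm w0 = 1/2" using R by (simp add: w0_def norm_divide R_def)
    define \<phi> where "\<phi> w = h (2 * of_real R * w) / (2 * of_real A - h (2 * of_real R * w))" for w
    have Rel: "Re (h (2 * of_real R * w)) < A" if "norm w < 1" for w
    proof -
      have "norm (2 * of_real R * w) ^ 2 \<le> (2 * R) ^ 2"
        using that R by (intro power_mono) (auto simp: norm_mult)
      then have "K * (1 + norm (2 * of_real R * w) ^ 2) \<le> A"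
        unfolding A_def using K by (intro mult_left_mono) (auto simp: power_mult_distrib)
      then show ?thesis using Reh[of "2 * of_real R * w"] by simp
    qed
    have nz: "2 * of_real A - h (2 * of_real R * w) \<noteq> 0" if "norm w < 1" for w
    proof
      assume "2 * of_real A - h (2 * of_real R * w) = 0"
      then have "Re (h (2 * of_real R * w)) = 2 * A" by (simp add: complex_eq_iff)
      with Rel[OF that] A show False by simp
    qed
    have holc: "(\<lambda>w. h (2 * of_real R * w)) holomorphic_on ball 0 1"
      using holomorphic_on_compose_gen[OF _ holh, of "\<lambda>w. 2 * of_real R * w" "ball 0 1"]
      by (auto simp: o_def intro!: holomorphic_intros)
    have hol\<phi>: "\<phi> holomorphic_on ball 0 1"
      unfolding \<phi>_def by (intro holomorphic_intros holc) (use nz in auto)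
    have no: "norm (\<phi> w) < 1" if "norm w < 1" for w
    proof -
      let ?u = "h (2 * of_real R * w)"
      have "norm ?u ^ 2 < norm (2 * of_real A - ?u) ^ 2"
      proof -
        have "norm (2 * of_real A - ?u) ^ 2 - norm ?u ^ 2 = 4 * A * (A - Re ?u)"
          unfolding cmod_power2 by (simp add: power2_eq_square algebra_simps)
        also have "\<dots> > 0" using A Rel[OF that] by simp
        finally show ?thesis by simp
      qed
      then have "norm ?u < norm (2 * of_real A - ?u)" by (rule power2_less_imp_less) simp
      then show ?thesis unfolding \<phi>_def using nz[OF that] by (simp add: norm_divide)
    qed
    have "norm (\<phi> w0) \<le> norm w0"
      using Schwarz_Lemma(1)[OF hol\<phi> _ no] w0 by (simp add: \<phi>_def h_def)
    moreover have "2 * of_real R * w0 = z" using R by (simp add: w0_def)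
    ultimately have "norm (h z / (2 * of_real A - h z)) \<le> 1/2"
      using w0 by (simp add: \<phi>_def)
    moreover have "norm (2 * of_real A - h z) > 0" using nz[of w0] w0 R by (simp add: w0_def)
    ultimately have "norm (h z) \<le> norm (2 * of_real A - h z) / 2"
      by (simp add: norm_divide field_simps)
    also have "\<dots> \<le> (2 * A + norm (h z)) / 2"
      using norm_triangle_ineq4[of "2 * of_real A" "h z"] A by (simp add: norm_mult)
    finally show ?thesis by (simp add: A_def R_def)
  qed
  have "norm (h z) \<le> (10 * K) * norm z ^ 2" if "1 \<le> norm z" for z
  proof -
    have "1 \<le> norm z ^ 2" using that by (rule one_le_power)
    then have "2 * (K * (1 + 4 * norm z ^ 2)) \<le> 2 * (K * (5 * norm z ^ 2))"
      using K by (intro mult_left_mono) auto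
    then show ?thesis using normh[of z] by simp
  qed
  note bound = this
  have S: "(\<Sum>k\<le>2. F k) = F 0 + F 1 + F 2" for F :: "nat \<Rightarrow> complex"
    by (simp add: eval_nat_numeral)
  have "h z = h 0 + deriv h 0 * z + ((deriv^^2) h 0 / 2) * z ^ 2" for z
    using Liouville_polynomial[OF holh bound, where \<xi> = z]
    unfolding S by (simp add: fact_2)
  then have "g z = (g 0 + h 0) + deriv h 0 * z + ((deriv^^2) h 0 / 2) * z ^ 2" for z
    using h_def[of z] by (metis add.assoc add_diff_cancel_left' diff_add_cancel add.commute)
  then show ?thesis by (rule that)
qed

text \<open>The plane is contractible, so a zero-free entire function is \<open>exp g\<close> with
  \<open>g\<close> entire, and the growth bound becomes a one-sided bound for
  \<open>Re (g z)\<close>. This is the zero-free case of Hadamard's factorization for order at most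
  2.\<close>

lemma entire_nonvanishing_eq_exp_quadratic:
  fixes f :: "complex \<Rightarrow> complex" and C :: real
  assumes hol: "f holomorphic_on UNIV" and nz: "\<And>z. f z \<noteq> 0"
    and bd: "\<And>z. norm (f z) \<le> exp (C * (1 + norm z ^ 2))"
  obtains c0 c1 c2 where "\<And>z. f z = exp (c0 + c1 * z + c2 * z ^ 2)"
proof -
  obtain g where g: "g holomorphic_on UNIV" "\<And>z. f z = exp (g z)"
    using contractible_imp_holomorphic_log[OF hol] nz
    by (metis UNIV_I contractible_UNIV)
  have "Re (g z) \<le> C * (1 + norm z ^ 2)" for z
    using bd[of z] g(2)[of z] by simp
  from entire_quadratic_of_Re_bound[OF g(1) this] g(2) show ?thesis
    using that by metis
qed

text \<open>The hypothesis is the ridge inequality for \<open>exp P\<close>, in logarithms. Dividing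
  by \<open>r ^ d\<close> along a ray leaves only the leading term, so the inequality passes to
  \<open>A * w ^ d\<close>, which attains its maximum on the unit circle too often once
  \<open>d \<ge> 3\<close>.\<close>

lemma degree_le_2_of_ridge:
  fixes P :: "complex poly"
  assumes ridge: "\<And>z. Re (poly P z) \<le> Re (poly P (\<i> * of_real (Im z)))"
  shows "degree P \<le> 2"
proof (rule ccontr)
  assume "\<not> degree P \<le> 2"
  then have d: "degree P \<ge> 3" by simp
  define d where "d = degree P"
  define A where "A = lead_coeff P"
  have A0: "A \<noteq> 0" using d by (auto simp: A_def)
  have lim: "((\<lambda>r. poly P (of_real r * w) / of_real r ^ d) \<longlongrightarrow> A * w ^ d) at_top" for w
  proof -
    have eq: "poly P (of_real r * w) / of_real r ^ d =
        (\<Sum>i\<le>d. coeff P i * w ^ i * of_real (r powi (int i - int d)))" if "r > 0" for r :: real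
      using that by (simp add: poly_altdef d_def sum_divide_distrib power_int_diff power_mult_distrib
          mult_ac)
    moreover have "((\<lambda>r::real. \<Sum>i\<le>d. coeff P i * w ^ i * of_real (r powi (int i - int d)))
        \<longlongrightarrow> (\<Sum>i\<le>d. coeff P i * w ^ i * of_real (if i = d then 1 else 0))) at_top"
    proof (intro tendsto_intros)
      fix i assume i: "i \<in> {..d}"
      show "((\<lambda>r::real. r powi (int i - int d)) \<longlongrightarrow> (if i = d then 1 else 0)) at_top"
      proof (cases "i = d")
        case False
        then have "0 < d - i" using i by simp
        have "((\<lambda>r::real. inverse (r ^ (d - i))) \<longlongrightarrow> 0) at_top"
          by (rule tendsto_inverse_0_at_top) (use \<open>0 < d - i\<close> in \<open>intro filterlim_pow_at_top filterlim_ident\<close>)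
        moreover have "r powi (int i - int d) = inverse (r ^ (d - i))" for r :: real
        proof -
          have e: "int i - int d = - int (d - i)" using i by simp
          show ?thesis unfolding e power_int_minus by simp
        qed
        ultimately show ?thesis using False by simp
      qed simp
    qed
    moreover have "(\<Sum>i\<le>d. coeff P i * w ^ i * of_real (if i = d then 1 else 0)) = A * w ^ d"
    proof -
      have "(\<Sum>i\<le>d. coeff P i * w ^ i * of_real (if i = d then 1 else 0))
          = (\<Sum>i\<in>{d}. coeff P i * w ^ i)"
        by (rule sum.mono_neutral_cong_right) auto
      then show ?thesis by (simp add: A_def d_def)
    qed
    ultimately have "((\<lambda>r::real. \<Sum>i\<le>d. coeff P i * w ^ i * of_real (r powi (int i - int d)))
        \<longlongrightarrow> A * w ^ d) at_top" by simp
    then show ?thesis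
    proof (rule Lim_transform_eventually)
      show "\<forall>\<^sub>F r in at_top. (\<Sum>i\<le>d. coeff P i * w ^ i * of_real (r powi (int i - int d)))
          = poly P (of_real r * w) / of_real r ^ d"
        using eventually_gt_at_top[of "0::real"] by eventually_elim (rule eq[symmetric])
    qed
  qed
  have ray: "Re (A * w ^ d) \<le> Re (A * (\<i> * of_real (Im w)) ^ d)" for w
  proof (rule tendsto_le)
    show "((\<lambda>r. Re (poly P (of_real r * w) / of_real r ^ d)) \<longlongrightarrow> Re (A * w ^ d)) at_top"
      by (intro tendsto_intros lim)
    show "((\<lambda>r. Re (poly P (of_real r * (\<i> * of_real (Im w))) / of_real r ^ d))
        \<longlongrightarrow> Re (A * (\<i> * of_real (Im w)) ^ d)) at_top"
      by (intro tendsto_intros lim)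
    show "\<forall>\<^sub>F r in at_top. Re (poly P (of_real r * w) / of_real r ^ d)
        \<le> Re (poly P (of_real r * (\<i> * of_real (Im w))) / of_real r ^ d)"
      using eventually_gt_at_top[of "0::real"]
    proof eventually_elim
      case (elim r)
      have "Re (poly P (of_real r * w)) \<le> Re (poly P (of_real r * (\<i> * of_real (Im w))))"
        using ridge[of "of_real r * w"] by (simp add: mult_ac)
      moreover have "Re (u / of_real r ^ d) = Re u / r ^ d" for u
        by (metis Re_divide_of_real of_real_power)
      ultimately show ?case using elim by (metis divide_right_mono less_imp_le zero_less_power)
    qed
  qed simp
  text \<open>At a point of the unit circle where \<open>A w\<^sup>d = |A|\<close> the inequality forces \<open>w = \<plusminus>\<i>\<close>, but there
    are \<open>d > 2\<close> such points.\<close>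
  have key: "w\<^sup>2 = -1" if "norm w = 1" "A * w ^ d = of_real (norm A)" for w
  proof -
    have "norm A \<le> Re (A * (\<i> * of_real (Im w)) ^ d)" using ray[of w] that(2) by simp
    also have "\<dots> \<le> norm A * \<bar>Im w\<bar> ^ d"
      using complex_Re_le_cmod[of "A * (\<i> * of_real (Im w)) ^ d"] by (simp add: norm_mult norm_power)
    finally have "1 \<le> \<bar>Im w\<bar> ^ d" using A0 by simp
    then have "1 \<le> \<bar>Im w\<bar>"
      using power_strict_mono[of "\<bar>Im w\<bar>" 1 d] d by (fastforce simp: d_def)
    moreover have "(Re w)\<^sup>2 + (Im w)\<^sup>2 = 1" using that(1) by (metis cmod_power2 one_power2)
    ultimately have "Re w = 0 \<and> (Im w)\<^sup>2 = 1"
      by (smt (verit) one_le_power power2_abs zero_le_power2 power2_eq_iff zero_eq_power2)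
    then show ?thesis by (simp add: complex_eq_iff power2_eq_square)
  qed
  \<comment> \<open>\<open>w\<close> rotates the leading coefficient to the positive axis and
    \<open>\<omega>\<close> is a primitive \<open>d\<close>-th root of unity, so \<open>key\<close>
    applies to \<open>w\<close> and to \<open>w * \<omega>\<close>. Then
    \<open>\<omega>\<^sup>2 = 1\<close>, which forces \<open>d\<close> to divide 2.\<close>
  define \<theta> where "\<theta> = - Arg A / d"
  define w where "w = cis \<theta>"
  define \<omega> where "\<omega> = cis (2 * pi / d)"
  have dpos: "real d > 0" using d d_def by simp
  have A_polar: "A = of_real (norm A) * cis (Arg A)" using A0 by (metis rcis_cmod_Arg rcis_def)
  have e: "real d * \<theta> = - Arg A" "real d * (2 * pi / real d) = 2 * pi"
    using dpos by (simp_all add: \<theta>_def)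
  have "cis (Arg A) * w ^ d = 1" unfolding w_def Complex.DeMoivre e cis_mult by simp
  then have wd: "A * w ^ d = of_real (norm A)"
    by (subst A_polar) (simp only: mult.assoc mult_1_right)
  have "\<omega> ^ d = 1" unfolding \<omega>_def Complex.DeMoivre e by simp
  then have "A * (w * \<omega>) ^ d = of_real (norm A)"
    using wd unfolding power_mult_distrib by simp
  then have "(w * \<omega>)\<^sup>2 = -1" by (intro key) (simp_all add: w_def \<omega>_def norm_mult)
  moreover have "w\<^sup>2 = -1" by (intro key wd) (simp add: w_def)
  ultimately have "\<omega>\<^sup>2 = 1" unfolding power_mult_distrib by simp
  then have "cis (4 * pi / d) = 1" unfolding \<omega>_def Complex.DeMoivre by simp
  then have c: "cos (4 * pi / d) = 1" by (simp add: complex_eq_iff)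
  then obtain k :: int where "4 * pi / d = real_of_int k * 2 * pi" unfolding cos_one_2pi_int by blast
  then have "2 = of_int k * real d" using dpos by (simp add: field_simps)
  then have k: "2 = k * int d" by (metis of_int_eq_iff of_int_mult of_int_numeral of_int_of_nat_eq)
  then have "int d dvd 2" by (metis dvd_triv_right)
  then show False using d d_def zdvd_imp_le[of "int d" 2] by simp
qed


section \<open>Sums of shifts of continuous functions\<close>

text \<open>Logarithms of characteristic functions are a priori only continuous; this gain of one
  derivative lets the induction below differentiate the equation. The interval shrinks to a quarter
  so that all arguments that occur stay in \<open>{-r..r}\<close>.\<close>

lemma continuous_shift_sum_C1:
  fixes E :: "real set" and \<phi> :: "real \<Rightarrow> real \<Rightarrow> complex"
  assumes fin: "finite E" and r: "r > 0"
    and cont: "\<And>d. d \<in> E \<Longrightarrow> continuous_on {-r..r} (\<phi> d)"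
    and eq: "\<And>s t. \<bar>s\<bar> \<le> r \<Longrightarrow> \<bar>t\<bar> \<le> r \<Longrightarrow> (\<Sum>d\<in>E. \<phi> d (s + d * t)) = 0"
    and e: "e \<in> E"
  shows "\<exists>\<psi>. continuous_on {-r/4..r/4} \<psi> \<and>
    (\<forall>x. \<bar>x\<bar> < r/4 \<longrightarrow> (\<phi> e has_vector_derivative \<psi> x) (at x))"
proof -
  \<comment> \<open>\<open>K\<close> bounds every coefficient and \<open>\<eta> * K = r / 4\<close>,
    so for \<open>0 \<le> t \<le> \<eta>\<close> the shift \<open>(d - e) * t\<close> is at most
    \<open>r / 2\<close> and \<open>e * t\<close> at most \<open>r / 4\<close> in absolute
    value.\<close>
  define K where "K = 1 + (\<Sum>d\<in>E. \<bar>d\<bar>)"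
  have K1: "K \<ge> 1" unfolding K_def by (simp add: sum_nonneg)
  have Kd: "\<bar>d\<bar> \<le> K" if "d \<in> E" for d
    unfolding K_def using member_le_sum[OF that, of abs] fin by simp
  define \<eta> where "\<eta> = r / (4 * K)"
  have \<eta>: "\<eta> > 0" "\<eta> * K = r / 4" "\<eta> \<le> r / 4"
    using r K1 by (auto simp: \<eta>_def field_simps)
  define \<Phi> where "\<Phi> d x = integral {-r..x} (\<phi> d)" for d x
  have \<Phi>: "(\<Phi> d has_vector_derivative \<phi> d x) (at x)" if "d \<in> E" "\<bar>x\<bar> < r" for d x
  proof -
    have "(\<Phi> d has_vector_derivative \<phi> d x) (at x within {-r..r})"
      unfolding \<Phi>_def using that by (intro integral_has_vector_derivative cont) auto
    moreover have "x \<in> interior {-r..r}" using that(2) by auto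
    ultimately show ?thesis by (metis at_within_interior)
  qed
  have small: "\<bar>x + (d - e) * t\<bar> \<le> 3 * r / 4" if "d \<in> E" "\<bar>x\<bar> \<le> r/4" "0 \<le> t" "t \<le> \<eta>" for d x t
  proof -
    have "\<bar>d - e\<bar> \<le> 2 * K" using Kd[OF that(1)] Kd[OF e] by linarith
    moreover have "\<bar>t\<bar> \<le> \<eta>" using that(3,4) by simp
    ultimately have "\<bar>(d - e) * t\<bar> \<le> (2 * K) * \<eta>"
      unfolding abs_mult using K1 by (intro mult_mono) linarith+
    then have "\<bar>(d - e) * t\<bar> \<le> 2 * (\<eta> * K)" by (simp only: mult_ac)
    then show ?thesis using that(2) \<eta>(2) by linarith
  qed
  have small_e: "\<bar>x - e * t\<bar> \<le> r" if "\<bar>x\<bar> \<le> r/4" "0 \<le> t" "t \<le> \<eta>" for x t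
  proof -
    have "\<bar>e * t\<bar> \<le> K * \<eta>"
      unfolding abs_mult using Kd[OF e] that(2,3) K1 by (intro mult_mono) linarith+
    then have "\<bar>e * t\<bar> \<le> \<eta> * K" by (simp only: mult.commute)
    then show ?thesis using \<eta>(2) that(1) r by linarith
  qed
  define E' where "E' = E - {e}"
  text \<open>On the line \<open>s + e t = x\<close> the term of \<open>e\<close> is constant in \<open>t\<close>; integrating over \<open>t\<close>
    gains one derivative.\<close>
  have rep: "\<phi> e x = (\<Sum>d\<in>E'. inverse (\<eta> * (d - e)) *\<^sub>R (\<Phi> d x - \<Phi> d (x + (d - e) * \<eta>)))"
    if x: "\<bar>x\<bar> \<le> r/4" for x
  proof -
    \<comment> \<open>The derivative of \<open>H\<close> is the left side of the equation on the
      line through \<open>x\<close>, hence 0; \<open>H 0 = H \<eta>\<close> then solves for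
      \<open>\<phi> e x\<close> in terms of the antiderivatives \<open>\<Phi> d\<close>.\<close>
    define H where "H t = (\<Sum>d\<in>E'. inverse (d - e) *\<^sub>R \<Phi> d (x + (d - e) * t)) + t *\<^sub>R \<phi> e x" for t
    have "(H has_vector_derivative 0) (at t within {0..\<eta>})" if t: "t \<in> {0..\<eta>}" for t
    proof -
      have "((\<lambda>t. inverse (d - e) *\<^sub>R \<Phi> d (x + (d - e) * t)) has_vector_derivative
          inverse (d - e) *\<^sub>R ((d - e) *\<^sub>R \<phi> d (x + (d - e) * t))) (at t)" if "d \<in> E'" for d
      proof -
        have lin: "((\<lambda>t. x + (d - e) * t) has_vector_derivative (d - e)) (at t)"
          by (auto intro!: derivative_eq_intros simp flip: has_real_derivative_iff_has_vector_derivative)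
        have "\<bar>x + (d - e) * t\<bar> < r" using small[of d x t] that x t r by (auto simp: E'_def)
        then have "(\<Phi> d has_vector_derivative \<phi> d (x + (d - e) * t)) (at (x + (d - e) * t))"
          using that by (intro \<Phi>) (auto simp: E'_def)
        from vector_diff_chain_at[OF lin this] show ?thesis
          by (intro has_vector_derivative_scaleR[OF DERIV_const, simplified]) (simp add: o_def)
      qed
      then have "((\<lambda>t. \<Sum>d\<in>E'. inverse (d - e) *\<^sub>R \<Phi> d (x + (d - e) * t)) has_vector_derivative
          (\<Sum>d\<in>E'. inverse (d - e) *\<^sub>R ((d - e) *\<^sub>R \<phi> d (x + (d - e) * t)))) (at t)"
        by (rule has_vector_derivative_sum)
      moreover have "((\<lambda>t. t *\<^sub>R \<phi> e x) has_vector_derivative \<phi> e x) (at t)"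
        by (auto intro!: derivative_eq_intros)
      ultimately have "(H has_vector_derivative
          (\<Sum>d\<in>E'. inverse (d - e) *\<^sub>R ((d - e) *\<^sub>R \<phi> d (x + (d - e) * t))) + \<phi> e x) (at t)"
        unfolding H_def by (rule has_vector_derivative_add)
      moreover have "(\<Sum>d\<in>E'. inverse (d - e) *\<^sub>R ((d - e) *\<^sub>R \<phi> d (x + (d - e) * t))) + \<phi> e x = 0"
      proof -
        have "(\<Sum>d\<in>E'. inverse (d - e) *\<^sub>R ((d - e) *\<^sub>R \<phi> d (x + (d - e) * t)))
            = (\<Sum>d\<in>E'. \<phi> d ((x - e * t) + d * t))"
        proof (intro sum.cong refl)
          fix d assume "d \<in> E'"
          then have "d - e \<noteq> 0" by (auto simp: E'_def)
          moreover have "x + (d - e) * t = (x - e * t) + d * t" by (simp add: algebra_simps)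
          ultimately show "inverse (d - e) *\<^sub>R ((d - e) *\<^sub>R \<phi> d (x + (d - e) * t)) = \<phi> d ((x - e * t) + d * t)"
            by (simp only: scaleR_scaleR left_inverse scaleR_one not_False_eq_True)
        qed
        also have "\<dots> + \<phi> e x = (\<Sum>d\<in>E. \<phi> d ((x - e * t) + d * t))"
          using fin e by (simp add: E'_def sum.remove[of E e])
        also have "\<dots> = 0" using small_e[of x t] x t \<eta> r by (intro eq) auto
        finally show ?thesis .
      qed
      ultimately show ?thesis by (metis has_vector_derivative_at_within)
    qed
    then obtain c where c: "\<And>t. t \<in> {0..\<eta>} \<Longrightarrow> H t = c"
      using has_vector_derivative_zero_constant[of "{0..\<eta>}" H] by auto
    have "H 0 = H \<eta>" using c[of 0] c[of \<eta>] \<eta> by simp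
    then have "\<eta> *\<^sub>R \<phi> e x = (\<Sum>d\<in>E'. inverse (d - e) *\<^sub>R (\<Phi> d x - \<Phi> d (x + (d - e) * \<eta>)))"
      by (simp add: H_def scaleR_diff_right sum_subtractf algebra_simps)
    then have "\<phi> e x = inverse \<eta> *\<^sub>R (\<Sum>d\<in>E'. inverse (d - e) *\<^sub>R (\<Phi> d x - \<Phi> d (x + (d - e) * \<eta>)))"
      using \<eta>(1) by (metis less_irrefl scaleR_one left_inverse scaleR_scaleR)
    then show ?thesis by (simp add: scaleR_sum_right inverse_mult_distrib)
  qed
  define \<psi> where "\<psi> x = (\<Sum>d\<in>E'. inverse (\<eta> * (d - e)) *\<^sub>R (\<phi> d x - \<phi> d (x + (d - e) * \<eta>)))" for x
  have "continuous_on {-r/4..r/4} \<psi>"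
    unfolding \<psi>_def
  proof (intro continuous_on_sum continuous_on_scaleR continuous_on_const continuous_on_diff)
    fix d assume d: "d \<in> E'"
    show "continuous_on {-r/4..r/4} (\<phi> d)"
      by (rule continuous_on_subset[OF cont]) (use d r in \<open>auto simp: E'_def\<close>)
    show "continuous_on {-r/4..r/4} (\<lambda>x. \<phi> d (x + (d - e) * \<eta>))"
    proof (rule continuous_on_compose2[OF cont])
      show "d \<in> E" using d by (simp add: E'_def)
      show "continuous_on {- r / 4..r / 4} (\<lambda>x. x + (d - e) * \<eta>)" by (intro continuous_intros)
      show "(\<lambda>x. x + (d - e) * \<eta>) ` {- r / 4..r / 4} \<subseteq> {- r..r}"
      proof (clarify)
        fix x assume "x \<in> {-r/4..r/4}"
        then have "\<bar>x + (d - e) * \<eta>\<bar> \<le> 3 * r / 4" using small[of d x \<eta>] d \<eta> by (auto simp: E'_def)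
        then have "\<bar>x + (d - e) * \<eta>\<bar> \<le> r" using r by linarith
        then show "x + (d - e) * \<eta> \<in> {-r..r}" unfolding abs_le_iff atLeastAtMost_iff by linarith
      qed
    qed
  qed
  moreover have "(\<phi> e has_vector_derivative \<psi> x) (at x)" if "\<bar>x\<bar> < r/4" for x
  proof -
    have "((\<lambda>x. inverse (\<eta> * (d - e)) *\<^sub>R (\<Phi> d x - \<Phi> d (x + (d - e) * \<eta>))) has_vector_derivative
        inverse (\<eta> * (d - e)) *\<^sub>R (\<phi> d x - \<phi> d (x + (d - e) * \<eta>))) (at x)" if d: "d \<in> E'" for d
    proof -
      have lin: "((\<lambda>x. x + (d - e) * \<eta>) has_vector_derivative 1) (at x)"
        by (auto intro!: derivative_eq_intros simp flip: has_real_derivative_iff_has_vector_derivative)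
      have "\<bar>x + (d - e) * \<eta>\<bar> < r" using small[of d x \<eta>] d \<eta> \<open>\<bar>x\<bar> < r/4\<close> r by (auto simp: E'_def)
      then have "(\<Phi> d has_vector_derivative \<phi> d (x + (d - e) * \<eta>)) (at (x + (d - e) * \<eta>))"
        using d by (intro \<Phi>) (auto simp: E'_def)
      from vector_diff_chain_at[OF lin this]
      have "((\<lambda>x. \<Phi> d (x + (d - e) * \<eta>)) has_vector_derivative \<phi> d (x + (d - e) * \<eta>)) (at x)"
        by (simp add: o_def)
      moreover have "(\<Phi> d has_vector_derivative \<phi> d x) (at x)"
        using d \<open>\<bar>x\<bar> < r/4\<close> r by (intro \<Phi>) (auto simp: E'_def)
      ultimately show ?thesis
        by (intro has_vector_derivative_scaleR[OF DERIV_const, simplified] has_vector_derivative_diff)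
    qed
    then have "((\<lambda>x. \<Sum>d\<in>E'. inverse (\<eta> * (d - e)) *\<^sub>R (\<Phi> d x - \<Phi> d (x + (d - e) * \<eta>)))
        has_vector_derivative \<psi> x) (at x)"
      unfolding \<psi>_def by (rule has_vector_derivative_sum)
    then show ?thesis
      by (rule has_vector_derivative_transform_within_open[of _ _ _ "{-r/4<..<r/4}"])
         (use \<open>\<bar>x\<bar> < r/4\<close> rep in auto)
  qed
  ultimately show ?thesis by blast
qed

lemma pderiv_surj:
  fixes Q :: "'a::field_char_0 poly"
  obtains P where "pderiv P = Q"
proof -
  define P where "P = (\<Sum>i\<le>degree Q. monom (coeff Q i / of_nat (Suc i)) (Suc i))"
  have "pderiv (\<Sum>i\<in>A. f i) = (\<Sum>i\<in>A. pderiv (f i))" for f :: "nat \<Rightarrow> 'a poly" and A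
    by (induction A rule: infinite_finite_induct) (simp_all add: pderiv_add)
  then have "pderiv P = (\<Sum>i\<le>degree Q. monom (coeff Q i) i)"
    unfolding P_def by (simp add: pderiv_monom del: of_nat_Suc)
  then have "pderiv P = Q" by (simp add: poly_as_sum_of_monoms)
  then show ?thesis by (rule that)
qed

text \<open>The direction \<open>(- e, 1)\<close> in the plane of \<open>(s, t)\<close> keeps
  \<open>s + e * t\<close> fixed. Differentiating along it removes the term of \<open>e\<close> and
  leaves an equation of the same kind for the functions \<open>(d - e) * \<psi> d\<close>,
  \<open>d \<in> D\<close>, to which the induction hypothesis applies. Integration recovers
  \<open>\<phi> d\<close>, and \<open>\<phi> e\<close> is read off at \<open>t = 0\<close>.\<close>

theorem continuous_shift_sum_polynomial:
  fixes D :: "real set" and \<phi> :: "real \<Rightarrow> real \<Rightarrow> complex"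
  assumes "finite D" and "r > 0"
    and "\<And>d. d \<in> D \<Longrightarrow> continuous_on {-r..r} (\<phi> d)"
    and "\<And>s t. \<bar>s\<bar> \<le> r \<Longrightarrow> \<bar>t\<bar> \<le> r \<Longrightarrow> (\<Sum>d\<in>D. \<phi> d (s + d * t)) = 0"
  shows "\<exists>\<rho>>0. \<forall>d\<in>D. \<exists>P. \<forall>x. \<bar>x\<bar> \<le> \<rho> \<longrightarrow> \<phi> d x = poly P (of_real x)"
  using assms
proof (induction D arbitrary: r \<phi> rule: finite_induct)
  case empty
  then show ?case by auto
next
  case (insert e D)
  let ?E = "insert e D"
  note r = insert.prems(1) and cont = insert.prems(2) and eq = insert.prems(3)
  define q where "q = r / 4"
  have q: "q > 0" "q \<le> r" using r by (auto simp: q_def)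
  have "\<forall>d\<in>?E. \<exists>\<psi>. continuous_on {-q..q} \<psi> \<and>
      (\<forall>x. \<bar>x\<bar> < q \<longrightarrow> (\<phi> d has_vector_derivative \<psi> x) (at x))"
    using continuous_shift_sum_C1[of ?E r \<phi>] insert r by (auto simp: q_def)
  then obtain \<psi> where \<psi>c: "\<And>d. d \<in> ?E \<Longrightarrow> continuous_on {-q..q} (\<psi> d)"
    and \<psi>d: "\<And>d x. d \<in> ?E \<Longrightarrow> \<bar>x\<bar> < q \<Longrightarrow> (\<phi> d has_vector_derivative \<psi> d x) (at x)"
    by (metis (no_types, lifting) bchoice)
  define K where "K = 1 + (\<Sum>d\<in>?E. \<bar>d\<bar>)"
  have K1: "K \<ge> 1" unfolding K_def by (simp add: sum_nonneg)
  have Kd: "\<bar>d\<bar> \<le> K" if "d \<in> ?E" for d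
    unfolding K_def using member_le_sum[OF that, of abs] insert.hyps(1) by simp
  \<comment> \<open>\<open>p * K = q / 4\<close> keeps \<open>s + d * t\<close> where
    \<open>\<psi> d\<close> is the derivative of \<open>\<phi> d\<close>, and the displaced points
    \<open>s - e * h\<close>, \<open>t + h\<close> in the range of \<open>eq\<close>.\<close>
  define p where "p = q / (4 * K)"
  have p: "p > 0" "p * K = q / 4" "p \<le> q / 4"
    using q K1 by (auto simp: p_def field_simps)
  have step: "(\<Sum>d\<in>D. of_real (d - e) * \<psi> d (s + d * t)) = 0" if s: "\<bar>s\<bar> \<le> p" and t: "\<bar>t\<bar> \<le> p" for s t
  proof -
    have "((\<lambda>h. \<phi> d ((s - e * h) + d * (t + h))) has_vector_derivative (d - e) *\<^sub>R \<psi> d (s + d * t)) (at 0)"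
      if d: "d \<in> ?E" for d
    proof -
      have lin: "((\<lambda>h. (s - e * h) + d * (t + h)) has_vector_derivative (d - e)) (at 0)"
        by (auto intro!: derivative_eq_intros simp flip: has_real_derivative_iff_has_vector_derivative)
      have "\<bar>d * t\<bar> \<le> K * p"
        unfolding abs_mult using Kd[OF d] t K1 by (intro mult_mono) linarith+
      then have "\<bar>d * t\<bar> \<le> p * K" by (simp only: mult.commute)
      then have "\<bar>s + d * t\<bar> < q" using p s q by linarith
      then have "(\<phi> d has_vector_derivative \<psi> d (s + d * t)) (at ((s - e * 0) + d * (t + 0)))"
        using \<psi>d[OF d] by simp
      from vector_diff_chain_at[OF lin this] show ?thesis by (simp add: o_def)
    qed
    then have "((\<lambda>h. \<Sum>d\<in>?E. \<phi> d ((s - e * h) + d * (t + h))) has_vector_derivative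
        (\<Sum>d\<in>?E. (d - e) *\<^sub>R \<psi> d (s + d * t))) (at 0)"
      by (rule has_vector_derivative_sum)
    then have "((\<lambda>h. 0) has_vector_derivative (\<Sum>d\<in>?E. (d - e) *\<^sub>R \<psi> d (s + d * t))) (at 0)"
    proof (rule has_vector_derivative_transform_within_open[of _ _ _ "{-p<..<p}"])
      fix h assume h: "h \<in> {-p<..<p}"
      have "\<bar>e\<bar> \<le> K" "\<bar>h\<bar> \<le> p" using Kd[of e] h by auto
      then have "\<bar>e * h\<bar> \<le> K * p" unfolding abs_mult using K1 by (intro mult_mono) linarith+
      then have "\<bar>e * h\<bar> \<le> p * K" by (simp only: mult.commute)
      then have "\<bar>s - e * h\<bar> \<le> r" using p s q by linarith
      moreover have "\<bar>t + h\<bar> \<le> r"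
        using t \<open>\<bar>h\<bar> \<le> p\<close> p(3) q by linarith
      ultimately show "(\<Sum>d\<in>?E. \<phi> d ((s - e * h) + d * (t + h))) = 0" by (rule eq)
    qed (use p in auto)
    then have "(\<Sum>d\<in>?E. (d - e) *\<^sub>R \<psi> d (s + d * t)) = 0"
      using vector_derivative_unique_at has_vector_derivative_const by blast
    then show ?thesis using insert.hyps by (simp add: scaleR_conv_of_real)
  qed
  have "\<exists>\<rho>>0. \<forall>d\<in>D. \<exists>P. \<forall>x. \<bar>x\<bar> \<le> \<rho> \<longrightarrow> of_real (d - e) * \<psi> d x = poly P (of_real x)"
  proof (rule insert.IH[of p])
    show "p > 0" by (rule p)
    show "continuous_on {-p..p} (\<lambda>x. of_real (d - e) * \<psi> d x)" if "d \<in> D" for d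
      by (intro continuous_intros continuous_on_subset[OF \<psi>c]) (use that p q in auto)
  qed (use step in auto)
  then obtain \<rho>0 where \<rho>0: "\<rho>0 > 0"
      "\<And>d. d \<in> D \<Longrightarrow> \<exists>P. \<forall>x. \<bar>x\<bar> \<le> \<rho>0 \<longrightarrow> of_real (d - e) * \<psi> d x = poly P (of_real x)"
    by auto
  define \<rho> where "\<rho> = min \<rho>0 (q / 2)"
  have \<rho>: "\<rho> > 0" "\<rho> \<le> \<rho>0" "\<rho> < q" using \<rho>0 q by (auto simp: \<rho>_def)
  have D: "\<exists>P. \<forall>x. \<bar>x\<bar> \<le> \<rho> \<longrightarrow> \<phi> d x = poly P (of_real x)" if d: "d \<in> D" for d
  proof -
    have de: "d - e \<noteq> 0" using d insert.hyps by auto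
    obtain Q where Q: "\<And>x. \<bar>x\<bar> \<le> \<rho>0 \<Longrightarrow> of_real (d - e) * \<psi> d x = poly Q (of_real x)"
      using \<rho>0(2)[OF d] by blast
    obtain R where R: "pderiv R = smult (of_real (inverse (d - e))) Q" by (rule pderiv_surj)
    have "((\<lambda>x. \<phi> d x - poly R (of_real x)) has_vector_derivative 0) (at x within {-\<rho>..\<rho>})"
      if x: "x \<in> {-\<rho>..\<rho>}" for x
    proof -
      have "((\<lambda>x. poly R (of_real x)) has_vector_derivative poly (pderiv R) (of_real x)) (at x)"
        using poly_DERIV[of R "of_real x"] by (rule has_vector_derivative_real_field)
      moreover have "(\<phi> d has_vector_derivative \<psi> d x) (at x)" using x \<rho> d by (intro \<psi>d) auto
      moreover have "poly (pderiv R) (of_real x) = \<psi> d x"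
      proof -
        have "of_real (d - e) * \<psi> d x = poly Q (of_real x)" using x \<rho> by (intro Q) auto
        moreover have "complex_of_real (d - e) \<noteq> 0" using de by (simp del: of_real_diff)
        ultimately show ?thesis unfolding R by (simp add: field_simps del: of_real_diff flip: \<open>_ = poly Q _\<close>)
      qed
      ultimately have "((\<lambda>x. \<phi> d x - poly R (of_real x)) has_vector_derivative 0) (at x)"
        using has_vector_derivative_diff by fastforce
      then show ?thesis by (rule has_vector_derivative_at_within)
    qed
    then obtain c where c: "\<And>x. x \<in> {-\<rho>..\<rho>} \<Longrightarrow> \<phi> d x - poly R (of_real x) = c"
      using has_vector_derivative_zero_constant[of "{-\<rho>..\<rho>}"] by (metis (no_types, lifting) convex_real_interval(5))
    have "\<phi> d x = poly (R + [:c:]) (of_real x)" if "\<bar>x\<bar> \<le> \<rho>" for x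
      using c[of x] that by (simp add: algebra_simps abs_le_iff)
    then show ?thesis by blast
  qed
  then obtain P where P: "\<And>d x. d \<in> D \<Longrightarrow> \<bar>x\<bar> \<le> \<rho> \<Longrightarrow> \<phi> d x = poly (P d) (of_real x)"
    by metis
  have "\<phi> e x = poly (- (\<Sum>d\<in>D. P d)) (of_real x)" if x: "\<bar>x\<bar> \<le> \<rho>" for x
  proof -
    have "(\<Sum>d\<in>?E. \<phi> d (x + d * 0)) = 0" using x \<rho> q r by (intro eq) auto
    then show ?thesis using insert.hyps x by (simp add: P poly_sum eq_neg_iff_add_eq_0)
  qed
  then have "\<forall>d\<in>?E. \<exists>P. \<forall>x. \<bar>x\<bar> \<le> \<rho> \<longrightarrow> \<phi> d x = poly P (of_real x)"
    using D by blast
  then show ?case using \<rho>(1) by blast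
qed


section \<open>Exponential moments and entire characteristic functions\<close>

lemma entire_eq_of_real_nbhd:
  fixes f g :: "complex \<Rightarrow> complex"
  assumes "f holomorphic_on UNIV" "g holomorphic_on UNIV" "r > 0"
    and eq: "\<And>s. \<bar>s\<bar> < r \<Longrightarrow> f (of_real s) = g (of_real s)"
  shows "f z = g z"
proof -
  have lim: "0 islimpt (of_real ` {-r<..<r} :: complex set)"
  proof (subst islimpt_approachable, intro allI impI)
    fix e :: real assume "e > 0"
    then show "\<exists>x'\<in>of_real ` {-r<..<r}. x' \<noteq> (0::complex) \<and> dist x' 0 < e"
      using \<open>r > 0\<close> by (intro bexI[of _ "of_real (min (r/2) (e/2))"]) (auto simp: min_def)
  qed
  have "(\<lambda>z. f z - g z) holomorphic_on UNIV" by (intro holomorphic_intros assms)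
  moreover have "f w - g w = 0" if "w \<in> of_real ` {-r<..<r}" for w
    using that eq by auto
  ultimately have "f z - g z = 0"
    by (rule analytic_continuation[OF _ open_UNIV connected_UNIV subset_UNIV UNIV_I lim _ UNIV_I])
  then show ?thesis by simp
qed

text \<open>The forward difference of order m and step h. The function is differenced before the
  recursive call, so inductions run over an arbitrary \<open>g\<close> at a fixed base
  point.\<close>

fun fdiff :: "nat \<Rightarrow> real \<Rightarrow> (real \<Rightarrow> complex) \<Rightarrow> real \<Rightarrow> complex" where
  "fdiff 0 h g s = g s"
| "fdiff (Suc m) h g s = fdiff m h (\<lambda>s. g (s + h) - g s) s"

lemma fdiff_cong:
  assumes "h \<ge> 0" "\<And>x. s \<le> x \<Longrightarrow> x \<le> s + m * h \<Longrightarrow> f x = g x"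
  shows "fdiff m h f s = fdiff m h g s"
  using assms(2)
proof (induction m arbitrary: f g)
  case (Suc m)
  have "f (x + h) - f x = g (x + h) - g x" if "s \<le> x" "x \<le> s + m * h" for x
    using Suc.prems[of x] Suc.prems[of "x + h"] that assms(1) by (simp add: algebra_simps)
  then show ?case by (auto intro: Suc.IH)
qed simp

lemma higher_deriv_shift:
  assumes "G holomorphic_on UNIV"
  shows "(deriv ^^ m) (\<lambda>z. G (z + c)) z = (deriv ^^ m) G (z + c)"
proof -
  have "(deriv ^^ m) (\<lambda>w. G (1 * w + c)) z = 1 ^ m * (deriv ^^ m) G (1 * z + c)"
    by (rule higher_deriv_compose_linear'[OF assms open_UNIV open_UNIV]) simp_all
  then show ?thesis by simp
qed

text \<open>The mean value inequality, once per difference: a bound \<open>B\<close> for the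
  derivative of order \<open>Suc m\<close> of \<open>G\<close> becomes the bound
  \<open>B * h\<close> for the derivative of order \<open>m\<close> of
  \<open>G (z + h) - G z\<close>.\<close>

lemma norm_fdiff_le:
  fixes h s :: real
  assumes hol: "G holomorphic_on UNIV" and "h \<ge> 0"
    and "\<And>x. s \<le> x \<Longrightarrow> x \<le> s + m * h \<Longrightarrow> norm ((deriv ^^ m) G (of_real x)) \<le> B"
  shows "norm (fdiff m h (\<lambda>x. G (of_real x)) s) \<le> B * h ^ m"
  using assms(1,3)
proof (induction m arbitrary: G B)
  case 0
  then show ?case using 0(2)[of s] by simp
next
  case (Suc m)
  define G' where "G' z = G (z + of_real h) - G z" for z
  have shift: "(\<lambda>z. G (z + of_real h)) holomorphic_on UNIV"
  proof -
    have "(\<lambda>z. z + complex_of_real h) holomorphic_on UNIV" by (intro holomorphic_intros)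
    from holomorphic_on_compose_gen[OF this Suc.prems(1)] show ?thesis by (simp add: o_def)
  qed
  have G': "G' holomorphic_on UNIV"
    unfolding G'_def by (intro holomorphic_intros shift Suc.prems(1))
  have "norm (fdiff m h (\<lambda>x. G' (of_real x)) s) \<le> (B * h) * h ^ m"
  proof (rule Suc.IH[OF G'])
    fix x assume x: "s \<le> x" "x \<le> s + m * h"
    have "(deriv ^^ m) G' (of_real x) = (deriv ^^ m) G (of_real (x + h)) - (deriv ^^ m) G (of_real x)"
      unfolding G'_def using higher_deriv_diff[OF shift Suc.prems(1), of "of_real x" m]
      by (simp add: higher_deriv_shift[OF Suc.prems(1)])
    also have "norm \<dots> \<le> B * norm (complex_of_real (x + h) - of_real x)"
    proof (rule field_differentiable_bound[where S = "of_real ` {x..x+h}"])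
      show "convex (complex_of_real ` {x..x + h})"
        by (intro convex_linear_image bounded_linear.linear bounded_linear_of_real) simp
      fix z assume z: "z \<in> complex_of_real ` {x..x + h}"
      have "(deriv ^^ m) G holomorphic_on UNIV" using Suc.prems(1) by (intro holomorphic_higher_deriv) auto
      then show "((deriv ^^ m) G has_field_derivative (deriv ^^ Suc m) G z) (at z within complex_of_real ` {x..x + h})"
        unfolding funpow.simps comp_apply
        by (rule holomorphic_derivI[OF _ open_UNIV]) simp_all
      show "norm ((deriv ^^ Suc m) G z) \<le> B"
      proof -
        obtain u where u: "z = of_real u" "x \<le> u" "u \<le> x + h" using z by auto
        show ?thesis unfolding u(1) by (rule Suc.prems(2)) (use u x in \<open>simp_all add: algebra_simps\<close>)
      qed
    qed (use assms(2) in \<open>simp_all add: image_iff del: of_real_add\<close>)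
    finally show "norm ((deriv ^^ m) G' (of_real x)) \<le> B * h" using assms(2) by simp
  qed
  then show ?case by (simp add: G'_def mult_ac)
qed

text \<open>The characteristic function of \<open>X\<close> with weight \<open>W\<close>, at complex
  arguments: \<open>W = 1\<close> gives F and the sign gives G, so one set of lemmas serves both.
  Where the integrand is not integrable the value is the default 0, hence the assumptions on
  exponential moments below.\<close>

definition wlap :: "'w measure \<Rightarrow> ('w \<Rightarrow> complex) \<Rightarrow> ('w \<Rightarrow> real) \<Rightarrow> complex \<Rightarrow> complex" where
  "wlap M W X z = (CLINT \<omega>|M. W \<omega> * exp (\<i> * z * of_real (X \<omega>)))"

section \<open>Even moments from finite differences\<close>

context prob_space
begin

lemma wlap_integrable_real:
  assumes [measurable]: "X \<in> borel_measurable M" "W \<in> borel_measurable M"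
    and W: "\<And>\<omega>. norm (W \<omega>) \<le> B"
  shows "integrable M (\<lambda>\<omega>. W \<omega> * exp (\<i> * of_real s * of_real (X \<omega>)))"
  by (rule integrable_const_bound[where B = B])
     (use W in \<open>auto simp: norm_mult\<close>)

text \<open>Each difference multiplies the weight by \<open>exp (\<i> * h * X) - 1\<close>, of norm
  at most 2, so the induction stays within bounded weights whatever the moments of
  \<open>X\<close>.\<close>

lemma fdiff_wlap:
  assumes [measurable]: "X \<in> borel_measurable M"
    and "W \<in> borel_measurable M" and "\<And>\<omega>. norm (W \<omega>) \<le> B"
  shows "fdiff m h (\<lambda>s. wlap M W X (of_real s)) s
    = wlap M (\<lambda>\<omega>. W \<omega> * (exp (\<i> * of_real h * of_real (X \<omega>)) - 1) ^ m) X (of_real s)"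
  using assms(2,3)
proof (induction m arbitrary: W B)
  case (Suc m)
  note [measurable] = Suc.prems(1)
  define W' where "W' \<omega> = W \<omega> * (exp (\<i> * of_real h * of_real (X \<omega>)) - 1)" for \<omega>
  have [measurable]: "W' \<in> borel_measurable M" unfolding W'_def by measurable
  have W': "norm (W' \<omega>) \<le> B * 2" for \<omega>
  proof -
    have "norm (exp (\<i> * of_real h * of_real (X \<omega>)) - 1) \<le> 1 + 1"
      by (rule order_trans[OF norm_triangle_ineq4]) simp
    then show ?thesis unfolding W'_def norm_mult
      using Suc.prems(2)[of \<omega>] by (intro mult_mono) (auto intro: order_trans[OF norm_ge_zero])
  qed
  have "wlap M W X (of_real (s + h)) - wlap M W X (of_real s) = wlap M W' X (of_real s)" for s
  proof -
    have e: "exp (\<i> * of_real (s + h) * x) = exp (\<i> * of_real h * x) * exp (\<i> * of_real s * x)" for x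
      by (simp add: algebra_simps flip: exp_add)
    have "wlap M W X (of_real (s + h)) - wlap M W X (of_real s)
        = (CLINT \<omega>|M. W \<omega> * exp (\<i> * of_real (s + h) * of_real (X \<omega>))
            - W \<omega> * exp (\<i> * of_real s * of_real (X \<omega>)))"
      unfolding wlap_def
      by (intro Bochner_Integration.integral_diff[symmetric] wlap_integrable_real[OF _ _ Suc.prems(2)]) simp_all
    also have "\<dots> = wlap M W' X (of_real s)"
      unfolding wlap_def e W'_def
      by (intro Bochner_Integration.integral_cong refl) (simp add: algebra_simps)
    finally show ?thesis .
  qed
  then have "fdiff (Suc m) h (\<lambda>s. wlap M W X (of_real s)) s = fdiff m h (\<lambda>s. wlap M W' X (of_real s)) s"
    by simp
  also have "\<dots> = wlap M (\<lambda>\<omega>. W' \<omega> * (exp (\<i> * of_real h * of_real (X \<omega>)) - 1) ^ m) X (of_real s)"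
    by (rule Suc.IH[OF _ W']) simp
  finally show ?case by (simp add: W'_def mult_ac)
qed simp

text \<open>The difference of order \<open>2 * k\<close> based at \<open>- (k * h)\<close> is
  centred at 0, and there it is, up to the sign \<open>(- 1) ^ k\<close>, the expectation of a
  nonnegative variable. The condition \<open>real k * h < r\<close> keeps all its nodes where
  \<open>wlap\<close> and \<open>G\<close> agree.\<close>

lemma expectation_cos_diff_le:
  assumes X: "X \<in> borel_measurable M"
    and G: "G holomorphic_on UNIV" and h: "0 \<le> h" "real k * h < r"
    and eq: "\<And>s. \<bar>s\<bar> < r \<Longrightarrow> wlap M (\<lambda>_. 1) X (of_real s) = G (of_real s)"
    and B: "\<And>x. \<bar>x\<bar> < r \<Longrightarrow> norm ((deriv ^^ (2*k)) G (of_real x)) \<le> B"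
  shows "(\<integral>\<omega>. (2 - 2 * cos (h * X \<omega>)) ^ k \<partial>M) \<le> B * h ^ (2 * k)"
proof -
  note [measurable] = X
  \<comment> \<open>The centred second difference
    \<open>exp (\<i> * a) - 2 + exp (- \<i> * a)\<close>, written as a product.\<close>
  have cosd: "(exp (\<i> * of_real a) - 1) ^ 2 * exp (\<i> * of_real (- a)) = of_real (- (2 - 2 * cos a))" for a :: real
  proof -
    define E where "E = exp (\<i> * complex_of_real a)"
    define F where "F = exp (- (\<i> * complex_of_real a))"
    have EF: "E * F = 1" by (simp add: E_def F_def exp_minus)
    have "complex_of_real (cos a) = (E + F) / 2"
      by (simp add: E_def F_def cos_exp_eq flip: cos_of_real)
    moreover have "(E - 1) ^ 2 * F = E * (E * F) - 2 * (E * F) + F"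
      by (simp add: power2_eq_square algebra_simps)
    ultimately have "(E - 1) ^ 2 * F = 2 * complex_of_real (cos a) - 2"
      by (simp only: EF) (simp add: field_simps)
    then have "(E - 1) ^ 2 * F = of_real (- (2 - 2 * cos a))" by simp
    then show ?thesis by (simp add: E_def F_def)
  qed
  have "wlap M (\<lambda>\<omega>. 1 * (exp (\<i> * of_real h * of_real (X \<omega>)) - 1) ^ (2 * k)) X (of_real (- (k * h)))
      = (CLINT \<omega>|M. of_real ((- (2 - 2 * cos (h * X \<omega>))) ^ k))"
    unfolding wlap_def
  proof (intro Bochner_Integration.integral_cong refl)
    fix \<omega>
    have "exp (\<i> * of_real (- (k * h)) * of_real (X \<omega>)) = exp (\<i> * of_real (- (h * X \<omega>))) ^ k"
      by (simp flip: exp_of_nat_mult add: mult_ac)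
    then have "(exp (\<i> * of_real h * of_real (X \<omega>)) - 1) ^ (2 * k) * exp (\<i> * of_real (- (k * h)) * of_real (X \<omega>))
      = ((exp (\<i> * of_real (h * X \<omega>)) - 1) ^ 2 * exp (\<i> * of_real (- (h * X \<omega>)))) ^ k"
      by (simp add: power_mult power_mult_distrib mult.assoc)
    then show "1 * (exp (\<i> * of_real h * of_real (X \<omega>)) - 1) ^ (2 * k) * exp (\<i> * of_real (- (k * h)) * of_real (X \<omega>))
      = of_real ((- (2 - 2 * cos (h * X \<omega>))) ^ k)"
      unfolding cosd by (simp only: of_real_power mult_1_left)
  qed
  also have "\<dots> = of_real ((- 1) ^ k * (\<integral>\<omega>. (2 - 2 * cos (h * X \<omega>)) ^ k \<partial>M))"
    by (simp only: integral_complex_of_real power_minus[of "2 - 2 * cos _"] integral_mult_right_zero)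
  finally have "fdiff (2 * k) h (\<lambda>s. wlap M (\<lambda>_. 1) X (of_real s)) (- (k * h))
      = of_real ((- 1) ^ k * (\<integral>\<omega>. (2 - 2 * cos (h * X \<omega>)) ^ k \<partial>M))"
    by (subst fdiff_wlap[OF X, of "\<lambda>_. 1" 1]) simp_all
  then have "\<bar>\<integral>\<omega>. (2 - 2 * cos (h * X \<omega>)) ^ k \<partial>M\<bar>
      = norm (fdiff (2 * k) h (\<lambda>s. wlap M (\<lambda>_. 1) X (of_real s)) (- (k * h)))"
    by (simp only: norm_of_real abs_mult power_abs abs_minus abs_one power_one mult_1_left)
  also have "fdiff (2 * k) h (\<lambda>s. wlap M (\<lambda>_. 1) X (of_real s)) (- (k * h))
      = fdiff (2 * k) h (\<lambda>s. G (of_real s)) (- (k * h))"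
  proof (rule fdiff_cong[OF h(1)])
    fix x assume "- (k * h) \<le> x" "x \<le> - (k * h) + real (2 * k) * h"
    then have "\<bar>x\<bar> \<le> k * h" by (simp add: abs_le_iff algebra_simps)
    then show "wlap M (\<lambda>_. 1) X (of_real x) = G (of_real x)" using h(2) by (intro eq) linarith
  qed
  also have "norm \<dots> \<le> B * h ^ (2 * k)"
  proof (rule norm_fdiff_le[OF G h(1)])
    fix x assume "- (k * h) \<le> x" "x \<le> - (k * h) + real (2 * k) * h"
    then have "\<bar>x\<bar> \<le> k * h" by (simp add: abs_le_iff algebra_simps)
    then show "norm ((deriv ^^ (2*k)) G (of_real x)) \<le> B" using h(2) by (intro B) linarith
  qed
  finally show ?thesis by linarith
qed

text \<open>Fatou's lemma along the steps \<open>h = 1 / Suc n\<close>: the quotients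
  \<open>(2 - 2 * cos (h * X)) / h ^ 2\<close> are nonnegative and tend to \<open>X ^ 2\<close>. The
  moment is a \<open>nn_integral\<close> because its finiteness is part of the claim.\<close>

lemma even_moment_le:
  assumes X: "X \<in> borel_measurable M"
    and G: "G holomorphic_on UNIV" and r: "r > 0"
    and eq: "\<And>s. \<bar>s\<bar> < r \<Longrightarrow> wlap M (\<lambda>_. 1) X (of_real s) = G (of_real s)"
    and B: "\<And>x. \<bar>x\<bar> < r \<Longrightarrow> norm ((deriv ^^ (2*k)) G (of_real x)) \<le> B"
  shows "(\<integral>\<^sup>+\<omega>. ennreal (X \<omega> ^ (2 * k)) \<partial>M) \<le> ennreal B"
proof -
  note [measurable] = X
  define u where "u n \<omega> = ((2 - 2 * cos (inverse (real (Suc n)) * X \<omega>)) / inverse (real (Suc n)) ^ 2) ^ k" for n \<omega>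
  have u0: "u n \<omega> \<ge> 0" for n \<omega> by (simp add: u_def)
  have lim: "(\<lambda>n. u n \<omega>) \<longlonglongrightarrow> X \<omega> ^ (2 * k)" for \<omega>
  proof -
    have "(\<lambda>n. (2 - 2 * cos (inverse (real (Suc n)) * x)) / inverse (real (Suc n)) ^ 2) \<longlonglongrightarrow> x * x" for x :: real
      by real_asymp
    then show ?thesis unfolding u_def power_mult power2_eq_square[of "X \<omega>"] by (intro tendsto_power)
  qed
  have "(\<integral>\<^sup>+\<omega>. ennreal (X \<omega> ^ (2 * k)) \<partial>M) = (\<integral>\<^sup>+\<omega>. liminf (\<lambda>n. ennreal (u n \<omega>)) \<partial>M)"
    by (intro nn_integral_cong lim_imp_Liminf[symmetric] tendsto_ennrealI lim) auto
  also have "\<dots> \<le> liminf (\<lambda>n. \<integral>\<^sup>+\<omega>. ennreal (u n \<omega>) \<partial>M)"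
    by (intro nn_integral_liminf) (simp add: u_def)
  also have "\<dots> \<le> liminf (\<lambda>n. ennreal B)"
  proof (rule Liminf_mono)
    have "(\<lambda>n. real k * inverse (real (Suc n))) \<longlonglongrightarrow> 0" by real_asymp
    from order_tendstoD(2)[OF this r]
    show "\<forall>\<^sub>F n in sequentially. (\<integral>\<^sup>+\<omega>. ennreal (u n \<omega>) \<partial>M) \<le> ennreal B"
    proof eventually_elim
      case (elim n)
      define h where "h = inverse (real (Suc n))"
      have h: "h > 0" by (simp add: h_def)
      have int: "integrable M (\<lambda>\<omega>. (2 - 2 * cos (h * X \<omega>)) ^ k)"
      proof (rule integrable_const_bound[where B = "4 ^ k"])
        have "\<bar>2 - 2 * cos a\<bar> \<le> 4" for a :: real using cos_ge_minus_one[of a] cos_le_one[of a] by linarith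
        then show "AE \<omega> in M. norm ((2 - 2 * cos (h * X \<omega>)) ^ k) \<le> 4 ^ k"
          by (auto simp: norm_power intro!: power_mono)
      qed measurable
      have un: "u n = (\<lambda>\<omega>. (2 - 2 * cos (h * X \<omega>)) ^ k / h ^ (2 * k))"
        by (simp add: u_def[abs_def] power_divide power_mult h_def del: of_nat_Suc)
      have "(\<integral>\<^sup>+\<omega>. ennreal (u n \<omega>) \<partial>M) = ennreal (\<integral>\<omega>. u n \<omega> \<partial>M)"
      proof (rule nn_integral_eq_integral)
        show "integrable M (u n)" unfolding un by (intro integrable_divide int)
      qed (use u0 in auto)
      also have "(\<integral>\<omega>. u n \<omega> \<partial>M) = (\<integral>\<omega>. (2 - 2 * cos (h * X \<omega>)) ^ k \<partial>M) / h ^ (2 * k)"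
        unfolding un by simp
      also have "\<dots> \<le> B"
      proof -
        have "(\<integral>\<omega>. (2 - 2 * cos (h * X \<omega>)) ^ k \<partial>M) \<le> B * h ^ (2 * k)"
          by (rule expectation_cos_diff_le[OF X G _ _ eq B]) (use h elim in \<open>simp_all add: h_def del: of_nat_Suc\<close>)
        then show ?thesis using h by (simp add: divide_le_eq)
      qed
      finally show ?case by (simp add: ennreal_leI)
    qed
  qed
  also have "\<dots> = ennreal B" by (simp add: Liminf_const)
  finally show ?thesis .
qed

text \<open>Cauchy's estimates for \<open>G\<close> bound the even moments by
  \<open>fact (2 * k) * C / R ^ (2 * k)\<close>. The factorial cancels in the power series of
  \<open>cosh\<close>, whose expectation is thus dominated by a geometric series of ratio
  \<open>\<bar>y\<bar> / R\<close>. As \<open>G\<close> is entire, \<open>R\<close> may be as large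
  as \<open>y\<close> demands.\<close>

theorem exp_moments_of_entire:
  assumes X: "X \<in> borel_measurable M"
    and G: "G holomorphic_on UNIV" and r: "r > 0"
    and eq: "\<And>s. \<bar>s\<bar> < r \<Longrightarrow> wlap M (\<lambda>_. 1) X (of_real s) = G (of_real s)"
  shows "integrable M (\<lambda>\<omega>. exp (y * X \<omega>))"
proof -
  note [measurable] = X
  \<comment> \<open>More than twice \<open>\<bar>y\<bar>\<close>, so that the ratio is at most 1/2,
    and positive also for \<open>y = 0\<close>.\<close>
  define R where "R = 2 * \<bar>y\<bar> + 1"
  have R: "R > 0" by (simp add: R_def add_nonneg_pos)
  have contG: "continuous_on A G" for A
    using G holomorphic_on_imp_continuous_on holomorphic_on_subset by blast
  obtain C where C: "\<And>z. norm z \<le> R + r \<Longrightarrow> norm (G z) \<le> C"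
  proof -
    have "compact (G ` cball 0 (R + r))" by (intro compact_continuous_image contG) simp
    then have "bounded (G ` cball 0 (R + r))" by (rule compact_imp_bounded)
    then obtain a where "\<forall>x\<in>cball 0 (R + r). norm (G x) \<le> a" unfolding bounded_iff by auto
    then show ?thesis by (intro that[of a]) simp
  qed
  have "norm (G 0) \<le> C" by (rule C) (use R r in simp)
  then have C0: "C \<ge> 0" by (rule order_trans[OF norm_ge_zero])
  have B: "norm ((deriv ^^ n) G (of_real x)) \<le> fact n * C / R ^ n" if "\<bar>x\<bar> < r" for n x
  proof (rule Cauchy_inequality)
    fix w assume "norm (complex_of_real x - w) = R"
    then have "norm w \<le> R + r" using norm_triangle_ineq4[of "of_real x" "of_real x - w"] that by simp
    then show "norm (G w) \<le> C" by (rule C)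
  qed (use R G holomorphic_on_subset contG in auto)
  \<comment> \<open>The terms of \<open>cosh_converges\<close>: the odd ones vanish, so only even
    moments enter. At the end \<open>exp a \<le> 2 * cosh a\<close> leads back to the
    exponential.\<close>
  define t where "t n \<omega> = (if even n then inverse (fact n) *\<^sub>R (y * X \<omega>) ^ n else 0)" for n \<omega>
  have t0: "t n \<omega> \<ge> 0" for n \<omega> by (auto simp: t_def zero_le_even_power)
  have [measurable]: "t n \<in> borel_measurable M" for n unfolding t_def by measurable
  have tn: "(\<integral>\<^sup>+\<omega>. ennreal (t n \<omega>) \<partial>M) \<le> ennreal (C * (1/2) ^ n)" for n
  proof (cases "even n")
    case True
    then obtain k where k: "n = 2 * k" by blast
    have "(\<integral>\<^sup>+\<omega>. ennreal (t n \<omega>) \<partial>M) = (\<integral>\<^sup>+\<omega>. ennreal (inverse (fact n) * y ^ n) * ennreal (X \<omega> ^ (2 * k)) \<partial>M)"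
      using True by (intro nn_integral_cong) (simp add: t_def k power_mult_distrib flip: ennreal_mult)
    also have "\<dots> = ennreal (inverse (fact n) * y ^ n) * (\<integral>\<^sup>+\<omega>. ennreal (X \<omega> ^ (2 * k)) \<partial>M)"
      by (rule nn_integral_cmult) simp
    also have "\<dots> \<le> ennreal (inverse (fact n) * y ^ n) * ennreal (fact (2*k) * C / R ^ (2*k))"
      by (intro mult_left_mono even_moment_le[OF X G r eq B]) auto
    also have "\<dots> = ennreal (C * (y / R) ^ n)"
    proof -
      have "inverse (fact n) * y ^ n * (fact (2*k) * C / R ^ (2*k)) = C * (y / R) ^ n"
        by (simp add: k power_divide field_simps)
      then show ?thesis using C0 R by (subst ennreal_mult[symmetric]) (simp_all add: k)
    qed
    also have "\<dots> \<le> ennreal (C * (1/2) ^ n)"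
    proof (intro ennreal_leI mult_left_mono C0)
      have "(y / R) ^ n = \<bar>y / R\<bar> ^ n" by (rule power_even_abs[OF True, symmetric])
      also have "\<dots> \<le> (1/2) ^ n"
      proof (rule power_mono)
        have "\<bar>y\<bar> \<le> R / 2" unfolding R_def by simp
        then show "\<bar>y / R\<bar> \<le> 1 / 2" using R by (simp add: abs_divide divide_le_eq)
      qed simp
      finally show "(y / R) ^ n \<le> (1/2) ^ n" .
    qed
    finally show ?thesis .
  qed (simp add: t_def)
  have "(\<integral>\<^sup>+\<omega>. ennreal (cosh (y * X \<omega>)) \<partial>M) = (\<integral>\<^sup>+\<omega>. (\<Sum>n. ennreal (t n \<omega>)) \<partial>M)"
  proof (intro nn_integral_cong suminf_ennreal_eq[symmetric] t0)
    show "(\<lambda>n. t n \<omega>) sums cosh (y * X \<omega>)" for \<omega> unfolding t_def by (rule cosh_converges)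
  qed
  also have "\<dots> = (\<Sum>n. \<integral>\<^sup>+\<omega>. ennreal (t n \<omega>) \<partial>M)" by (rule nn_integral_suminf) simp
  also have "\<dots> \<le> (\<Sum>n. ennreal (C * (1/2) ^ n))" by (intro suminf_le tn) auto
  also have "\<dots> = ennreal (C * 2)"
    by (rule suminf_ennreal_eq) (use C0 geometric_sums[of "1/2::real"] in \<open>auto intro!: sums_mult\<close>)
  finally have fin: "(\<integral>\<^sup>+\<omega>. ennreal (cosh (y * X \<omega>)) \<partial>M) < \<infinity>"
    by (metis ennreal_less_top infinity_ennreal_def order_le_less_trans)
  have [measurable]: "(\<lambda>\<omega>. cosh (y * X \<omega>)) \<in> borel_measurable M" unfolding cosh_field_def by measurable
  have "integrable M (\<lambda>\<omega>. cosh (y * X \<omega>))"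
    by (rule integrableI_nonneg) (use fin in auto)
  then have "integrable M (\<lambda>\<omega>. 2 * cosh (y * X \<omega>))" by simp
  then show ?thesis
  proof (rule Bochner_Integration.integrable_bound)
    have "norm (exp a) \<le> norm (2 * cosh a)" for a :: real
      unfolding cosh_field_def by (simp add: abs_of_pos add_pos_pos)
    then show "AE \<omega> in M. norm (exp (y * X \<omega>)) \<le> norm (2 * cosh (y * X \<omega>))" by blast
  qed simp
qed

section \<open>Continuation of \<open>wlap\<close> to the complex plane\<close>

lemma wlap_integrable:
  assumes [measurable]: "X \<in> borel_measurable M" "W \<in> borel_measurable M"
    and W: "\<And>\<omega>. norm (W \<omega>) \<le> 1"
    and em: "\<And>y. integrable M (\<lambda>\<omega>. exp (y * X \<omega>))"
  shows "integrable M (\<lambda>\<omega>. W \<omega> * exp (\<i> * z * of_real (X \<omega>)))"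
  by (rule Bochner_Integration.integrable_bound[OF em[of "- Im z"]])
     (use W in \<open>auto simp: norm_mult mult_left_le_one_le\<close>)

text \<open>The modulus of \<open>exp (\<i> * z * X)\<close> depends on \<open>Im z\<close> alone.
  For \<open>W = 1\<close> the bound is the value at \<open>\<i> * Im z\<close>, which is the ridge
  property; for other weights it lets F control G.\<close>

lemma norm_wlap_le:
  assumes [measurable]: "X \<in> borel_measurable M" "W \<in> borel_measurable M"
    and W: "\<And>\<omega>. norm (W \<omega>) \<le> 1"
    and em: "\<And>y. integrable M (\<lambda>\<omega>. exp (y * X \<omega>))"
  shows "norm (wlap M W X z) \<le> (\<integral>\<omega>. exp (- Im z * X \<omega>) \<partial>M)"
proof -
  have "norm (wlap M W X z) \<le> (\<integral>\<omega>. norm (W \<omega> * exp (\<i> * z * of_real (X \<omega>))) \<partial>M)"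
    unfolding wlap_def by (rule integral_norm_bound)
  also have "\<dots> \<le> (\<integral>\<omega>. exp (- Im z * X \<omega>) \<partial>M)"
    by (intro integral_mono integrable_norm wlap_integrable assms em)
       (use W in \<open>auto simp: norm_mult mult_left_le_one_le\<close>)
  finally show ?thesis .
qed

lemma wlap_imaginary:
  "wlap M (\<lambda>_. 1) X (\<i> * of_real y) = of_real (\<integral>\<omega>. exp (- y * X \<omega>) \<partial>M)"
proof -
  have "\<i> * (\<i> * of_real y) * of_real x = of_real (- y * x)" for x
    by (simp add: mult.assoc[symmetric])
  then show ?thesis unfolding wlap_def by (simp only: mult_1_left exp_of_real integral_complex_of_real)
qed

text \<open>Integrating the exponential series term by term gives a power series that converges
  everywhere. The partial sums of the norms are dominated by
  \<open>exp (norm z * \<bar>X\<bar>)\<close>, which is at most the sum of the exponentials at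
  \<open>norm z\<close> and \<open>- norm z\<close>.\<close>

theorem wlap_holomorphic:
  assumes [measurable]: "X \<in> borel_measurable M" "W \<in> borel_measurable M"
    and W: "\<And>\<omega>. norm (W \<omega>) \<le> 1"
    and em: "\<And>y. integrable M (\<lambda>\<omega>. exp (y * X \<omega>))"
  shows "wlap M W X holomorphic_on UNIV"
proof -
  define c where "c k = (CLINT \<omega>|M. W \<omega> * (\<i> * of_real (X \<omega>)) ^ k) / fact k" for k
  have sums: "(\<lambda>k. c k * (z - 0) ^ k) sums wlap M W X z" for z
  proof -
    define f where "f k \<omega> = W \<omega> * ((\<i> * z * of_real (X \<omega>)) ^ k /\<^sub>R fact k)" for k \<omega>
    have [measurable]: "f k \<in> borel_measurable M" for k unfolding f_def by measurable
    have E: "integrable M (\<lambda>\<omega>. exp (norm z * \<bar>X \<omega>\<bar>))"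
    proof (rule Bochner_Integration.integrable_bound[OF Bochner_Integration.integrable_add[OF em[of "norm z"] em[of "- norm z"]]])
      have "exp (norm z * \<bar>x\<bar>) \<le> exp (norm z * x) + exp (- norm z * x)" for x
        by (cases "x \<ge> 0") auto
      then show "AE \<omega> in M. norm (exp (norm z * \<bar>X \<omega>\<bar>)) \<le> norm (exp (norm z * X \<omega>) + exp (- norm z * X \<omega>))"
        by (intro AE_I2) (smt (verit) exp_ge_zero real_norm_def)
    qed simp
    have nf: "norm (f k \<omega>) \<le> (norm z * \<bar>X \<omega>\<bar>) ^ k /\<^sub>R fact k" for k \<omega>
      using W[of \<omega>] by (simp add: f_def norm_mult norm_power mult_left_le_one_le)
    have es: "(\<lambda>k. (norm z * \<bar>X \<omega>\<bar>) ^ k /\<^sub>R fact k) sums exp (norm z * \<bar>X \<omega>\<bar>)" for \<omega>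
      by (rule exp_converges)
    have part: "(\<Sum>k<n. norm (f k \<omega>)) \<le> exp (norm z * \<bar>X \<omega>\<bar>)" for n \<omega>
    proof -
      have "(\<Sum>k<n. norm (f k \<omega>)) \<le> (\<Sum>k<n. (norm z * \<bar>X \<omega>\<bar>) ^ k /\<^sub>R fact k)"
        by (intro sum_mono nf)
      also have "\<dots> \<le> exp (norm z * \<bar>X \<omega>\<bar>)"
        using sum_le_suminf[OF sums_summable[OF es[of \<omega>]], of "{..<n}"] sums_unique[OF es[of \<omega>]] by simp
      finally show ?thesis .
    qed
    have int: "integrable M (f k)" for k
    proof (rule Bochner_Integration.integrable_bound[OF E])
      have "norm (f k \<omega>) \<le> exp (norm z * \<bar>X \<omega>\<bar>)" for \<omega>
      proof -
        have "(\<Sum>j<Suc k. norm (f j \<omega>)) \<le> exp (norm z * \<bar>X \<omega>\<bar>)" by (rule part)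
        then show ?thesis using sum_nonneg[of "{..<k}" "\<lambda>k. norm (f k \<omega>)"] by simp
      qed
      then show "AE \<omega> in M. norm (f k \<omega>) \<le> norm (exp (norm z * \<bar>X \<omega>\<bar>))" by simp
    qed simp
    have "(\<lambda>k. integral\<^sup>L M (f k)) sums (\<integral>\<omega>. (\<Sum>k. f k \<omega>) \<partial>M)"
    proof (rule sums_integral[OF int])
      show "AE \<omega> in M. summable (\<lambda>k. norm (f k \<omega>))"
        by (intro AE_I2 summableI_nonneg_bounded[OF _ part]) simp
      show "summable (\<lambda>k. \<integral>\<omega>. norm (f k \<omega>) \<partial>M)"
      proof (rule summableI_nonneg_bounded)
        fix n
        have "(\<Sum>k<n. \<integral>\<omega>. norm (f k \<omega>) \<partial>M) = (\<integral>\<omega>. (\<Sum>k<n. norm (f k \<omega>)) \<partial>M)"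
          using int by (intro Bochner_Integration.integral_sum[symmetric] integrable_norm)
        also have "\<dots> \<le> (\<integral>\<omega>. exp (norm z * \<bar>X \<omega>\<bar>) \<partial>M)"
          by (intro integral_mono E part Bochner_Integration.integrable_sum integrable_norm int)
        finally show "(\<Sum>k<n. \<integral>\<omega>. norm (f k \<omega>) \<partial>M) \<le> (\<integral>\<omega>. exp (norm z * \<bar>X \<omega>\<bar>) \<partial>M)" .
      qed simp
    qed
    moreover have "(\<Sum>k. f k \<omega>) = W \<omega> * exp (\<i> * z * of_real (X \<omega>))" for \<omega>
      unfolding f_def by (rule sums_unique[symmetric]) (intro sums_mult exp_converges)
    moreover have "integral\<^sup>L M (f k) = c k * (z - 0) ^ k" for k
    proof -
      have "f k \<omega> = W \<omega> * (\<i> * of_real (X \<omega>)) ^ k * (z ^ k / fact k)" for \<omega>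
        by (simp add: f_def power_mult_distrib scaleR_conv_of_real field_simps)
      then have "integral\<^sup>L M (f k) = (CLINT \<omega>|M. W \<omega> * (\<i> * of_real (X \<omega>)) ^ k * (z ^ k / fact k))"
        by presburger
      also have "\<dots> = c k * (z - 0) ^ k" unfolding c_def integral_mult_left_zero by simp
      finally show ?thesis .
    qed
    ultimately show ?thesis by (simp add: wlap_def)
  qed
  have "wlap M W X holomorphic_on ball 0 r" for r
    by (rule power_series_holomorphic) (rule sums)
  then have "wlap M W X field_differentiable at z" for z
    by (metis holomorphic_on_imp_differentiable_at open_ball mem_ball_0 gt_ex)
  then show ?thesis by (simp add: holomorphic_on_def field_differentiable_at_within)
qed

end


section \<open>The theorems of Marcinkiewicz, Cramer and Heyde\<close>

lemma norm_quadratic_le: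
  fixes z :: complex
  shows "norm (c0 + c1 * z + c2 * z ^ 2) \<le> (norm c0 + norm c1 + norm c2) * (1 + norm z ^ 2)"
proof -
  have z: "norm z \<le> 1 + norm z ^ 2"
  proof (cases "norm z \<le> 1")
    case False
    then show ?thesis using self_le_power[of "norm z" 2] by simp
  qed (simp add: add_increasing2)
  have "norm (c0 + c1 * z + c2 * z ^ 2) \<le> norm c0 * 1 + norm c1 * norm z + norm c2 * norm z ^ 2"
    by (intro order_trans[OF norm_triangle_ineq] add_mono) (auto simp: norm_mult norm_power)
  also have "\<dots> \<le> norm c0 * (1 + norm z ^ 2) + norm c1 * (1 + norm z ^ 2) + norm c2 * (1 + norm z ^ 2)"
    by (intro add_mono mult_left_mono z) auto
  finally show ?thesis by (simp add: algebra_simps)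
qed

lemma poly_degree_le_2:
  fixes P :: "'a::comm_ring_1 poly"
  assumes "degree P \<le> 2"
  shows "poly P z = coeff P 0 + coeff P 1 * z + coeff P 2 * z ^ 2"
proof -
  have "poly P z = (\<Sum>i\<le>2. coeff P i * z ^ i)"
    unfolding poly_altdef
    by (rule sum.mono_neutral_left) (use assms in \<open>auto intro: le_degree\<close>)
  then show ?thesis by (simp add: eval_nat_numeral)
qed

context prob_space
begin

text \<open>The exponential moments come first: they make \<open>wlap\<close> entire, and only then
  can the identity theorem carry the local formula to the plane, where the ridge property is
  stated.\<close>

theorem Marcinkiewicz:
  assumes X: "X \<in> borel_measurable M" and r: "r > 0"
    and eq: "\<And>s. \<bar>s\<bar> < r \<Longrightarrow> wlap M (\<lambda>_. 1) X (of_real s) = exp (poly P (of_real s))"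
  shows "integrable M (\<lambda>\<omega>. exp (y * X \<omega>))" "degree P \<le> 2"
    and "wlap M (\<lambda>_. 1) X z = exp (poly P z)"
proof -
  have G: "(\<lambda>z. exp (poly P z)) holomorphic_on UNIV" by (intro holomorphic_intros)
  show em: "integrable M (\<lambda>\<omega>. exp (y * X \<omega>))" for y
    by (rule exp_moments_of_entire[OF X G r eq])
  have hol: "wlap M (\<lambda>_. 1) X holomorphic_on UNIV"
    by (rule wlap_holomorphic[OF X _ _ em]) auto
  show F: "wlap M (\<lambda>_. 1) X z = exp (poly P z)" for z
    by (rule entire_eq_of_real_nbhd[OF hol G r eq])
  show "degree P \<le> 2"
  proof (rule degree_le_2_of_ridge)
    fix z
    define E where "E = (\<integral>\<omega>. exp (- Im z * X \<omega>) \<partial>M)"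
    have "norm (wlap M (\<lambda>_. 1) X z) \<le> E"
      unfolding E_def by (rule norm_wlap_le[OF X _ _ em]) auto
    also have "E \<le> norm (wlap M (\<lambda>_. 1) X (\<i> * of_real (Im z)))"
      unfolding wlap_imaginary E_def by simp
    finally show "Re (poly P z) \<le> Re (poly P (\<i> * of_real (Im z)))"
      by (simp add: F)
  qed
qed

text \<open>Jensen's inequality, from the tangent \<open>1 + u \<le> exp u\<close> at the mean. In
  Cramer's argument it bounds the other factors from below.\<close>

lemma expectation_exp_ge:
  fixes X :: "'a \<Rightarrow> real"
  assumes [measurable]: "X \<in> borel_measurable M" and em: "\<And>y. integrable M (\<lambda>\<omega>. exp (y * X \<omega>))"
  shows "exp (y * expectation X) \<le> (\<integral>\<omega>. exp (y * X \<omega>) \<partial>M)"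
proof -
  have int: "integrable M X"
  proof (rule Bochner_Integration.integrable_bound[OF Bochner_Integration.integrable_add[OF em[of 1] em[of "-1"]]])
    have "\<bar>x\<bar> \<le> exp x + exp (- x)" for x :: real
      using exp_ge_add_one_self[of x] exp_ge_add_one_self[of "- x"] exp_ge_zero[of x] exp_ge_zero[of "-x"]
      by linarith
    then have "norm x \<le> norm (exp (1 * x) + exp (- 1 * x))" for x :: real
      by (simp add: abs_of_pos add_pos_pos)
    then show "AE \<omega> in M. norm (X \<omega>) \<le> norm (exp (1 * X \<omega>) + exp (- 1 * X \<omega>))" by blast
  qed simp
  define m where "m = expectation X"
  have "1 = (\<integral>\<omega>. 1 + y * (X \<omega> - m) \<partial>M)"
    using int by (simp add: m_def prob_space)
  also have "\<dots> \<le> (\<integral>\<omega>. exp (y * X \<omega>) * exp (- (y * m)) \<partial>M)"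
  proof (rule integral_mono)
    show "1 + y * (X \<omega> - m) \<le> exp (y * X \<omega>) * exp (- (y * m))" for \<omega>
      using exp_ge_add_one_self[of "y * (X \<omega> - m)"] by (simp add: algebra_simps exp_diff exp_minus divide_inverse)
  qed (use int em in auto)
  also have "\<dots> = (\<integral>\<omega>. exp (y * X \<omega>) \<partial>M) * exp (- (y * m))" by simp
  finally show ?thesis by (simp add: m_def exp_minus field_simps)
qed

text \<open>By independence the real exponential expectations multiply to that of the sum. The
  factors other than that of \<open>X j\<close> are at least
  \<open>exp (y * expectation (X i))\<close>, so \<open>X j\<close> inherits growth of order 2 from
  the sum; and its transform divides an exponential, hence has no zeros.\<close>

theorem Cramer_decomposition:
  assumes fin: "finite J" and j: "j \<in> J"
    and indep: "indep_vars (\<lambda>_. borel) X J"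
    and em: "\<And>y. integrable M (\<lambda>\<omega>. exp (y * (\<Sum>i\<in>J. X i \<omega>)))"
    and F: "\<And>z. wlap M (\<lambda>_. 1) (\<lambda>\<omega>. \<Sum>i\<in>J. X i \<omega>) z = exp (c0 + c1 * z + c2 * z ^ 2)"
  shows "integrable M (\<lambda>\<omega>. exp (y * X j \<omega>))"
    and "\<exists>d0 d1 d2. \<forall>z. wlap M (\<lambda>_. 1) (X j) z = exp (d0 + d1 * z + d2 * z ^ 2)"
proof -
  have [measurable]: "i \<in> J \<Longrightarrow> X i \<in> borel_measurable M" for i
    using indep by (simp add: indep_vars_def2)
  \<comment> \<open>Nonnegative integrals multiply under independence even when they may be
    infinite. The product is finite and no factor is 0, so every factor is finite.\<close>
  have em': "integrable M (\<lambda>\<omega>. exp (y * X i \<omega>))" if i: "i \<in> J" for i y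
  proof -
    let ?N = "\<lambda>i. \<integral>\<^sup>+\<omega>. ennreal (exp (y * X i \<omega>)) \<partial>M"
    have pos: "?N i \<noteq> 0" if i: "i \<in> J" for i
    proof
      assume "?N i = 0"
      then have "AE \<omega> in M. ennreal (exp (y * X i \<omega>)) = 0"
        using i by (subst (asm) nn_integral_0_iff_AE) auto
      then show False by simp
    qed
    have "(\<Prod>i\<in>J. ?N i) = (\<integral>\<^sup>+\<omega>. (\<Prod>i\<in>J. ennreal (exp (y * X i \<omega>))) \<partial>M)"
      by (intro indep_vars_nn_integral[symmetric] fin indep_vars_compose2[OF indep]) auto
    also have "\<dots> = (\<integral>\<^sup>+\<omega>. ennreal (exp (y * (\<Sum>i\<in>J. X i \<omega>))) \<partial>M)"
      by (intro nn_integral_cong) (simp add: prod_ennreal sum_distrib_left exp_sum fin)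
    also have "\<dots> < \<infinity>"
      using em[of y] by (simp add: integrable_iff_bounded)
    finally have "?N i * (\<Prod>i\<in>J-{i}. ?N i) < \<infinity>"
      using fin i by (simp add: prod.remove)
    moreover have "(\<Prod>i\<in>J-{i}. ?N i) \<noteq> 0"
      using fin pos by (simp add: prod_zero_iff)
    ultimately have "?N i < \<infinity>"
      by (metis ennreal_mult_eq_top_iff infinity_ennreal_def less_top top.not_eq_extremum)
    then show ?thesis using i by (intro integrableI_nonneg) auto
  qed
  show "integrable M (\<lambda>\<omega>. exp (y * X j \<omega>))" by (rule em'[OF j])
  \<comment> \<open>\<open>K\<close> controls the quadratic exponent of the sum; \<open>A\<close>
    pays for the means of the other summands.\<close>
  define K where "K = norm c0 + norm c1 + norm c2"
  define A where "A = \<bar>\<Sum>i\<in>J-{j}. expectation (X i)\<bar>"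
  have bd: "(\<integral>\<omega>. exp (y * X j \<omega>) \<partial>M) \<le> exp ((K + A) * (1 + y ^ 2))" for y
  proof -
    let ?E = "\<lambda>i. \<integral>\<omega>. exp (y * X i \<omega>) \<partial>M"
    have "?E j * exp (y * (\<Sum>i\<in>J-{j}. expectation (X i))) = ?E j * (\<Prod>i\<in>J-{j}. exp (y * expectation (X i)))"
      using fin by (simp add: exp_sum sum_distrib_left)
    also have "\<dots> \<le> ?E j * (\<Prod>i\<in>J-{j}. ?E i)"
      by (intro mult_left_mono prod_mono conjI expectation_exp_ge em') auto
    also have "\<dots> = (\<Prod>i\<in>J. ?E i)" using fin j by (simp add: prod.remove)
    also have "\<dots> = (\<integral>\<omega>. (\<Prod>i\<in>J. exp (y * X i \<omega>)) \<partial>M)"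
      by (intro indep_vars_lebesgue_integral[symmetric] fin indep_vars_compose2[OF indep] em') auto
    also have "\<dots> = (\<integral>\<omega>. exp (y * (\<Sum>i\<in>J. X i \<omega>)) \<partial>M)"
      by (intro Bochner_Integration.integral_cong refl) (simp add: sum_distrib_left exp_sum fin)
    also have "\<dots> \<le> norm (wlap M (\<lambda>_. 1) (\<lambda>\<omega>. \<Sum>i\<in>J. X i \<omega>) (\<i> * of_real (- y)))"
      unfolding wlap_imaginary by simp
    also have "\<dots> \<le> exp (norm (c0 + c1 * (\<i> * of_real (- y)) + c2 * (\<i> * of_real (- y)) ^ 2))"
      unfolding F by (rule norm_exp)
    also have "\<dots> \<le> exp (K * (1 + y ^ 2))"
      using norm_quadratic_le[of c0 c1 "\<i> * of_real (- y)" c2] by (simp add: K_def norm_mult)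
    finally have "?E j \<le> exp (K * (1 + y ^ 2)) * exp (- (y * (\<Sum>i\<in>J-{j}. expectation (X i))))"
      by (simp add: exp_minus field_simps)
    also have "\<dots> = exp (K * (1 + y ^ 2) - y * (\<Sum>i\<in>J-{j}. expectation (X i)))"
      by (simp add: exp_diff exp_minus divide_inverse)
    also have "\<dots> \<le> exp ((K + A) * (1 + y ^ 2))"
    proof -
      have "- (y * (\<Sum>i\<in>J-{j}. expectation (X i))) \<le> \<bar>y\<bar> * A"
        unfolding A_def abs_mult[symmetric] by linarith
      also have "\<dots> \<le> (1 + y ^ 2) * A"
      proof (intro mult_right_mono)
        show "\<bar>y\<bar> \<le> 1 + y ^ 2" 
          using zero_le_power2[of "\<bar>y\<bar> - 1"] abs_ge_zero[of y] by (simp add: power2_diff)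
      qed (simp add: A_def)
      finally show ?thesis by (simp add: algebra_simps)
    qed
    finally show ?thesis .
  qed
  show "\<exists>d0 d1 d2. \<forall>z. wlap M (\<lambda>_. 1) (X j) z = exp (d0 + d1 * z + d2 * z ^ 2)"
  proof -
    have hol: "wlap M (\<lambda>_. 1) (X j) holomorphic_on UNIV"
      by (rule wlap_holomorphic[OF _ _ _ em'[OF j]]) (use j in auto)
    have nz: "wlap M (\<lambda>_. 1) (X j) z \<noteq> 0" for z
    proof -
      have "(\<Prod>i\<in>J. wlap M (\<lambda>_. 1) (X i) z) = (CLINT \<omega>|M. (\<Prod>i\<in>J. 1 * exp (\<i> * z * of_real (X i \<omega>))))"
        unfolding wlap_def
        by (intro indep_vars_lebesgue_integral[symmetric] fin indep_vars_compose2[OF indep] wlap_integrable em') auto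
      also have "\<dots> = wlap M (\<lambda>_. 1) (\<lambda>\<omega>. \<Sum>i\<in>J. X i \<omega>) z"
        unfolding wlap_def
        by (intro Bochner_Integration.integral_cong refl) (simp add: sum_distrib_left exp_sum fin)
      also have "\<dots> \<noteq> 0" unfolding F by simp
      finally show ?thesis using fin j by (simp add: prod_zero_iff)
    qed
    have "norm (wlap M (\<lambda>_. 1) (X j) z) \<le> exp ((K + A) * (1 + norm z ^ 2))" for z
    proof -
      have "norm (wlap M (\<lambda>_. 1) (X j) z) \<le> (\<integral>\<omega>. exp (- Im z * X j \<omega>) \<partial>M)"
        by (rule norm_wlap_le[OF _ _ _ em'[OF j]]) (use j in auto)
      also have "\<dots> \<le> exp ((K + A) * (1 + (- Im z) ^ 2))" by (rule bd)
      also have "\<dots> \<le> exp ((K + A) * (1 + norm z ^ 2))"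
        by (simp, intro mult_left_mono add_left_mono) (simp_all add: K_def A_def cmod_power2)
      finally show ?thesis .
    qed
    from entire_nonvanishing_eq_exp_quadratic[OF hol nz this] show ?thesis by metis
  qed
qed

lemma wlap_eq_char:
  assumes "X \<in> borel_measurable M"
  shows "wlap M (\<lambda>_. 1) X (of_real s) = char (distr M borel X) s"
  using assms by (simp add: wlap_def char_def integral_distr cis_conv_exp mult_ac)

theorem Heyde_real:
  assumes fin: "finite I" and indep: "indep_vars (\<lambda>_. borel) X I"
    and c: "\<And>i j. i \<in> I \<Longrightarrow> j \<in> I \<Longrightarrow> c i + c j \<noteq> (0::real)"
    and eq: "\<And>s t. (\<Prod>i\<in>I. wlap M (\<lambda>_. 1) (X i) (of_real (s + c i * t)))
      = (\<Prod>i\<in>I. wlap M (\<lambda>_. 1) (X i) (of_real (s - c i * t)))"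
    and j: "j \<in> I"
  shows "integrable M (\<lambda>\<omega>. exp (y * X j \<omega>))"
    and "\<exists>d0 d1 d2. \<forall>z. wlap M (\<lambda>_. 1) (X j) z = exp (d0 + d1 * z + d2 * z ^ 2)"
proof -
  have meas: "i \<in> I \<Longrightarrow> X i \<in> borel_measurable M" for i
    using indep by (simp add: indep_vars_def2)
  define f where "f i s = wlap M (\<lambda>_. 1) (X i) (of_real s)" for i s
  have f_char: "f i = char (distr M borel (X i))" if "i \<in> I" for i
    using wlap_eq_char[OF meas[OF that]] by (simp add: f_def fun_eq_iff)
  have f_cont: "isCont (f i) s" and f0: "f i 0 = 1" if "i \<in> I" for i s
    unfolding f_char[OF that] using meas[OF that]
    by (simp_all add: real_distribution.isCont_char real_distribution.char_zero)
  \<comment> \<open>With \<open>card I\<close> logarithms of norm below \<open>\<epsilon>\<close>,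
    each side of the equation has norm at most 1. The imaginary parts then differ by less than
    \<open>2 * pi\<close>, so equal exponentials have equal exponents.\<close>
  define \<epsilon> where "\<epsilon> = 1 / (1 + real (card I))"
  have \<epsilon>: "\<epsilon> > 0" "card I * \<epsilon> \<le> 1" by (auto simp: \<epsilon>_def)
  have "\<exists>\<delta>>0. \<forall>x. \<bar>x\<bar> < \<delta> \<longrightarrow> Re (f i x) > 0 \<and> norm (Ln (f i x)) < \<epsilon>" if i: "i \<in> I" for i
  proof -
    have lim: "(f i \<longlongrightarrow> 1) (nhds 0)"
      using f_cont[OF i, of 0] f0[OF i] tendsto_at_iff_tendsto_nhds[of "f i" 0] by (simp add: isCont_def)
    have 1: "\<forall>\<^sub>F x in nhds 0. Re (f i x) > 0"
      using tendsto_Re[OF lim] by (rule order_tendstoD) simp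
    have "((\<lambda>x. norm (Ln (f i x))) \<longlongrightarrow> norm (Ln 1)) (nhds 0)"
      by (intro tendsto_intros lim) simp
    then have 2: "\<forall>\<^sub>F x in nhds 0. norm (Ln (f i x)) < \<epsilon>"
      by (rule order_tendstoD) (simp add: \<epsilon>)
    from 1 2 have "\<forall>\<^sub>F x in nhds 0. Re (f i x) > 0 \<and> norm (Ln (f i x)) < \<epsilon>" by (rule eventually_conj)
    then show ?thesis unfolding eventually_nhds_metric by (simp add: dist_real_def)
  qed
  then obtain \<delta>i where \<delta>i: "\<And>i. i \<in> I \<Longrightarrow> \<delta>i i > 0"
    "\<And>i x. i \<in> I \<Longrightarrow> \<bar>x\<bar> < \<delta>i i \<Longrightarrow> Re (f i x) > 0 \<and> norm (Ln (f i x)) < \<epsilon>"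
    by metis
  define \<delta> where "\<delta> = Min (\<delta>i ` I) / 2"
  have Min: "Min (\<delta>i ` I) > 0" using fin j \<delta>i(1) by (subst Min_gr_iff) auto
  then have \<delta>: "\<delta> > 0" by (simp add: \<delta>_def)
  have small: "Re (f i x) > 0" "norm (Ln (f i x)) < \<epsilon>" if "i \<in> I" "\<bar>x\<bar> \<le> \<delta>" for i x
  proof -
    have "Min (\<delta>i ` I) \<le> \<delta>i i" using fin that(1) by simp
    then have "\<bar>x\<bar> < \<delta>i i" using that(2) Min unfolding \<delta>_def by linarith
    then show "Re (f i x) > 0" "norm (Ln (f i x)) < \<epsilon>" using \<delta>i(2)[OF that(1)] by auto
  qed
  define \<psi> where "\<psi> i x = Ln (f i x)" for i x
  have exp\<psi>: "exp (\<psi> i x) = f i x" if "i \<in> I" "\<bar>x\<bar> \<le> \<delta>" for i x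
    unfolding \<psi>_def by (rule exp_Ln) (use small(1)[OF that] in auto)
  have \<psi>_cont: "continuous_on {-\<delta>..\<delta>} (\<psi> i)" if "i \<in> I" for i
    unfolding \<psi>_def
  proof (rule continuous_on_Ln')
    show "continuous_on {-\<delta>..\<delta>} (f i)" using f_cont[OF that] by (simp add: continuous_at_imp_continuous_on)
    show "f i x \<notin> \<real>\<^sub>\<le>\<^sub>0" if "x \<in> {-\<delta>..\<delta>}" for x
      using small(1)[OF \<open>i \<in> I\<close>, of x] that by (auto simp: complex_nonpos_Reals_iff abs_le_iff)
  qed
  \<comment> \<open>\<open>r * L = \<delta>\<close> keeps \<open>s + c i * t\<close> and
    \<open>s - c i * t\<close> where the logarithms are defined.\<close>
  define L where "L = 1 + (\<Sum>i\<in>I. \<bar>c i\<bar>)"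
  have L: "L \<ge> 1" by (simp add: L_def sum_nonneg)
  define r where "r = \<delta> / L"
  have r: "r > 0" "r * L = \<delta>" "r \<le> \<delta>"
    using \<delta> L by (auto simp: r_def field_simps)
  have range: "\<bar>s + c i * t\<bar> \<le> \<delta>" "\<bar>s - c i * t\<bar> \<le> \<delta>" if "\<bar>s\<bar> \<le> r" "\<bar>t\<bar> \<le> r" "i \<in> I" for s t i
  proof -
    have "\<bar>c i\<bar> \<le> (\<Sum>i\<in>I. \<bar>c i\<bar>)" using fin that(3) by (intro member_le_sum) auto
    then have "\<bar>c i * t\<bar> \<le> (\<Sum>i\<in>I. \<bar>c i\<bar>) * r"
      unfolding abs_mult using that(2) by (intro mult_mono) (auto intro: order_trans[OF abs_ge_zero])
    moreover have "r + (\<Sum>i\<in>I. \<bar>c i\<bar>) * r = \<delta>" using r(2) by (simp add: L_def algebra_simps)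
    ultimately show "\<bar>s + c i * t\<bar> \<le> \<delta>" "\<bar>s - c i * t\<bar> \<le> \<delta>" using that(1) by linarith+
  qed
  have log_eq: "(\<Sum>i\<in>I. \<psi> i (s + c i * t)) = (\<Sum>i\<in>I. \<psi> i (s - c i * t))" if "\<bar>s\<bar> \<le> r" "\<bar>t\<bar> \<le> r" for s t
  proof (rule exp_complex_eqI)
    have *: "\<bar>Im (\<Sum>i\<in>I. \<psi> i (u i))\<bar> \<le> 1" if "\<And>i. i \<in> I \<Longrightarrow> \<bar>u i\<bar> \<le> \<delta>" for u
    proof -
      have "\<bar>Im (\<Sum>i\<in>I. \<psi> i (u i))\<bar> \<le> norm (\<Sum>i\<in>I. \<psi> i (u i))" by (rule abs_Im_le_cmod)
      also have "\<dots> \<le> (\<Sum>i\<in>I. \<epsilon>)"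
        by (rule sum_norm_le) (use small(2) that in \<open>auto simp: \<psi>_def intro: less_imp_le\<close>)
      finally show ?thesis using \<epsilon>(2) by simp
    qed
    have "\<bar>Im (\<Sum>i\<in>I. \<psi> i (s + c i * t))\<bar> \<le> 1" "\<bar>Im (\<Sum>i\<in>I. \<psi> i (s - c i * t))\<bar> \<le> 1"
      by (intro * range that; assumption)+
    then show "\<bar>Im (\<Sum>i\<in>I. \<psi> i (s + c i * t)) - Im (\<Sum>i\<in>I. \<psi> i (s - c i * t))\<bar> < 2 * pi"
      using pi_gt3 by linarith
    have "exp (\<Sum>i\<in>I. \<psi> i (s + c i * t)) = (\<Prod>i\<in>I. f i (s + c i * t))"
      unfolding exp_sum[OF fin] by (intro prod.cong refl exp\<psi> range that)
    also have "\<dots> = (\<Prod>i\<in>I. f i (s - c i * t))" using eq[of s t] by (simp add: f_def)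
    also have "\<dots> = exp (\<Sum>i\<in>I. \<psi> i (s - c i * t))"
      unfolding exp_sum[OF fin] by (intro prod.cong refl exp\<psi>[symmetric] range that)
    finally show "exp (\<Sum>i\<in>I. \<psi> i (s + c i * t)) = exp (\<Sum>i\<in>I. \<psi> i (s - c i * t))" .
  qed
  text \<open>The coefficients \<open>c i\<close> need not be distinct: equal ones are grouped, and since
    \<open>c i + c j \<noteq> 0\<close> the groups of \<open>c\<close> and of \<open>-c\<close> do not interfere.\<close>
  define J where "J d = {i \<in> I. c i = d}" for d
  \<comment> \<open>\<open>\<psi> i\<close> enters with a plus sign at \<open>d = c i\<close> and
    with a minus sign at \<open>d = - c i\<close>; this brings both sides of the equation into the
    single form \<open>\<phi> d (s + d * t)\<close>.\<close>
  define \<phi> where "\<phi> d x = (\<Sum>i\<in>J d. \<psi> i x) - (\<Sum>i\<in>J (- d). \<psi> i x)" for d x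
  define D where "D = c ` I \<union> uminus ` c ` I"
  have finD: "finite D" using fin by (simp add: D_def)
  have grp: "(\<Sum>d\<in>D. \<Sum>i\<in>J d. g i d) = (\<Sum>i\<in>I. g i (c i))" for g :: "_ \<Rightarrow> real \<Rightarrow> complex"
  proof -
    have "(\<Sum>d\<in>D. \<Sum>i\<in>J d. g i d) = (\<Sum>d\<in>D. \<Sum>i | i \<in> I \<and> c i = d. g i (c i))"
      by (intro sum.cong) (auto simp: J_def)
    also have "\<dots> = (\<Sum>i\<in>I. g i (c i))" by (rule sum.group[OF fin finD]) (auto simp: D_def)
    finally show ?thesis .
  qed
  have "\<exists>\<rho>>0. \<forall>d\<in>D. \<exists>P. \<forall>x. \<bar>x\<bar> \<le> \<rho> \<longrightarrow> \<phi> d x = poly P (of_real x)"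
  proof (rule continuous_shift_sum_polynomial[OF finD r(1)])
    fix d
    show "continuous_on {-r..r} (\<phi> d)"
      unfolding \<phi>_def
      by (intro continuous_intros continuous_on_subset[OF \<psi>_cont]) (use r in \<open>auto simp: J_def\<close>)
  next
    fix s t :: real assume st: "\<bar>s\<bar> \<le> r" "\<bar>t\<bar> \<le> r"
    have "(\<Sum>d\<in>D. \<Sum>i\<in>J (- d). \<psi> i (s + d * t)) = (\<Sum>d\<in>uminus ` D. \<Sum>i\<in>J d. \<psi> i (s - d * t))"
      by (subst sum.reindex) (auto simp: inj_on_def)
    also have "uminus ` D = D" by (force simp: D_def)
    finally have "(\<Sum>d\<in>D. \<phi> d (s + d * t)) = (\<Sum>i\<in>I. \<psi> i (s + c i * t)) - (\<Sum>i\<in>I. \<psi> i (s - c i * t))"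
      using grp[of "\<lambda>i d. \<psi> i (s + d * t)"] grp[of "\<lambda>i d. \<psi> i (s - d * t)"]
      by (simp add: \<phi>_def sum_subtractf)
    then show "(\<Sum>d\<in>D. \<phi> d (s + d * t)) = 0" using log_eq[OF st] by simp
  qed
  moreover have "c j \<in> D" using j by (simp add: D_def)
  ultimately obtain \<rho> P where \<rho>: "\<rho> > 0"
    and P: "\<And>x. \<bar>x\<bar> \<le> \<rho> \<Longrightarrow> \<phi> (c j) x = poly P (of_real x)"
    by metis
  \<comment> \<open>A member \<open>i\<close> of this group would give \<open>c i + c j = 0\<close>.
    So \<open>\<phi> (c j)\<close> contains the logarithms of the group of \<open>c j\<close> alone,
    that is, the logarithm of the characteristic function of the sum of its
    \<open>X i\<close>.\<close>
  have Jm: "J (- c j) = {}" using c j by (force simp: J_def)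
  define K where "K = J (c j)"
  have K: "finite K" "K \<subseteq> I" "j \<in> K" using fin j by (auto simp: K_def J_def)
  have indepK: "indep_vars (\<lambda>_. borel) X K" using indep K(2) by (rule indep_vars_subset)
  have measS: "(\<lambda>\<omega>. \<Sum>i\<in>K. X i \<omega>) \<in> borel_measurable M"
    using meas K(2) by (intro borel_measurable_sum) blast
  have S: "wlap M (\<lambda>_. 1) (\<lambda>\<omega>. \<Sum>i\<in>K. X i \<omega>) (of_real s) = exp (poly P (of_real s))"
    if "\<bar>s\<bar> < min \<rho> \<delta>" for s
  proof -
    have "wlap M (\<lambda>_. 1) (\<lambda>\<omega>. \<Sum>i\<in>K. X i \<omega>) (of_real s)
        = char (distr M borel (\<lambda>\<omega>. \<Sum>i\<in>K. X i \<omega>)) s"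
      by (rule wlap_eq_char) (rule measS)
    also have "\<dots> = (\<Prod>i\<in>K. char (distr M borel (X i)) s)" by (rule char_distr_sum[OF indepK])
    also have "\<dots> = (\<Prod>i\<in>K. exp (\<psi> i s))"
      using K that by (intro prod.cong refl) (auto simp: exp\<psi> f_char)
    also have "\<dots> = exp (\<phi> (c j) s)" by (simp add: exp_sum K(1) \<phi>_def Jm flip: K_def)
    finally show ?thesis using P[of s] that by simp
  qed
  have "min \<rho> \<delta> > 0" using \<rho> \<delta> by simp
  note Mz = Marcinkiewicz[OF measS this S]
  have F: "wlap M (\<lambda>_. 1) (\<lambda>\<omega>. \<Sum>i\<in>K. X i \<omega>) z = exp (coeff P 0 + coeff P 1 * z + coeff P 2 * z ^ 2)" for z
    using Mz(3)[of z] poly_degree_le_2[OF Mz(2), of z] by simp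
  show "integrable M (\<lambda>\<omega>. exp (y * X j \<omega>))"
    "\<exists>d0 d1 d2. \<forall>z. wlap M (\<lambda>_. 1) (X j) z = exp (d0 + d1 * z + d2 * z ^ 2)"
    using Cramer_decomposition[OF K(1,3) indepK Mz(1) F] by blast+
qed

end

section \<open>Zeros of entire solutions of Heyde's equation\<close>

lemma entire_prod_eq_0:
  fixes g :: "'i \<Rightarrow> complex \<Rightarrow> complex"
  assumes "finite I" "\<And>i. i \<in> I \<Longrightarrow> g i holomorphic_on UNIV" "\<And>z. (\<Prod>i\<in>I. g i z) = 0"
  shows "\<exists>i\<in>I. \<forall>z. g i z = 0"
  using assms
proof (induction I rule: finite_induct)
  case (insert i I)
  show ?case
  proof (cases "\<forall>z. g i z = 0")
    case False
    then obtain w where w: "g i w \<noteq> 0" by blast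
    have "continuous_on UNIV (g i)" using insert.prems(1) by (auto intro: holomorphic_on_imp_continuous_on)
    then have op: "open {z. g i z \<noteq> 0}" by (intro open_Collect_neq continuous_on_const)
    \<comment> \<open>The remaining product vanishes on the nonempty open set where
      \<open>g i\<close> does not, hence everywhere: entire functions have no zero divisors.\<close>
    have "(\<Prod>i\<in>I. g i z) = 0" for z
    proof (rule analytic_continuation_open[of "{z. g i z \<noteq> 0}" UNIV "\<lambda>z. \<Prod>i\<in>I. g i z" "\<lambda>_. 0"])
      show "(\<lambda>z. \<Prod>i\<in>I. g i z) holomorphic_on UNIV" using insert.prems(1) by (intro holomorphic_intros) auto
      show "(\<Prod>i\<in>I. g i z) = 0" if "z \<in> {z. g i z \<noteq> 0}" for z
        using insert.prems(2)[of z] insert.hyps that by simp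
    qed (use op w in auto)
    then show ?thesis using insert.IH insert.prems by auto
  qed auto
qed simp

theorem entire_Heyde_nonvanishing:
  fixes G :: "'i \<Rightarrow> complex \<Rightarrow> complex" and c :: "'i \<Rightarrow> real"
  assumes fin: "finite I" and hol: "\<And>i. i \<in> I \<Longrightarrow> G i holomorphic_on UNIV"
    and c: "\<And>i j. i \<in> I \<Longrightarrow> j \<in> I \<Longrightarrow> c i + c j \<noteq> 0"
    and eq: "\<And>s t. (\<Prod>i\<in>I. G i (of_real (s + c i * t))) = (\<Prod>i\<in>I. G i (of_real (s - c i * t)))"
    and nz: "\<And>i. i \<in> I \<Longrightarrow> \<exists>z. G i z \<noteq> 0" and j: "j \<in> I"
  shows "G j z \<noteq> 0"
proof
  assume zero: "G j z = 0"
  have aff: "(\<lambda>w. G i (u + v * w)) holomorphic_on UNIV" if "i \<in> I" for i u v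
  proof -
    have "(\<lambda>w. u + v * w) holomorphic_on UNIV" by (intro holomorphic_intros)
    from holomorphic_on_compose_gen[OF this hol[OF that]] show ?thesis by (simp add: o_def)
  qed
  \<comment> \<open>A zero of \<open>G j\<close> may lie off the real axis, so the equation is
    continued to complex \<open>s\<close> with \<open>t\<close> still real.\<close>
  have ext: "(\<Prod>i\<in>I. G i (s + of_real (c i * t))) = (\<Prod>i\<in>I. G i (s - of_real (c i * t)))" for s t
  proof (rule entire_eq_of_real_nbhd[where r = 1 and z = s
        and f = "\<lambda>s. \<Prod>i\<in>I. G i (s + of_real (c i * t))" and g = "\<lambda>s. \<Prod>i\<in>I. G i (s - of_real (c i * t))"])
    show "(\<lambda>s. \<Prod>i\<in>I. G i (s + of_real (c i * t))) holomorphic_on UNIV"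
      using aff[where v = 1 and u = "of_real (c _ * t)"] by (intro holomorphic_intros) (simp add: add.commute)
    show "(\<lambda>s. \<Prod>i\<in>I. G i (s - of_real (c i * t))) holomorphic_on UNIV"
      using aff[where v = 1 and u = "- of_real (c _ * t)"] by (intro holomorphic_intros) simp
  qed (use eq in auto)
  \<comment> \<open>With \<open>s = z - c j * t\<close> the factor of \<open>j\<close> on the left
    is \<open>G j z = 0\<close> for every real \<open>t\<close>. The right side, in which
    \<open>t\<close> is the only variable, therefore vanishes for real \<open>t\<close> and then for
    every complex \<open>w\<close>.\<close>
  have "(\<Prod>i\<in>I. G i (z + of_real (- (c i + c j)) * w)) = 0" for w
  proof (rule entire_eq_of_real_nbhd[where r = 1 and z = w and g = "\<lambda>_. 0"
        and f = "\<lambda>w. \<Prod>i\<in>I. G i (z + of_real (- (c i + c j)) * w)"])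
    show "(\<lambda>w. \<Prod>i\<in>I. G i (z + of_real (- (c i + c j)) * w)) holomorphic_on UNIV"
      by (intro holomorphic_intros aff)
    fix t :: real assume "\<bar>t\<bar> < 1"
    have "(\<Prod>i\<in>I. G i ((z - of_real (c j * t)) + of_real (c i * t))) = 0"
      using fin j zero by (intro prod_zero bexI[of _ j]) auto
    then have "(\<Prod>i\<in>I. G i ((z - of_real (c j * t)) - of_real (c i * t))) = 0" by (simp only: ext)
    then show "(\<Prod>i\<in>I. G i (z + of_real (- (c i + c j)) * of_real t)) = 0"
      by (simp add: algebra_simps)
  qed auto
  from entire_prod_eq_0[OF fin aff this]
  obtain i where i: "i \<in> I" "\<And>w. G i (z + of_real (- (c i + c j)) * w) = 0" by blast
  have "G i u = 0" for u
  proof -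
    have "z + of_real (- (c i + c j)) * ((z - u) / of_real (c i + c j)) = u"
    proof -
      have "complex_of_real (c i + c j) \<noteq> 0" using c[OF i(1) j] by (simp del: of_real_add)
      then show ?thesis unfolding of_real_minus by (metis add.commute diff_add_cancel minus_diff_eq
          mult_minus_left nonzero_mult_div_cancel_left times_divide_eq_right)
    qed
    then show ?thesis using i(2) by metis
  qed
  then show False using nz[OF i(1)] by blast
qed


section \<open>Gaussian characteristic functions\<close>

text \<open>Differentiating the entire extension avoids logarithms, which are determined only up to
  multiples of \<open>2 * pi * \<i>\<close>.\<close>

lemma exp_quadratic_eq_1:
  assumes "\<And>s::real. exp (u * of_real s + v * of_real s ^ 2) = (1::complex)"
  shows "u = 0" "v = 0"
proof -
  define f where "f z = exp (u * z + v * z ^ 2)" for z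
  have "f holomorphic_on UNIV" unfolding f_def by (intro holomorphic_intros)
  then have f1: "f z = 1" for z
    by (rule entire_eq_of_real_nbhd[of f "\<lambda>_. 1" 1]) (auto simp: f_def assms)
  have "u + 2 * v * z = 0" for z
  proof -
    have "(f has_field_derivative (u + 2 * v * z) * f z) (at z)"
      unfolding f_def by (auto intro!: derivative_eq_intros)
    moreover have "(f has_field_derivative 0) (at z)"
    proof -
      have "f = (\<lambda>_. 1)" using f1 by blast
      then show ?thesis by simp
    qed
    ultimately have "(u + 2 * v * z) * f z = 0" by (rule DERIV_unique)
    then show ?thesis by (simp add: f1)
  qed
  from this[of 0] this[of 1] show "u = 0" "v = 0" by auto
qed

lemma exp_quadratic_le_imp:
  fixes k a b :: real
  assumes k: "k > 0" and le: "\<And>y. k * exp (a * y ^ 2 + b * y) \<le> 1"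
  shows "a \<le> 0" "a = 0 \<Longrightarrow> b = 0"
proof -
  define L where "L = - ln k"
  have L: "a * y ^ 2 + b * y \<le> L" for y
  proof -
    have "ln (k * exp (a * y ^ 2 + b * y)) \<le> ln 1" using le[of y] k by (subst ln_le_cancel_iff) auto
    then show ?thesis using k by (simp add: ln_mult L_def)
  qed
  \<comment> \<open>Adding the bounds at \<open>y\<close> and \<open>- y\<close> removes the linear
    term.\<close>
  have L2: "a * y ^ 2 \<le> L" for y using L[of y] L[of "- y"] by simp
  show "a \<le> 0"
  proof (rule ccontr)
    assume "\<not> a \<le> 0"
    then have "a * (sqrt ((\<bar>L\<bar> + 1) / a)) ^ 2 = \<bar>L\<bar> + 1" by simp
    with L2[of "sqrt ((\<bar>L\<bar> + 1) / a)"] show False by linarith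
  qed
  show "b = 0" if "a = 0"
  proof (rule ccontr)
    assume "b \<noteq> 0"
    then have "b * ((\<bar>L\<bar> + 1) / b) = \<bar>L\<bar> + 1" by simp
    with L[of "(\<bar>L\<bar> + 1) / b"] that show False by simp
  qed
qed

text \<open>The substitution by \<open>c = sqrt (2 * A)\<close> turns the integrand into the
  standard normal density times an oscillation of frequency \<open>B / c\<close>, up to a constant;
  its integral is the known characteristic function.\<close>

lemma gaussian_Fourier_integral:
  fixes A B :: real
  assumes A: "A > 0"
  shows "integrable lborel (\<lambda>s. exp (- A * s ^ 2))"
    and "(CLINT s|lborel. exp (of_real (- A * s ^ 2)) * exp (\<i> * of_real (B * s)))
      = of_real (sqrt (pi / A) * exp (- B\<^sup>2 / (4 * A)))"
proof -
  define c where "c = sqrt (2 * A)"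
  have c: "c > 0" "c ^ 2 = 2 * A" using A by (auto simp: c_def)
  have dens: "std_normal_density (0 + c * s) = exp (- A * s ^ 2) / sqrt (2 * pi)" for s
    using c(2) by (simp add: std_normal_density_def power_mult_distrib)
  have int: "integrable lborel std_normal_density"
    using integrable_std_normal_moment[of 0] by simp
  have "integrable lborel (\<lambda>s. std_normal_density (0 + c * s))"
    by (rule lborel_integrable_real_affine[OF int]) (use c in simp)
  then have "integrable lborel (\<lambda>s. exp (- A * s ^ 2) / sqrt (2 * pi) * sqrt (2 * pi))"
    unfolding dens by (rule integrable_mult_left)
  then show "integrable lborel (\<lambda>s. exp (- A * s ^ 2))" by simp
  let ?f = "\<lambda>x. std_normal_density x *\<^sub>R exp (\<i> * of_real ((B / c) * x))"
  have "char std_normal_distribution (B / c) = (CLINT x|lborel. ?f x)"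
    unfolding char_def by (subst integral_density) (auto simp: cis_conv_exp)
  also have "\<dots> = \<bar>c\<bar> *\<^sub>R (CLINT s|lborel. ?f (0 + c * s))"
    by (rule lborel_integral_real_affine) (use c in simp)
  also have "(\<lambda>s. ?f (0 + c * s)) = (\<lambda>s. (1 / sqrt (2 * pi)) *\<^sub>R (exp (of_real (- A * s ^ 2)) * exp (\<i> * of_real (B * s))))"
  proof
    fix s
    have e: "(B / c) * (0 + c * s) = B * s" using c by simp
    show "?f (0 + c * s) = (1 / sqrt (2 * pi)) *\<^sub>R (exp (of_real (- A * s ^ 2)) * exp (\<i> * of_real (B * s)))"
      unfolding dens e by (simp only: exp_of_real scaleR_conv_of_real) simp
  qed
  also have "\<bar>c\<bar> *\<^sub>R (CLINT s|lborel. (1 / sqrt (2 * pi)) *\<^sub>R (exp (of_real (- A * s ^ 2)) * exp (\<i> * of_real (B * s))))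
      = of_real (c / sqrt (2 * pi)) * (CLINT s|lborel. exp (of_real (- A * s ^ 2)) * exp (\<i> * of_real (B * s)))"
    using c by (simp add: scaleR_conv_of_real)
  finally have 1: "of_real (c / sqrt (2 * pi)) * (CLINT s|lborel. exp (of_real (- A * s ^ 2)) * exp (\<i> * of_real (B * s)))
      = of_real (exp (- (B / c)\<^sup>2 / 2))"
    by (simp only: char_std_normal_distribution)
  have 2: "- (B / c)\<^sup>2 / 2 = - B\<^sup>2 / (4 * A)" using c(2) by (simp add: power_divide)
  have 3: "sqrt (pi / A) * (c / sqrt (2 * pi)) = 1"
    using A unfolding c_def by (simp add: real_sqrt_divide[symmetric] real_sqrt_mult[symmetric])
  define I where "I = (CLINT s|lborel. exp (of_real (- A * s ^ 2)) * exp (\<i> * of_real (B * s)))"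
  have "I = of_real (sqrt (pi / A) * (c / sqrt (2 * pi))) * I" unfolding 3 by simp
  also have "\<dots> = of_real (sqrt (pi / A)) * (of_real (c / sqrt (2 * pi)) * I)"
    by (simp only: of_real_mult mult.assoc)
  also have "\<dots> = of_real (sqrt (pi / A) * exp (- B\<^sup>2 / (4 * A)))"
    using 1 unfolding I_def 2 by (simp only: of_real_mult)
  finally show "(CLINT s|lborel. exp (of_real (- A * s ^ 2)) * exp (\<i> * of_real (B * s)))
      = of_real (sqrt (pi / A) * exp (- B\<^sup>2 / (4 * A)))"
    unfolding I_def .
qed

text \<open>In this parametrization the variance is \<open>2 * \<sigma>\<close>, hence
  \<open>c = sqrt (2 * \<sigma>)\<close>, and \<open>\<sigma> = 0\<close> is the point mass at
  \<open>\<beta>\<close>. Otherwise the normal law is realized as the image of the standard one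
  under \<open>\<beta> + c * x\<close> and identified with \<open>N\<close> by Levy's uniqueness
  theorem.\<close>

lemma gaussian_of_char:
  fixes N :: "real measure"
  assumes N: "real_distribution N" and \<sigma>: "\<sigma> \<ge> 0"
    and ch: "\<And>s. char N s = exp (of_real (- \<sigma> * s ^ 2) + \<i> * of_real (\<beta> * s))"
  shows "gaussian N"
proof (cases "\<sigma> = 0")
  case True
  interpret R: prob_space "return borel \<beta>" by (rule prob_space_return) simp
  have "real_distribution (return borel \<beta>)"
    by (simp add: real_distribution_def real_distribution_axioms_def R.prob_space_axioms)
  moreover have "char (return borel \<beta>) s = exp (\<i> * of_real (\<beta> * s))" for s
    by (simp add: char_def integral_return cis_conv_exp mult.commute)
  then have "char (return borel \<beta>) = char N"
    by (simp add: fun_eq_iff ch True)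
  ultimately have "return borel \<beta> = N" using N by (intro Levy_uniqueness)
  then show ?thesis unfolding gaussian_def by blast
next
  case False
  define c where "c = sqrt (2 * \<sigma>)"
  have c: "c > 0" "c ^ 2 = 2 * \<sigma>" using False \<sigma> by (auto simp: c_def)
  interpret S: prob_space std_normal_distribution by (rule prob_space_normal_density) simp
  have "distributed std_normal_distribution lborel (\<lambda>x. \<beta> + c * x) (normal_density \<beta> c)"
    unfolding S.normal_standard_normal_convert[OF c(1)] using c(1)
    by (auto simp: distributed_def distr_id2)
  then have D: "density lborel (normal_density \<beta> c) = distr std_normal_distribution borel (\<lambda>x. \<beta> + c * x)"
    using distributed_distr_eq_density[symmetric] distr_cong[OF refl sets_lborel] by metis
  have "real_distribution (density lborel (normal_density \<beta> c))"
    unfolding D by (rule S.real_distribution_distr) simp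
  moreover have "char (density lborel (normal_density \<beta> c)) = char N"
  proof
    fix s
    have "char (density lborel (normal_density \<beta> c)) s
        = (CLINT x|std_normal_distribution. exp (\<i> * of_real (\<beta> * s)) * iexp ((s * c) * x))"
      unfolding D char_def by (subst integral_distr) (auto simp: cis_conv_exp algebra_simps simp flip: exp_add intro!: Bochner_Integration.integral_cong)
    also have "\<dots> = exp (\<i> * of_real (\<beta> * s)) * char std_normal_distribution (s * c)"
      by (simp add: char_def)
    also have "\<dots> = exp (\<i> * of_real (\<beta> * s)) * exp (of_real (- \<sigma> * s ^ 2))"
    proof -
      have "- (s * c)\<^sup>2 / 2 = - \<sigma> * s ^ 2" using c(2) by (simp add: power_mult_distrib)
      then show ?thesis by (simp only: char_std_normal_distribution exp_of_real)
    qed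
    finally show "char (density lborel (normal_density \<beta> c)) s = char N s"
      unfolding ch exp_add by (simp only: mult.commute)
  qed
  ultimately have "density lborel (normal_density \<beta> c) = N" using N by (intro Levy_uniqueness)
  then show ?thesis unfolding gaussian_def using c(1) by blast
qed

section \<open>Parameters of the pair F, G\<close>

context prob_space
begin

text \<open>A real weight makes the transform Hermitian on the real line, so \<open>c1\<close> is
  imaginary and \<open>c2\<close> real; \<open>\<bar>W\<bar> \<le> 1\<close> bounds it there by 1,
  so \<open>Re c2 \<le> 0\<close>. The factor \<open>exp c0\<close> is the value at 0. Both
  \<open>W = 1\<close> and the sign are instances.\<close>

lemma wlap_real_weight_quadratic:
  fixes W :: "'a \<Rightarrow> real"
  assumes X: "X \<in> borel_measurable M" and W: "W \<in> borel_measurable M" "\<And>\<omega>. \<bar>W \<omega>\<bar> \<le> 1"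
    and eq: "\<And>z. wlap M (\<lambda>\<omega>. of_real (W \<omega>)) X z = exp (c0 + c1 * z + c2 * z ^ 2)"
  shows "\<exists>\<sigma> \<beta>. \<sigma> \<ge> 0 \<and> expectation W \<noteq> 0 \<and> \<bar>expectation W\<bar> \<le> 1 \<and>
    (\<forall>z. wlap M (\<lambda>\<omega>. of_real (W \<omega>)) X z = of_real (expectation W) * exp (- of_real \<sigma> * z ^ 2 + \<i> * of_real \<beta> * z))"
proof -
  note [measurable] = X W(1)
  define \<kappa> where "\<kappa> = expectation W"
  let ?G = "wlap M (\<lambda>\<omega>. of_real (W \<omega>)) X"
  have int: "integrable M (\<lambda>\<omega>. of_real (W \<omega>) * exp (\<i> * of_real s * of_real (X \<omega>)))" for s
    by (rule wlap_integrable_real[where B = 1]) (use W in auto)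
  have G0: "exp c0 = of_real \<kappa>"
    using eq[of 0] by (simp add: wlap_def \<kappa>_def)
  have \<kappa>0: "\<kappa> \<noteq> 0" using G0 by (metis exp_not_eq_zero of_real_0)
  have nG: "norm (?G (of_real s)) \<le> 1" for s
  proof -
    have "norm (?G (of_real s)) \<le> (\<integral>\<omega>. norm (of_real (W \<omega>) * exp (\<i> * of_real s * of_real (X \<omega>))) \<partial>M)"
      unfolding wlap_def by (rule integral_norm_bound)
    also have "\<dots> \<le> (\<integral>\<omega>. 1 \<partial>M)"
      by (intro integral_mono integrable_norm int) (use W in \<open>auto simp: norm_mult\<close>)
    finally show ?thesis by (simp add: prob_space)
  qed
  have "cnj (?G (of_real s)) = ?G (of_real (- s))" for s
    unfolding wlap_def integral_bounded_linear[OF bounded_linear_cnj int, symmetric]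
    by (simp add: exp_cnj)
  then have cnj_eq: "cnj (exp (c0 + c1 * of_real s + c2 * of_real s ^ 2)) = exp (c0 - c1 * of_real s + c2 * of_real s ^ 2)" for s
    by (simp add: eq)
  have "exp ((cnj c1 + c1) * of_real s + (cnj c2 - c2) * of_real s ^ 2) = 1" for s
  proof -
    have "cnj (exp (c0 + c1 * of_real s + c2 * of_real s ^ 2))
        = cnj (exp c0) * exp (cnj c1 * of_real s + cnj c2 * of_real s ^ 2)"
      by (simp add: exp_add add.assoc exp_cnj)
    moreover have "exp (c0 - c1 * of_real s + c2 * of_real s ^ 2)
        = exp c0 * exp (- c1 * of_real s + c2 * of_real s ^ 2)"
      by (subst exp_add[symmetric]) (simp add: algebra_simps)
    ultimately have "of_real \<kappa> * exp (cnj c1 * of_real s + cnj c2 * of_real s ^ 2)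
        = of_real \<kappa> * exp (- c1 * of_real s + c2 * of_real s ^ 2)"
      using cnj_eq[of s] by (simp only: G0 complex_cnj_complex_of_real)
    then have "exp (cnj c1 * of_real s + cnj c2 * of_real s ^ 2) = exp (- c1 * of_real s + c2 * of_real s ^ 2)"
      using \<kappa>0 by simp
    moreover have "(cnj c1 + c1) * of_real s + (cnj c2 - c2) * of_real s ^ 2
        = (cnj c1 * of_real s + cnj c2 * of_real s ^ 2) - (- c1 * of_real s + c2 * of_real s ^ 2)"
      by (simp add: algebra_simps)
    ultimately show ?thesis by (simp only: exp_diff) simp
  qed
  from exp_quadratic_eq_1[OF this] have c12: "cnj c1 + c1 = 0" "cnj c2 - c2 = 0" by auto
  define \<beta> where "\<beta> = Im c1"
  define \<sigma> where "\<sigma> = - Re c2"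
  have c1: "c1 = \<i> * of_real \<beta>" using c12(1) by (simp add: \<beta>_def complex_eq_iff)
  have c2: "c2 = - of_real \<sigma>" using c12(2) by (simp add: \<sigma>_def complex_eq_iff)
  have form: "?G z = of_real \<kappa> * exp (- of_real \<sigma> * z ^ 2 + \<i> * of_real \<beta> * z)" for z
    unfolding eq G0[symmetric] c1 c2 by (simp flip: exp_add add: algebra_simps)
  have nf: "\<bar>\<kappa>\<bar> * exp (- \<sigma> * s ^ 2 + 0 * s) \<le> 1" for s
    using nG[of s] unfolding form by (simp add: norm_mult)
  have "- \<sigma> \<le> 0" by (rule exp_quadratic_le_imp(1)[OF _ nf]) (use \<kappa>0 in simp)
  moreover have "\<bar>\<kappa>\<bar> \<le> 1" using nf[of 0] by simp
  ultimately show ?thesis using form \<kappa>0 unfolding \<kappa>_def by (intro exI[of _ \<sigma>] exI[of _ \<beta>]) auto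
qed

text \<open>
  Testing against a Gaussian of width \<open>\<tau>\<close> replaces the comparison of densities, which need not exist.
\<close>

lemma expectation_gaussian_test:
  fixes W :: "'a \<Rightarrow> real"
  assumes X[measurable]: "X \<in> borel_measurable M" and W[measurable]: "W \<in> borel_measurable M"
    and W1: "\<And>\<omega>. \<bar>W \<omega>\<bar> \<le> 1" and \<tau>: "\<tau> > 0" and \<sigma>: "\<sigma> \<ge> 0"
    and eq: "\<And>s. wlap M (\<lambda>\<omega>. of_real (W \<omega>)) X (of_real s)
      = of_real \<kappa> * exp (- of_real \<sigma> * of_real s ^ 2 + \<i> * of_real \<beta> * of_real s)"
  shows "(\<integral>\<omega>. W \<omega> * (sqrt (pi / \<tau>) * exp (- (X \<omega> - m)\<^sup>2 / (4 * \<tau>))) \<partial>M)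
    = \<kappa> * (sqrt (pi / (\<tau> + \<sigma>)) * exp (- (\<beta> - m)\<^sup>2 / (4 * (\<tau> + \<sigma>))))"
proof -
  interpret P: pair_sigma_finite lborel M by standard
  \<comment> \<open>Parseval by Fubini: integrating over \<open>s\<close> first gives the Gaussian
    test function at \<open>X\<close>, integrating over \<open>M\<close> first gives the transform
    damped by \<open>exp (- \<tau> * s ^ 2)\<close>. The damping is what makes \<open>f\<close>
    integrable.\<close>
  define f where "f s \<omega> = of_real (W \<omega>) * (exp (of_real (- \<tau> * s ^ 2)) * exp (\<i> * of_real ((X \<omega> - m) * s)))"
    for s \<omega>
  have nf: "norm (f s \<omega>) = \<bar>W \<omega>\<bar> * exp (- \<tau> * s ^ 2)" for s \<omega>
    by (simp add: f_def norm_mult)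
  have intW: "integrable M (\<lambda>\<omega>. \<bar>W \<omega>\<bar>)"
    by (rule integrable_const_bound[where B = 1]) (use W1 in auto)
  have fs: "f s = (\<lambda>\<omega>. (exp (of_real (- \<tau> * s ^ 2)) * exp (- (\<i> * of_real (m * s)))) *
      (of_real (W \<omega>) * exp (\<i> * of_real s * of_real (X \<omega>))))" for s
    by (rule ext) (simp add: f_def algebra_simps exp_diff exp_minus divide_inverse)
  have fsi: "integrable M (f s)" for s
    unfolding fs by (intro integrable_mult_right wlap_integrable_real[where B = 1]) (use W1 in auto)
  have "integrable (lborel \<Otimes>\<^sub>M M) (case_prod f)"
  proof (rule P.Fubini_integrable)
    show "case_prod f \<in> borel_measurable (lborel \<Otimes>\<^sub>M M)" unfolding f_def by measurable
    show "integrable lborel (\<lambda>x. \<integral>y. norm (case (x, y) of (x, xa) \<Rightarrow> f x xa) \<partial>M)"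
      using gaussian_Fourier_integral(1)[OF \<tau>] by (simp add: nf)
  qed (use fsi in simp)
  from P.Fubini_integral[OF this]
  have "(CLINT \<omega>|M. CLINT s|lborel. f s \<omega>) = (CLINT s|lborel. CLINT \<omega>|M. f s \<omega>)" .
  moreover have "(CLINT s|lborel. f s \<omega>) = of_real (W \<omega> * (sqrt (pi / \<tau>) * exp (- (X \<omega> - m)\<^sup>2 / (4 * \<tau>))))" for \<omega>
    using gaussian_Fourier_integral(2)[OF \<tau>, of "X \<omega> - m"]
    by (simp only: f_def integral_mult_right_zero of_real_mult)
  moreover have "(CLINT \<omega>|M. f s \<omega>) = of_real \<kappa> * (exp (of_real (- (\<tau> + \<sigma>) * s ^ 2)) * exp (\<i> * of_real ((\<beta> - m) * s)))" for s
  proof -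
    have "(CLINT \<omega>|M. f s \<omega>) = (exp (of_real (- \<tau> * s ^ 2)) * exp (- (\<i> * of_real (m * s)))) * wlap M (\<lambda>\<omega>. of_real (W \<omega>)) X (of_real s)"
      unfolding fs wlap_def by (rule integral_mult_right_zero)
    also have "\<dots> = of_real \<kappa> * exp (of_real (- \<tau> * s ^ 2) - \<i> * of_real (m * s) + (- of_real \<sigma> * of_real s ^ 2 + \<i> * of_real \<beta> * of_real s))"
      unfolding eq by (simp add: exp_add exp_diff exp_minus divide_inverse)
    also have "of_real (- \<tau> * s ^ 2) - \<i> * of_real (m * s) + (- of_real \<sigma> * of_real s ^ 2 + \<i> * of_real \<beta> * of_real s)
        = of_real (- (\<tau> + \<sigma>) * s ^ 2) + \<i> * of_real ((\<beta> - m) * s)"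
      by (simp add: algebra_simps)
    finally show ?thesis by (simp only: exp_add)
  qed
  ultimately have "(CLINT \<omega>|M. of_real (W \<omega> * (sqrt (pi / \<tau>) * exp (- (X \<omega> - m)\<^sup>2 / (4 * \<tau>)))))
      = (CLINT s|lborel. of_real \<kappa> * (exp (of_real (- (\<tau> + \<sigma>) * s ^ 2)) * exp (\<i> * of_real ((\<beta> - m) * s))))"
    by simp
  also have "\<dots> = of_real (\<kappa> * (sqrt (pi / (\<tau> + \<sigma>)) * exp (- (\<beta> - m)\<^sup>2 / (4 * (\<tau> + \<sigma>)))))"
  proof -
    have "\<tau> + \<sigma> > 0" using \<tau> \<sigma> by simp
    from gaussian_Fourier_integral(2)[OF this, of "\<beta> - m"] show ?thesis
      by (simp only: integral_mult_right_zero of_real_mult)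
  qed
  finally show ?thesis unfolding integral_complex_of_real of_real_eq_iff .
qed

text \<open>On the imaginary axis the weighted transform is dominated by the unweighted one; this
  compares two real quadratics and yields \<open>\<sigma>' \<le> \<sigma>\<close>, with
  \<open>\<beta> = \<beta>'\<close> in the case of equality. For \<open>\<sigma>' < \<sigma>\<close>
  the Gaussian tests bound \<open>\<kappa>\<close> for each \<open>\<tau> > 0\<close>, and
  \<open>\<tau>\<close> tends to 0.\<close>

theorem gaussian_pair_parameters:
  fixes W :: "'a \<Rightarrow> real"
  assumes X[measurable]: "X \<in> borel_measurable M" and W[measurable]: "W \<in> borel_measurable M"
    and W1: "\<And>\<omega>. \<bar>W \<omega>\<bar> \<le> 1" and em: "\<And>y. integrable M (\<lambda>\<omega>. exp (y * X \<omega>))"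
    and \<sigma>: "\<sigma> \<ge> 0" and \<sigma>': "\<sigma>' \<ge> 0" and \<kappa>: "\<kappa> \<noteq> 0" "\<bar>\<kappa>\<bar> \<le> 1"
    and F: "\<And>z. wlap M (\<lambda>_. 1) X z = exp (- of_real \<sigma> * z ^ 2 + \<i> * of_real \<beta> * z)"
    and G: "\<And>z. wlap M (\<lambda>\<omega>. of_real (W \<omega>)) X z = of_real \<kappa> * exp (- of_real \<sigma>' * z ^ 2 + \<i> * of_real \<beta>' * z)"
  shows "0 < \<sigma>' \<and> \<sigma>' < \<sigma> \<and> 0 < \<bar>\<kappa>\<bar> \<and>
      \<bar>\<kappa>\<bar> \<le> sqrt (\<sigma>' / \<sigma>) * exp (- (\<beta> - \<beta>')\<^sup>2 / (4 * (\<sigma> - \<sigma>')))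
    \<or> \<sigma> = \<sigma>' \<and> \<beta> = \<beta>' \<and> \<bar>\<kappa>\<bar> \<le> 1"
proof -
  have "\<bar>\<kappa>\<bar> * exp ((\<sigma>' - \<sigma>) * y ^ 2 + (\<beta> - \<beta>') * y) \<le> 1" for y
  proof -
    have "norm (wlap M (\<lambda>\<omega>. of_real (W \<omega>)) X (\<i> * of_real y)) \<le> (\<integral>\<omega>. exp (- Im (\<i> * of_real y) * X \<omega>) \<partial>M)"
      by (rule norm_wlap_le[OF X _ _ em]) (use W1 in auto)
    also have "\<dots> \<le> norm (wlap M (\<lambda>_. 1) X (\<i> * of_real y))"
      unfolding wlap_imaginary by simp
    finally have "\<bar>\<kappa>\<bar> * exp (\<sigma>' * y ^ 2 - \<beta>' * y) \<le> exp (\<sigma> * y ^ 2 - \<beta> * y)"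
      unfolding F G by (simp add: norm_mult power_mult_distrib)
    then have "\<bar>\<kappa>\<bar> * (exp (\<sigma>' * y ^ 2 - \<beta>' * y) / exp (\<sigma> * y ^ 2 - \<beta> * y)) \<le> 1"
      by (simp add: divide_le_eq)
    then show ?thesis by (simp add: algebra_simps flip: exp_diff)
  qed
  from exp_quadratic_le_imp[OF _ this] \<kappa>(1)
  have le: "\<sigma>' \<le> \<sigma>" and eq: "\<sigma>' = \<sigma> \<Longrightarrow> \<beta> = \<beta>'" by auto
  show ?thesis
  proof (cases "\<sigma>' = \<sigma>")
    case True
    then show ?thesis using eq \<kappa> by simp
  next
    case False
    with le have lt: "\<sigma>' < \<sigma>" by simp
    define D where "D = - (\<beta> - \<beta>')\<^sup>2 / (4 * (\<sigma> - \<sigma>'))"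
    have bound: "\<bar>\<kappa>\<bar> \<le> sqrt ((\<tau> + \<sigma>') / (\<tau> + \<sigma>)) * exp D" if \<tau>: "\<tau> > 0" for \<tau>
    proof -
      define p where "p = \<tau> + \<sigma>"
      define q where "q = \<tau> + \<sigma>'"
      have pq: "p > 0" "q > 0" "p - q = \<sigma> - \<sigma>'" "p - q > 0" using \<tau> \<sigma> \<sigma>' lt by (auto simp: p_def q_def)
      text \<open>The centre \<open>m\<close> of the test function at which the inequality is sharpest.\<close>
      define m where "m = (p * \<beta>' - q * \<beta>) / (p - q)"
      define \<phi> where "\<phi> x = sqrt (pi / \<tau>) * exp (- (x - m)\<^sup>2 / (4 * \<tau>))" for x
      have \<phi>0: "\<phi> x \<ge> 0" for x using \<tau> by (simp add: \<phi>_def)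
      have \<phi>B: "\<phi> x \<le> sqrt (pi / \<tau>)" for x using \<tau> by (simp add: \<phi>_def mult_le_cancel_left1)
      have [measurable]: "\<phi> \<in> borel_measurable borel" unfolding \<phi>_def by measurable
      have int1: "integrable M (\<lambda>\<omega>. \<phi> (X \<omega>))"
        by (rule integrable_const_bound[where B = "sqrt (pi / \<tau>)"]) (use \<phi>0 \<phi>B in auto)
      have int2: "integrable M (\<lambda>\<omega>. W \<omega> * \<phi> (X \<omega>))"
        by (rule Bochner_Integration.integrable_bound[OF int1])
           (use W1 \<phi>0 in \<open>auto simp: abs_mult mult_left_le_one_le\<close>)
      have F': "wlap M (\<lambda>\<omega>. of_real 1) X (of_real s) = of_real 1 * exp (- of_real \<sigma> * of_real s ^ 2 + \<i> * of_real \<beta> * of_real s)" for s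
        using F[of "of_real s"] by simp
      have E1: "(\<integral>\<omega>. \<phi> (X \<omega>) \<partial>M) = sqrt (pi / p) * exp (- (\<beta> - m)\<^sup>2 / (4 * p))"
        using expectation_gaussian_test[OF X _ _ \<tau> \<sigma> F', of m] by (simp add: \<phi>_def p_def)
      have E2: "(\<integral>\<omega>. W \<omega> * \<phi> (X \<omega>) \<partial>M) = \<kappa> * (sqrt (pi / q) * exp (- (\<beta>' - m)\<^sup>2 / (4 * q)))"
        using expectation_gaussian_test[OF X W W1 \<tau> \<sigma>' G, of m] by (simp add: \<phi>_def q_def)
      have "\<bar>\<integral>\<omega>. W \<omega> * \<phi> (X \<omega>) \<partial>M\<bar> \<le> (\<integral>\<omega>. \<bar>W \<omega> * \<phi> (X \<omega>)\<bar> \<partial>M)" by (rule integral_abs_bound)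
      also have "\<dots> \<le> (\<integral>\<omega>. \<phi> (X \<omega>) \<partial>M)"
        by (intro integral_mono integrable_abs int1 int2)
           (use W1 \<phi>0 in \<open>auto simp: abs_mult mult_left_le_one_le\<close>)
      finally have "\<bar>\<kappa>\<bar> * (sqrt (pi / q) * exp (- (\<beta>' - m)\<^sup>2 / (4 * q))) \<le> sqrt (pi / p) * exp (- (\<beta> - m)\<^sup>2 / (4 * p))"
        unfolding E1 E2 abs_mult using pq by simp
      then have "\<bar>\<kappa>\<bar> \<le> (sqrt (pi / p) / sqrt (pi / q)) * (exp (- (\<beta> - m)\<^sup>2 / (4 * p)) / exp (- (\<beta>' - m)\<^sup>2 / (4 * q)))"
        using pq by (simp add: field_simps)
      also have "sqrt (pi / p) / sqrt (pi / q) = sqrt (q / p)"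
        unfolding real_sqrt_divide[symmetric] using pq by simp
      also have "exp (- (\<beta> - m)\<^sup>2 / (4 * p)) / exp (- (\<beta>' - m)\<^sup>2 / (4 * q)) = exp D"
      proof -
        \<comment> \<open>At this centre both distances are multiples of one \<open>k\<close>, by
          \<open>p\<close> and by \<open>q\<close>, so the exponents combine to \<open>D\<close>,
          which does not depend on \<open>\<tau>\<close> because
          \<open>p - q = \<sigma> - \<sigma>'\<close>.\<close>
        define k where "k = (\<beta> - \<beta>') / (p - q)"
        have m: "\<beta> - m = p * k" "\<beta>' - m = q * k"
          unfolding m_def k_def using pq(4) by (simp_all add: field_simps)
        have "- (\<beta> - m)\<^sup>2 / (4 * p) - (- (\<beta>' - m)\<^sup>2 / (4 * q)) = - ((p - q) * k\<^sup>2 / 4)"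
          unfolding m using pq(1,2) by (simp add: power2_eq_square field_simps)
        also have "\<dots> = D"
          unfolding D_def k_def pq(3)[symmetric] using pq(4) by (simp add: power_divide power2_eq_square)
        finally show ?thesis by (simp flip: exp_diff)
      qed
      finally show ?thesis by (simp add: p_def q_def)
    qed
    have "((\<lambda>\<tau>. sqrt ((\<tau> + \<sigma>') / (\<tau> + \<sigma>)) * exp D) \<longlongrightarrow> sqrt ((0 + \<sigma>') / (0 + \<sigma>)) * exp D) (at_right 0)"
      using lt \<sigma>' by (intro tendsto_intros) auto
    then have "((\<lambda>\<tau>. sqrt ((\<tau> + \<sigma>') / (\<tau> + \<sigma>)) * exp D) \<longlongrightarrow> sqrt (\<sigma>' / \<sigma>) * exp D) (at_right 0)"
      by (simp only: add_0)
    then have K: "\<bar>\<kappa>\<bar> \<le> sqrt (\<sigma>' / \<sigma>) * exp D"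
      by (rule tendsto_lowerbound) (auto simp: eventually_at_filter bound)
    \<comment> \<open>Positivity of \<open>\<sigma>'\<close> is a consequence: for
      \<open>\<sigma>' = 0\<close> the bound would force \<open>\<kappa> = 0\<close>.\<close>
    then have "\<sigma>' \<noteq> 0" using \<kappa>(1) by auto
    then show ?thesis using K \<sigma>' lt \<kappa> by (simp add: D_def)
  qed
qed

end


section \<open>Distributions on the product group\<close>

instance bit :: topological_comm_monoid_add
  by standard
    (simp add: nhds_discrete principal_prod_principal filterlim_principal eventually_principal)

text \<open>The nontrivial character of Z(2), real-valued so that the results on real weights
  apply.\<close>

definition bit_sign :: "bit \<Rightarrow> real" where
  "bit_sign k = (if k = 1 then - 1 else 1)"

lemma bit_sign_simps [simp]: "bit_sign 0 = 1" "bit_sign 1 = - 1" "\<bar>bit_sign k\<bar> = 1"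
  by (simp_all add: bit_sign_def)

lemma bit_sign_add: "bit_sign (k + l) = bit_sign k * bit_sign l"
  by (cases k; cases l) simp_all

lemma borel_measurable_bit:
  fixes f :: "bit \<Rightarrow> 'a::topological_space"
  shows "f \<in> borel_measurable borel"
  by (intro borel_measurable_continuous_onI) simp

lemma measurable_fst_real_z2: "(fst :: real_z2 \<Rightarrow> real) \<in> borel_measurable borel"
  by (intro borel_measurable_continuous_onI continuous_intros)

lemma measurable_bit_snd:
  fixes f :: "bit \<Rightarrow> 'a::topological_space"
  shows "(\<lambda>x :: real_z2. f (snd x)) \<in> borel_measurable borel"
proof (rule measurable_compose[OF _ borel_measurable_bit])
  show "(snd :: real_z2 \<Rightarrow> bit) \<in> borel_measurable borel"
    by (intro borel_measurable_continuous_onI continuous_intros)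
qed

lemma borel_measurable_sets_eq:
  assumes "sets \<mu> = sets borel" "f \<in> borel_measurable borel"
  shows "f \<in> borel_measurable \<mu>"
  using assms(2) measurable_cong_sets[OF assms(1) refl] by blast

lemma char_fun_wlap:
  "char_fun \<mu> (s, 0) = wlap \<mu> (\<lambda>_. 1) fst (of_real s)"
  "char_fun \<mu> (s, 1) = wlap \<mu> (\<lambda>x. of_real (bit_sign (snd x))) fst (of_real s)"
  unfolding char_fun_def wlap_def pairing_def
  by (auto intro!: Bochner_Integration.integral_cong simp: bit_sign_def case_prod_beta mult_ac)

lemma prob_distributionD:
  assumes "prob_distribution \<mu>"
  shows "prob_space \<mu>" "sets \<mu> = sets borel" "space \<mu> = UNIV"
  using assms sets_eq_imp_space_eq[of \<mu> borel] by (auto simp: prob_distribution_def)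

lemma real_distribution_fst:
  fixes \<mu> :: "real_z2 measure"
  assumes "prob_distribution \<mu>"
  shows "real_distribution (distr \<mu> borel fst)"
proof -
  interpret prob_space \<mu> using prob_distributionD[OF assms] by simp
  show ?thesis
    by (rule real_distribution_distr)
      (rule borel_measurable_sets_eq[OF prob_distributionD(2)[OF assms] measurable_fst_real_z2])
qed

lemma (in prob_space) wlap_quadratic:
  assumes "X \<in> borel_measurable M" and F: "\<And>z. wlap M (\<lambda>_. 1) X z = exp (c0 + c1 * z + c2 * z ^ 2)"
  obtains \<sigma> \<beta> where "\<sigma> \<ge> 0" "\<And>z. wlap M (\<lambda>_. 1) X z = exp (- of_real \<sigma> * z ^ 2 + \<i> * of_real \<beta> * z)"
proof -
  have "\<exists>\<sigma> \<beta>. \<sigma> \<ge> 0 \<and> expectation (\<lambda>_. 1 :: real) \<noteq> 0 \<and> \<bar>expectation (\<lambda>_. 1 :: real)\<bar> \<le> 1 \<and>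
      (\<forall>z. wlap M (\<lambda>_. of_real 1) X z
        = of_real (expectation (\<lambda>_. 1 :: real)) * exp (- of_real \<sigma> * z ^ 2 + \<i> * of_real \<beta> * z))"
    by (rule wlap_real_weight_quadratic[OF assms(1)]) (simp_all only: F of_real_1, simp_all)
  moreover have "expectation (\<lambda>_. 1 :: real) = 1" by (simp add: prob_space)
  ultimately show ?thesis using that by (metis mult_1 of_real_1)
qed

section \<open>Membership in \<Lambda> and \<Theta>\<close>

lemma class_LambdaI:
  fixes \<mu> :: "real_z2 measure"
  assumes \<mu>: "prob_distribution \<mu>"
    and F: "\<And>z. wlap \<mu> (\<lambda>_. 1) fst z = exp (c0 + c1 * z + c2 * z ^ 2)"
  shows "\<mu> \<in> class_Lambda"
proof -
  interpret prob_space \<mu> using prob_distributionD[OF \<mu>] by simp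
  have X: "fst \<in> borel_measurable \<mu>"
    by (rule borel_measurable_sets_eq[OF prob_distributionD(2)[OF \<mu>] measurable_fst_real_z2])
  obtain \<sigma> \<beta> where *: "\<sigma> \<ge> 0"
      "\<And>z. wlap \<mu> (\<lambda>_. 1) fst z = exp (- of_real \<sigma> * z ^ 2 + \<i> * of_real \<beta> * z)"
    by (rule wlap_quadratic[OF X F]) (rule that)
  have "char (distr \<mu> borel fst) s = exp (of_real (- \<sigma> * s ^ 2) + \<i> * of_real (\<beta> * s))" for s
    using *(2)[of "of_real s"] by (simp add: wlap_eq_char[OF X] mult.assoc)
  then have "gaussian (distr \<mu> borel fst)"
    by (rule gaussian_of_char[OF real_distribution_fst[OF \<mu>] *(1)])
  then show ?thesis using \<mu> by (simp add: class_Lambda_def)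
qed

lemma class_ThetaI:
  fixes \<mu> :: "real_z2 measure"
  assumes \<mu>: "prob_distribution \<mu>" and em: "\<And>y. integrable \<mu> (\<lambda>x. exp (y * fst x))"
    and F: "\<And>z. wlap \<mu> (\<lambda>_. 1) fst z = exp (c0 + c1 * z + c2 * z ^ 2)"
    and G: "\<And>z. wlap \<mu> (\<lambda>x. of_real (bit_sign (snd x))) fst z = exp (d0 + d1 * z + d2 * z ^ 2)"
  shows "\<mu> \<in> class_Theta" "char_fun \<mu> y \<noteq> 0"
proof -
  interpret prob_space \<mu> using prob_distributionD[OF \<mu>] by simp
  have X: "fst \<in> borel_measurable \<mu>"
    by (rule borel_measurable_sets_eq[OF prob_distributionD(2)[OF \<mu>] measurable_fst_real_z2])
  have W: "(\<lambda>x. bit_sign (snd x)) \<in> borel_measurable \<mu>"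
    by (rule borel_measurable_sets_eq[OF prob_distributionD(2)[OF \<mu>] measurable_bit_snd])
  obtain \<sigma> \<beta> where 1: "\<sigma> \<ge> 0"
      "\<And>z. wlap \<mu> (\<lambda>_. 1) fst z = exp (- of_real \<sigma> * z ^ 2 + \<i> * of_real \<beta> * z)"
    by (rule wlap_quadratic[OF X F]) (rule that)
  have W1: "\<bar>bit_sign (snd x)\<bar> \<le> 1" for x :: real_z2 by simp
  define \<kappa> where "\<kappa> = expectation (\<lambda>x. bit_sign (snd x))"
  obtain \<sigma>' \<beta>' where 2: "\<sigma>' \<ge> 0" "\<kappa> \<noteq> 0" "\<bar>\<kappa>\<bar> \<le> 1"
      "\<And>z. wlap \<mu> (\<lambda>x. of_real (bit_sign (snd x))) fst z = of_real \<kappa> * exp (- of_real \<sigma>' * z ^ 2 + \<i> * of_real \<beta>' * z)"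
    using wlap_real_weight_quadratic[OF X W W1 G] unfolding \<kappa>_def[symmetric] by (elim exE conjE) blast
  have params: "0 < \<sigma>' \<and> \<sigma>' < \<sigma> \<and> 0 < \<bar>\<kappa>\<bar> \<and>
      \<bar>\<kappa>\<bar> \<le> sqrt (\<sigma>' / \<sigma>) * exp (- (\<beta> - \<beta>')\<^sup>2 / (4 * (\<sigma> - \<sigma>')))
    \<or> \<sigma> = \<sigma>' \<and> \<beta> = \<beta>' \<and> \<bar>\<kappa>\<bar> \<le> 1"
    by (rule gaussian_pair_parameters[OF X W _ em 1(1) 2(1,2,3) 1(2) 2(4)]) simp
  have cf: "char_fun \<mu> (s, 0) = exp (- of_real \<sigma> * (of_real s)\<^sup>2 + \<i> * of_real \<beta> * of_real s)"
    "char_fun \<mu> (s, 1) = of_real \<kappa> * exp (- of_real \<sigma>' * (of_real s)\<^sup>2 + \<i> * of_real \<beta>' * of_real s)"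
    for s :: real
    unfolding char_fun_wlap 1(2) 2(4) by (rule refl)+
  show "\<mu> \<in> class_Theta"
    unfolding class_Theta_def mem_Collect_eq
    by (intro conjI[OF \<mu>], rule exI[of _ \<sigma>], rule exI[of _ \<sigma>'], rule exI[of _ \<beta>],
        rule exI[of _ \<beta>'], rule exI[of _ \<kappa>], intro conjI allI cf 1(1) 2(1) params)
  obtain s l where "y = (s, l)" by (cases y)
  then show "char_fun \<mu> y \<noteq> 0"
    by (cases l) (simp_all add: char_fun_wlap F G)
qed

section \<open>Convolution with the Haar measure of Z(2)\<close>

lemma emeasure_real_z2_split:
  fixes \<mu> :: "real_z2 measure"
  assumes \<mu>: "sets \<mu> = sets borel" and A: "A \<in> sets borel"
  shows "emeasure \<mu> A = emeasure \<mu> ({t. (t, 0) \<in> A} \<times> {0}) + emeasure \<mu> ({t. (t, 1) \<in> A} \<times> {1})"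
    and "{t. (t, k) \<in> A} \<in> sets borel"
proof -
  show B: "{t. (t, k) \<in> A} \<in> sets borel" for k
  proof -
    have "(\<lambda>t. (t, k)) \<in> measurable borel borel"
      by (intro borel_measurable_continuous_onI continuous_intros)
    from measurable_sets[OF this A] show ?thesis by (simp add: vimage_def)
  qed
  have S: "{t. (t, k) \<in> A} \<times> {k} \<in> sets \<mu>" for k
  proof -
    have "{t. (t, k) \<in> A} \<times> {k} \<in> sets (borel \<Otimes>\<^sub>M borel)" using B by (intro pair_measureI) auto
    then show ?thesis unfolding \<mu> borel_prod .
  qed
  have "A = {t. (t, 0) \<in> A} \<times> {0} \<union> {t. (t, 1) \<in> A} \<times> {1}"
  proof (intro set_eqI)
    fix x show "x \<in> A \<longleftrightarrow> x \<in> {t. (t, 0) \<in> A} \<times> {0} \<union> {t. (t, 1) \<in> A} \<times> {1}"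
      by (cases x; cases "snd x") auto
  qed
  then have "emeasure \<mu> A = emeasure \<mu> ({t. (t, 0) \<in> A} \<times> {0} \<union> {t. (t, 1) \<in> A} \<times> {1})" by metis
  also have "\<dots> = emeasure \<mu> ({t. (t, 0) \<in> A} \<times> {0}) + emeasure \<mu> ({t. (t, 1) \<in> A} \<times> {1})"
    by (intro plus_emeasure[symmetric] S) auto
  finally show "emeasure \<mu> A = emeasure \<mu> ({t. (t, 0) \<in> A} \<times> {0}) + emeasure \<mu> ({t. (t, 1) \<in> A} \<times> {1})" .
qed

text \<open>Fubini: adding an independent uniform bit to \<open>(t, 0)\<close> gives
  \<open>(t, 0)\<close> and \<open>(t, 1)\<close> with probability 1/2 each.\<close>

lemma emeasure_convolution_haar_Z2:
  fixes \<nu> :: "real measure"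
  assumes \<nu>: "real_distribution \<nu>" and A: "A \<in> sets borel"
  shows "emeasure (group_convolution (distr \<nu> borel (\<lambda>t. (t, 0))) haar_Z2) A
    = (emeasure \<nu> {t. (t, 0) \<in> A} + emeasure \<nu> {t. (t, 1) \<in> A}) / 2"
proof -
  interpret \<nu>: real_distribution \<nu> by (rule \<nu>)
  have emb: "(\<lambda>t::real. (t, 0::bit)) \<in> measurable \<nu> borel"
    unfolding measurable_cong_sets[OF \<nu>.events_eq_borel refl]
    by (intro borel_measurable_continuous_onI continuous_intros)
  have U: "(\<lambda>k::bit. (0::real, k)) \<in> measurable (uniform_count_measure UNIV) borel"
    by (simp add: measurable_def space_uniform_count_measure sets_uniform_count_measure)
  interpret U: prob_space "uniform_count_measure (UNIV :: bit set)"
    by (rule prob_space_uniform_count_measure) auto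
  interpret H: prob_space haar_Z2 unfolding haar_Z2_def by (rule U.prob_space_distr[OF U])
  let ?\<gamma> = "distr \<nu> borel (\<lambda>t. (t, 0::bit))"
  have plus: "(\<lambda>(x, y). x + y) \<in> measurable (?\<gamma> \<Otimes>\<^sub>M haar_Z2) (borel :: real_z2 measure)"
  proof -
    have s: "sets (?\<gamma> \<Otimes>\<^sub>M haar_Z2) = sets (borel :: (real_z2 \<times> real_z2) measure)"
      by (simp add: haar_Z2_def borel_prod[symmetric] cong: sets_pair_measure_cong)
    have "continuous_on UNIV (\<lambda>(x, y). x + y :: real_z2)"
      unfolding case_prod_beta plus_prod_def
      by (intro continuous_intros)
    then show ?thesis
      unfolding measurable_cong_sets[OF s refl] by (rule borel_measurable_continuous_onI)
  qed
  have k: "emeasure haar_Z2 {y. (t, 0) + y \<in> A} = (indicator {t. (t, 0) \<in> A} t + indicator {t. (t, 1) \<in> A} t) / 2" for t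
  proof -
    have "emeasure haar_Z2 {y. (t, 0) + y \<in> A} = emeasure (uniform_count_measure (UNIV :: bit set)) {k. (t, k) \<in> A}"
    proof -
      have "continuous_on UNIV (\<lambda>y::real_z2. (t, 0) + y)"
        unfolding plus_prod_def by (intro continuous_intros)
      then have "(\<lambda>y::real_z2. (t, 0) + y) \<in> measurable borel borel" by (rule borel_measurable_continuous_onI)
      from measurable_sets[OF this A] have "{y. (t, 0) + y \<in> A} \<in> sets borel" by (simp add: vimage_def)
      from emeasure_distr[OF U this] have "emeasure haar_Z2 {y. (t, 0) + y \<in> A}
          = emeasure (uniform_count_measure UNIV) ((\<lambda>k::bit. (0, k)) -` {y. (t, 0) + y \<in> A})"
        by (simp only: haar_Z2_def space_uniform_count_measure Int_UNIV_right)
      moreover have "(\<lambda>k::bit. (0, k)) -` {y. (t, 0) + y \<in> A} = {k. (t, k) \<in> A}"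
      proof (intro set_eqI)
        fix k :: bit have "(t, 0) + (0, k) = (t, k)" by simp
        then show "k \<in> (\<lambda>k::bit. (0, k)) -` {y. (t, 0) + y \<in> A} \<longleftrightarrow> k \<in> {k. (t, k) \<in> A}"
          by (simp only: vimage_eq mem_Collect_eq)
      qed
      ultimately show ?thesis by simp
    qed
    also have "\<dots> = ennreal (card {k::bit. (t, k) \<in> A} / 2)"
    proof -
      have "(UNIV :: bit set) = {0, 1}" by (auto intro: bit_not_zero_iff[THEN iffD1])
      moreover have "card {0, 1 :: bit} = 2" by simp
      ultimately have "card (UNIV :: bit set) = 2" by metis
      then show ?thesis by (subst emeasure_uniform_count_measure) simp_all
    qed
    also have "{k::bit. (t, k) \<in> A} = (if (t, 0) \<in> A then {0} else {}) \<union> (if (t, 1) \<in> A then {1} else {})"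
    proof (intro set_eqI)
      fix k show "k \<in> {k::bit. (t, k) \<in> A} \<longleftrightarrow> k \<in> (if (t, 0) \<in> A then {0} else {}) \<union> (if (t, 1) \<in> A then {1} else {})"
        by (cases k) auto
    qed
    finally show ?thesis
      by (auto simp: indicator_def ennreal_divide_numeral) (simp_all add: divide_ennreal_def)
  qed
  have "emeasure (group_convolution ?\<gamma> haar_Z2) A
      = emeasure (?\<gamma> \<Otimes>\<^sub>M haar_Z2) ((\<lambda>(x, y). x + y) -` A \<inter> space (?\<gamma> \<Otimes>\<^sub>M haar_Z2))"
    unfolding group_convolution_def by (rule emeasure_distr[OF plus A])
  also have "\<dots> = (\<integral>\<^sup>+x. emeasure haar_Z2 (Pair x -` ((\<lambda>(x, y). x + y) -` A \<inter> space (?\<gamma> \<Otimes>\<^sub>M haar_Z2))) \<partial>?\<gamma>)"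
    by (rule H.emeasure_pair_measure_alt) (rule measurable_sets[OF plus A])
  also have "\<dots> = (\<integral>\<^sup>+x. emeasure haar_Z2 {y. x + y \<in> A} \<partial>?\<gamma>)"
    by (intro nn_integral_cong arg_cong[where f = "emeasure haar_Z2"]) (auto simp: space_pair_measure haar_Z2_def)
  also have "\<dots> = (\<integral>\<^sup>+t. emeasure haar_Z2 {y. (t, 0) + y \<in> A} \<partial>\<nu>)"
  proof (rule nn_integral_distr[OF emb])
    have "(\<lambda>x. emeasure haar_Z2 (Pair x -` ((\<lambda>(x, y). x + y) -` A \<inter> space (?\<gamma> \<Otimes>\<^sub>M haar_Z2)))) \<in> borel_measurable ?\<gamma>"
      by (rule H.measurable_emeasure_Pair) (rule measurable_sets[OF plus A])
    also have "(\<lambda>x. emeasure haar_Z2 (Pair x -` ((\<lambda>(x, y). x + y) -` A \<inter> space (?\<gamma> \<Otimes>\<^sub>M haar_Z2))))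
        = (\<lambda>x. emeasure haar_Z2 {y. x + y \<in> A})"
      by (intro ext arg_cong[where f = "emeasure haar_Z2"]) (auto simp: space_pair_measure haar_Z2_def)
    finally show "(\<lambda>x. emeasure haar_Z2 {y. x + y \<in> A}) \<in> borel_measurable ?\<gamma>" .
  qed
  also have "\<dots> = (\<integral>\<^sup>+t. (indicator {t. (t, 0) \<in> A} t + indicator {t. (t, 1) \<in> A} t) / 2 \<partial>\<nu>)"
    unfolding k ..
  also have "\<dots> = (emeasure \<nu> {t. (t, 0) \<in> A} + emeasure \<nu> {t. (t, 1) \<in> A}) / 2"
    using emeasure_real_z2_split(2)[of borel A] A
    by (simp add: nn_integral_divide nn_integral_add)
  finally show ?thesis .
qed

text \<open>The hypothesis says that the signed measure with density (-1)^k has zero real marginal.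
  Levy's uniqueness theorem concerns probability measures, so the density is shifted to
  \<open>w\<close>, with values 0 and 2. The weighted marginal \<open>N\<close> then has the
  characteristic function of the marginal of \<open>\<mu>\<close>, so half of the mass above each
  \<open>B\<close> lies on \<open>B \<times> {0}\<close>.\<close>

theorem eq_convolution_haar_Z2:
  fixes \<mu> :: "real_z2 measure"
  assumes \<mu>: "prob_distribution \<mu>"
    and zero: "\<And>s. wlap \<mu> (\<lambda>x. of_real (bit_sign (snd x))) fst (of_real s) = 0"
  shows "\<mu> = group_convolution (distr (distr \<mu> borel fst) borel (\<lambda>t. (t, 0))) haar_Z2"
proof -
  interpret prob_space \<mu> using prob_distributionD[OF \<mu>] by simp
  have X[measurable]: "fst \<in> borel_measurable \<mu>"
    by (rule borel_measurable_sets_eq[OF prob_distributionD(2)[OF \<mu>] measurable_fst_real_z2])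
  have W[measurable]: "(\<lambda>x. bit_sign (snd x)) \<in> borel_measurable \<mu>"
    by (rule borel_measurable_sets_eq[OF prob_distributionD(2)[OF \<mu>] measurable_bit_snd])
  have intW: "integrable \<mu> (\<lambda>x. bit_sign (snd x))"
    by (rule integrable_const_bound[where B = 1]) auto
  define w where "w x = 1 + bit_sign (snd x)" for x :: real_z2
  have w: "w x = (if snd x = 0 then 2 else 0)" for x by (cases "snd x") (auto simp: w_def)
  have [measurable]: "w \<in> borel_measurable \<mu>" unfolding w_def by measurable
  have w0: "w x \<ge> 0" for x by (simp add: w)
  define N where "N = distr (density \<mu> (\<lambda>x. ennreal (w x))) borel fst"
  \<comment> \<open>At \<open>s = 0\<close> the hypothesis balances the two bits, which gives the
    weighted measure total mass 1.\<close>
  have expW: "expectation (\<lambda>x. bit_sign (snd x)) = 0"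
    using zero[of 0] by (simp add: wlap_def)
  have intw: "integrable \<mu> w"
    unfolding w_def by (intro Bochner_Integration.integrable_add integrable_const intW)
  have "expectation w = 1"
    unfolding w_def using expW intW by (simp add: prob_space)
  then have "(\<integral>\<^sup>+x. ennreal (w x) \<partial>\<mu>) = 1"
    using nn_integral_eq_integral[OF intw] w0 by simp
  then have "emeasure (density \<mu> (\<lambda>x. ennreal (w x))) (space \<mu>) = 1"
    by (subst emeasure_density) (simp_all cong: nn_integral_cong)
  then interpret D: prob_space "density \<mu> (\<lambda>x. ennreal (w x))"
    by (intro prob_spaceI) simp
  have rdN: "real_distribution N"
    unfolding N_def by (rule D.real_distribution_distr) simp
  have "char N s = char (distr \<mu> borel fst) s" for s
  proof -
    have "char N s = (CLINT x|\<mu>. w x *\<^sub>R iexp (s * fst x))"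
      unfolding N_def char_def by (subst integral_distr) (auto simp: integral_density w0)
    also have "\<dots> = (CLINT x|\<mu>. iexp (s * fst x) + of_real (bit_sign (snd x)) * exp (\<i> * of_real s * of_real (fst x)))"
      by (intro Bochner_Integration.integral_cong refl) (simp add: w_def algebra_simps scaleR_conv_of_real)
    also have "\<dots> = (CLINT x|\<mu>. iexp (s * fst x)) + wlap \<mu> (\<lambda>x. of_real (bit_sign (snd x))) fst (of_real s)"
      unfolding wlap_def
      by (intro Bochner_Integration.integral_add wlap_integrable_real[where B = 1] integrable_const_bound[where B = 1]) auto
    also have "\<dots> = char (distr \<mu> borel fst) s"
      unfolding zero char_def by (subst integral_distr) auto
    finally show ?thesis .
  qed
  then have N: "N = distr \<mu> borel fst"
    by (intro Levy_uniqueness rdN real_distribution_fst \<mu>) auto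
  have half: "emeasure \<mu> (B \<times> {k}) = emeasure (distr \<mu> borel fst) B / 2" if B[measurable]: "B \<in> sets borel" for B k
  proof -
    have S: "B \<times> {k} \<in> sets \<mu>" for k
    proof -
      have "B \<times> {k} \<in> sets (borel \<Otimes>\<^sub>M borel)" using B by (intro pair_measureI) auto
      then show ?thesis unfolding prob_distributionD(2)[OF \<mu>] borel_prod .
    qed
    have sp: "space \<mu> = UNIV" by (rule prob_distributionD[OF \<mu>])
    have fB: "emeasure (distr \<mu> borel fst) B = emeasure \<mu> (fst -` B)"
      by (subst emeasure_distr) (auto simp: sp)
    have "emeasure N B = emeasure (density \<mu> (\<lambda>x. ennreal (w x))) (fst -` B)"
      unfolding N_def by (subst emeasure_distr) (auto simp: sp)
    also have "\<dots> = (\<integral>\<^sup>+x. ennreal (w x) * indicator (fst -` B) x \<partial>\<mu>)"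
      using measurable_sets[OF X B] by (subst emeasure_density) (auto simp: sp)
    also have "\<dots> = (\<integral>\<^sup>+x. 2 * indicator (B \<times> {0}) x \<partial>\<mu>)"
      by (intro nn_integral_cong) (auto simp: w indicator_def)
    also have "\<dots> = 2 * emeasure \<mu> (B \<times> {0})" using S by (subst nn_integral_cmult_indicator) auto
    finally have e0: "emeasure \<mu> (fst -` B) = 2 * emeasure \<mu> (B \<times> {0})" unfolding N fB .
    have "fst -` B = B \<times> {0 :: bit} \<union> B \<times> {1}"
    proof (intro set_eqI)
      fix x :: real_z2 show "x \<in> fst -` B \<longleftrightarrow> x \<in> B \<times> {0} \<union> B \<times> {1}" by (cases x; cases "snd x") auto
    qed
    moreover have "B \<times> {0 :: bit} \<inter> B \<times> {1} = {}" by auto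
    ultimately have e1: "emeasure \<mu> (fst -` B) = emeasure \<mu> (B \<times> {0}) + emeasure \<mu> (B \<times> {1})"
      using plus_emeasure[OF S[of 0] S[of 1]] by metis
    have r: "measure \<mu> (fst -` B) = 2 * measure \<mu> (B \<times> {0})" "measure \<mu> (fst -` B) = measure \<mu> (B \<times> {0}) + measure \<mu> (B \<times> {1})"
      using e0 e1 unfolding emeasure_eq_measure
      by (simp_all flip: ennreal_numeral ennreal_mult ennreal_plus)
    have "measure \<mu> (B \<times> {k}) = measure \<mu> (fst -` B) / 2" using r by (cases k) auto
    then show ?thesis unfolding fB emeasure_eq_measure by (simp add: ennreal_divide_numeral)
  qed
  show ?thesis
  proof (rule measure_eqI)
    show "sets \<mu> = sets (group_convolution (distr (distr \<mu> borel fst) borel (\<lambda>t. (t, 0))) haar_Z2)"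
      by (simp add: group_convolution_def prob_distributionD(2)[OF \<mu>])
    fix A assume "A \<in> sets \<mu>"
    then have A: "A \<in> sets borel" by (simp add: prob_distributionD(2)[OF \<mu>])
    show "emeasure \<mu> A = emeasure (group_convolution (distr (distr \<mu> borel fst) borel (\<lambda>t. (t, 0))) haar_Z2) A"
      unfolding emeasure_convolution_haar_Z2[OF real_distribution_fst[OF \<mu>] A]
        emeasure_real_z2_split(1)[OF prob_distributionD(2)[OF \<mu>] A]
        half[OF emeasure_real_z2_split(2)[OF prob_distributionD(2)[OF \<mu>] A]]
      by (simp add: add_divide_distrib_ennreal)
  qed
qed


section \<open>Heyde's theorem on the product group\<close>

context prob_space
begin

text \<open>\<open>w\<close> is a character of Z(2): the constant 1 gives the equation for F, the
  sign the one for G. Independence factorizes the expectation of a test function, and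
  \<open>s * a j + t * b j = (s + b j / a j * t) * a j\<close> explains the variables
  \<open>a j * fst (\<xi> j \<omega>)\<close>.\<close>

lemma Heyde_equation:
  fixes \<xi> :: "nat \<Rightarrow> 'a \<Rightarrow> real_z2" and a b :: "nat \<Rightarrow> real" and w :: "bit \<Rightarrow> complex"
  assumes fin: "finite I" and indep: "indep_vars (\<lambda>_. borel) \<xi> I"
    and a: "\<And>j. j \<in> I \<Longrightarrow> a j \<noteq> 0"
    and sym: "conditionally_symmetric M
           (\<lambda>\<omega>. \<Sum>j\<in>I. dilation (b j) (\<xi> j \<omega>)) (\<lambda>\<omega>. \<Sum>j\<in>I. dilation (a j) (\<xi> j \<omega>))"
    and w: "w 0 = 1" "\<And>k l. w (k + l) = w k * w l" "\<And>k. norm (w k) \<le> 1"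
  shows "(\<Prod>j\<in>I. wlap M (\<lambda>\<omega>. w (snd (\<xi> j \<omega>))) (\<lambda>\<omega>. a j * fst (\<xi> j \<omega>)) (of_real (s + b j / a j * t)))
       = (\<Prod>j\<in>I. wlap M (\<lambda>\<omega>. w (snd (\<xi> j \<omega>))) (\<lambda>\<omega>. a j * fst (\<xi> j \<omega>)) (of_real (s - b j / a j * t)))"
proof -
  define L1 where "L1 \<omega> = (\<Sum>j\<in>I. dilation (a j) (\<xi> j \<omega>))" for \<omega>
  define L2 where "L2 \<omega> = (\<Sum>j\<in>I. dilation (b j) (\<xi> j \<omega>))" for \<omega>
  have meas: "\<xi> j \<in> borel_measurable M" if "j \<in> I" for j
    using indep that by (simp add: indep_vars_def2)
  have mf: "(\<lambda>\<omega>. fst (\<xi> j \<omega>)) \<in> borel_measurable M" if "j \<in> I" for j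
    by (rule measurable_compose[OF meas[OF that] measurable_fst_real_z2])
  have mw: "(\<lambda>\<omega>. snd (\<xi> j \<omega>)) \<in> borel_measurable M" if "j \<in> I" for j
    by (rule measurable_compose[OF meas[OF that]]) (intro borel_measurable_continuous_onI continuous_intros)
  have L_eq: "(\<Sum>j\<in>I. dilation (c j) (\<xi> j \<omega>)) = (\<Sum>j\<in>I. c j * fst (\<xi> j \<omega>), \<Sum>j\<in>I. snd (\<xi> j \<omega>))" for c \<omega>
    by (simp add: prod_eq_iff fst_sum snd_sum dilation_def case_prod_beta)
  have mL: "(\<lambda>\<omega>. \<Sum>j\<in>I. dilation (c j) (\<xi> j \<omega>)) \<in> borel_measurable M" for c
    unfolding L_eq by (intro borel_measurable_Pair borel_measurable_sum borel_measurable_times borel_measurable_const mf mw)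
  have neg: "- x = (- fst x, snd x)" for x :: real_z2
    by (cases x; cases "snd x") auto
  have mneg: "(\<lambda>\<omega>. - L2 \<omega>) \<in> borel_measurable M"
    unfolding L2_def L_eq neg
    by (simp only: fst_conv snd_conv) (intro borel_measurable_Pair borel_measurable_uminus borel_measurable_sum borel_measurable_times borel_measurable_const mf mw)
  \<comment> \<open>The bit is taken from \<open>L1\<close> and only the real coordinate from
    \<open>L2\<close>, so passing to \<open>- L2\<close> means passing from \<open>t\<close> to
    \<open>- t\<close>. Dilations fix bits, so the bit of \<open>L1\<close> is the sum of all bits,
    which \<open>w\<close> turns into a product.\<close>
  define g where "g t p = w (snd (fst p)) * exp (\<i> * of_real (s * fst (fst p) + t * fst (snd p)))"
    for t :: real and p :: "real_z2 \<times> real_z2"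
  have mg: "g t \<in> borel_measurable borel" for t
  proof -
    have "continuous_on UNIV (\<lambda>p :: real_z2 \<times> real_z2. w (snd (fst p)))"
      by (rule continuous_on_compose2[of UNIV w]) (auto intro!: continuous_intros)
    then show ?thesis unfolding g_def by (intro borel_measurable_continuous_onI continuous_intros)
  qed
  have w_sum: "w (\<Sum>j\<in>J. f j) = (\<Prod>j\<in>J. w (f j))" for J :: "nat set" and f
    by (induction J rule: infinite_finite_induct)
       (simp_all only: sum.infinite prod.infinite sum.empty prod.empty sum.insert prod.insert w(1,2)
          not_False_eq_True)
  have val: "(CLINT \<omega>|M. g t (L1 \<omega>, L2 \<omega>))
      = (\<Prod>j\<in>I. wlap M (\<lambda>\<omega>. w (snd (\<xi> j \<omega>))) (\<lambda>\<omega>. a j * fst (\<xi> j \<omega>)) (of_real (s + b j / a j * t)))" for t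
  proof -
    define h where "h j x = w (snd x) * exp (\<i> * of_real (s + b j / a j * t) * of_real (a j * fst x))"
      for j and x :: real_z2
    have mh: "h j \<in> borel_measurable borel" for j
      unfolding h_def
      by (intro borel_measurable_times measurable_bit_snd borel_measurable_continuous_onI continuous_intros)
    have "g t (L1 \<omega>, L2 \<omega>) = (\<Prod>j\<in>I. h j (\<xi> j \<omega>))" for \<omega>
    proof -
      have "s * (\<Sum>j\<in>I. a j * fst (\<xi> j \<omega>)) + t * (\<Sum>j\<in>I. b j * fst (\<xi> j \<omega>))
          = (\<Sum>j\<in>I. (s + b j / a j * t) * (a j * fst (\<xi> j \<omega>)))"
        unfolding sum_distrib_left sum.distrib[symmetric]
      proof (intro sum.cong refl)
        fix j assume "j \<in> I"
        then show "s * (a j * fst (\<xi> j \<omega>)) + t * (b j * fst (\<xi> j \<omega>)) = (s + b j / a j * t) * (a j * fst (\<xi> j \<omega>))"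
          using a[of j] by (simp add: distrib_right)
      qed
      then have "g t (L1 \<omega>, L2 \<omega>) = (\<Prod>j\<in>I. w (snd (\<xi> j \<omega>)))
          * exp (\<Sum>j\<in>I. \<i> * of_real ((s + b j / a j * t) * (a j * fst (\<xi> j \<omega>))))"
        unfolding g_def L1_def L2_def L_eq fst_conv snd_conv w_sum by (simp only: of_real_sum sum_distrib_left)
      also have "\<dots> = (\<Prod>j\<in>I. h j (\<xi> j \<omega>))"
        unfolding exp_sum[OF fin] prod.distrib[symmetric] h_def by (simp only: of_real_mult mult.assoc)
      finally show ?thesis .
    qed
    then have "(CLINT \<omega>|M. g t (L1 \<omega>, L2 \<omega>)) = (CLINT \<omega>|M. (\<Prod>j\<in>I. h j (\<xi> j \<omega>)))" by simp
    also have "\<dots> = (\<Prod>j\<in>I. CLINT \<omega>|M. h j (\<xi> j \<omega>))"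
    proof (rule indep_vars_lebesgue_integral[OF fin])
      show "indep_vars (\<lambda>_. borel) (\<lambda>j \<omega>. h j (\<xi> j \<omega>)) I"
        by (rule indep_vars_compose2[OF indep]) (rule mh)
      show "integrable M (\<lambda>\<omega>. h j (\<xi> j \<omega>))" if "j \<in> I" for j
      proof (rule integrable_const_bound[where B = 1])
        show "(\<lambda>\<omega>. h j (\<xi> j \<omega>)) \<in> borel_measurable M" by (rule measurable_compose[OF meas[OF that] mh])
      qed (use w(3) in \<open>simp add: h_def norm_mult flip: of_real_mult of_real_add\<close>)
    qed
    also have "\<dots> = (\<Prod>j\<in>I. wlap M (\<lambda>\<omega>. w (snd (\<xi> j \<omega>))) (\<lambda>\<omega>. a j * fst (\<xi> j \<omega>)) (of_real (s + b j / a j * t)))"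
      unfolding wlap_def h_def ..
    finally show ?thesis .
  qed
  have mpair: "(\<lambda>\<omega>. (L1 \<omega>, L2 \<omega>)) \<in> borel_measurable M" "(\<lambda>\<omega>. (L1 \<omega>, - L2 \<omega>)) \<in> borel_measurable M"
    unfolding L1_def using mL[of a] mL[of b] mneg
    by (simp_all only: L2_def borel_measurable_Pair)
  have "(CLINT \<omega>|M. g t (L1 \<omega>, L2 \<omega>)) = (CLINT p|distr M borel (\<lambda>\<omega>. (L1 \<omega>, L2 \<omega>)). g t p)"
    by (rule integral_distr[symmetric, OF mpair(1) mg])
  also have "distr M borel (\<lambda>\<omega>. (L1 \<omega>, L2 \<omega>)) = distr M borel (\<lambda>\<omega>. (L1 \<omega>, - L2 \<omega>))"
    using sym unfolding conditionally_symmetric_def L1_def L2_def .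
  also have "(CLINT p|distr M borel (\<lambda>\<omega>. (L1 \<omega>, - L2 \<omega>)). g t p) = (CLINT \<omega>|M. g t (L1 \<omega>, - L2 \<omega>))"
    by (rule integral_distr[OF mpair(2) mg])
  also have "\<dots> = (CLINT \<omega>|M. g (- t) (L1 \<omega>, L2 \<omega>))"
    by (simp add: g_def)
  finally show ?thesis unfolding val by simp
qed

end

text \<open>Returns from the normalized variables to the distributions themselves, at the price of
  dividing the argument by \<open>a\<close>.\<close>

lemma wlap_distr_scale:
  fixes \<xi> :: "'w \<Rightarrow> real_z2" and a :: real
  assumes \<xi>: "\<xi> \<in> borel_measurable M" and W: "W \<in> borel_measurable borel" and a: "a \<noteq> 0"
  shows "wlap (distr M borel \<xi>) W fst z = wlap M (\<lambda>\<omega>. W (\<xi> \<omega>)) (\<lambda>\<omega>. a * fst (\<xi> \<omega>)) (z / of_real a)"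
proof -
  have m: "(\<lambda>x. W x * exp (\<i> * z * of_real (fst x))) \<in> borel_measurable (borel :: real_z2 measure)"
    using W measurable_fst_real_z2 by measurable
  show ?thesis
    unfolding wlap_def integral_distr[OF \<xi> m] using a
    by (intro Bochner_Integration.integral_cong refl) (simp add: mult.assoc)
qed

theorem theorem2p1:
  fixes M :: "'w measure"
    and n :: nat
    and a b :: "nat \<Rightarrow> real"
    and \<xi> :: "nat \<Rightarrow> 'w \<Rightarrow> real_z2"
    and \<mu> :: "nat \<Rightarrow> real_z2 measure"
  assumes "prob_space M"
    and "2 \<le> n"
    and "\<And>j. j \<in> {1..n} \<Longrightarrow> topological_automorphism (dilation (a j))"
    and "\<And>j. j \<in> {1..n} \<Longrightarrow> topological_automorphism (dilation (b j))"
    and "\<And>i j. i \<in> {1..n} \<Longrightarrow> j \<in> {1..n} \<Longrightarrow> b i * inverse (a i) + b j * inverse (a j) \<noteq> 0"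
    and "prob_space.indep_vars M (\<lambda>_. borel) \<xi> {1..n}"
    and "\<And>j. j \<in> {1..n} \<Longrightarrow> \<mu> j = distr M borel (\<xi> j)"
    and "conditionally_symmetric M
           (\<lambda>\<omega>. \<Sum>j=1..n. dilation (b j) (\<xi> j \<omega>))
           (\<lambda>\<omega>. \<Sum>j=1..n. dilation (a j) (\<xi> j \<omega>))"
  shows "((\<forall>j\<in>{1..n}. \<mu> j \<in> class_Lambda) \<and>
            (\<exists>j\<in>{1..n}. \<exists>\<gamma>\<in>Gamma_R. \<mu> j = group_convolution \<gamma> haar_Z2))
       \<or> ((\<forall>j\<in>{1..n}. \<mu> j \<in> class_Theta) \<and>
            (\<forall>j\<in>{1..n}. \<forall>y. char_fun (\<mu> j) y \<noteq> 0))"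
proof -
  interpret prob_space M by (rule assms(1))
  define I where "I = {1..n}"
  have fin: "finite I" by (simp add: I_def)
  \<comment> \<open>The characterization of automorphisms only gives
    \<open>dilation (a j) = dilation a'\<close> with \<open>a' \<noteq> 0\<close>; the value at
    \<open>(1, 0)\<close> identifies \<open>a'\<close> with \<open>a j\<close>.\<close>
  have a: "a j \<noteq> 0" if "j \<in> I" for j
  proof -
    have "topological_automorphism (dilation (a j))" using assms(3)[of j] that by (simp add: I_def)
    then obtain a' where a': "a' \<noteq> 0" "dilation (a j) = dilation a'"
      unfolding topological_automorphism_iff by (elim exE conjE) (rule that)
    from fun_cong[OF a'(2), of "(1, 0)"] a'(1) show ?thesis by (simp add: dilation_def)
  qed
  have c: "b i / a i + b j / a j \<noteq> 0" if "i \<in> I" "j \<in> I" for i j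
    using assms(5)[of i j] that by (simp add: I_def divide_inverse)
  have indep: "indep_vars (\<lambda>_. borel) \<xi> I" using assms(6) by (simp add: I_def)
  have sym: "conditionally_symmetric M (\<lambda>\<omega>. \<Sum>j\<in>I. dilation (b j) (\<xi> j \<omega>))
      (\<lambda>\<omega>. \<Sum>j\<in>I. dilation (a j) (\<xi> j \<omega>))"
    using assms(8) by (simp add: I_def)
  have meas: "\<xi> j \<in> borel_measurable M" if "j \<in> I" for j
    using indep that by (simp add: indep_vars_def2)
  have \<mu>: "\<mu> j = distr M borel (\<xi> j)" if "j \<in> I" for j
    using assms(7)[of j] that by (simp add: I_def)
  have pd: "prob_distribution (\<mu> j)" if "j \<in> I" for j
    unfolding prob_distribution_def \<mu>[OF that] using prob_space_distr[OF meas[OF that]] by simp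
  define X where "X j \<omega> = a j * fst (\<xi> j \<omega>)" for j \<omega>
  have mf: "(\<lambda>x :: real_z2. k * fst x) \<in> borel_measurable borel" for k
    using measurable_fst_real_z2 by (intro borel_measurable_times borel_measurable_const)
  have X: "X j \<in> borel_measurable M" if "j \<in> I" for j
    unfolding X_def by (rule measurable_compose[OF meas[OF that] mf])
  have indepX: "indep_vars (\<lambda>_. borel) X I"
    unfolding X_def by (rule indep_vars_compose2[OF indep]) (rule mf)
  define W where "W j \<omega> = complex_of_real (bit_sign (snd (\<xi> j \<omega>)))" for j \<omega>
  have mW: "(\<lambda>x :: real_z2. complex_of_real (bit_sign (snd x))) \<in> borel_measurable borel"
    by (rule measurable_bit_snd)
  have W: "W j \<in> borel_measurable M" if "j \<in> I" for j
    unfolding W_def by (rule measurable_compose[OF meas[OF that] mW])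
  have W1: "norm (W j \<omega>) \<le> 1" for j \<omega> by (simp add: W_def)
  define F where "F j = wlap M (\<lambda>_. 1) (X j)" for j
  define G where "G j = wlap M (W j) (X j)" for j
  have eqF: "(\<Prod>j\<in>I. F j (of_real (s + b j / a j * t))) = (\<Prod>j\<in>I. F j (of_real (s - b j / a j * t)))" for s t
    using Heyde_equation[OF fin indep a sym, of "\<lambda>_. 1" s t] by (simp add: F_def X_def[abs_def])
  have eqG: "(\<Prod>j\<in>I. G j (of_real (s + b j / a j * t))) = (\<Prod>j\<in>I. G j (of_real (s - b j / a j * t)))" for s t
  proof -
    have "complex_of_real (bit_sign (k + l)) = of_real (bit_sign k) * of_real (bit_sign l)" for k l
      unfolding bit_sign_add by (rule of_real_mult)
    from Heyde_equation[OF fin indep a sym, of "\<lambda>k. of_real (bit_sign k)", OF _ _ this]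
    show ?thesis unfolding G_def X_def[abs_def] W_def[abs_def] by simp
  qed
  have em: "integrable M (\<lambda>\<omega>. exp (y * X j \<omega>))" if "j \<in> I" for j y
    by (rule Heyde_real(1)[OF fin indepX c eqF[unfolded F_def] that])
  have "\<exists>d0 d1 d2. \<forall>z. F j z = exp (d0 + d1 * z + d2 * z ^ 2)" if "j \<in> I" for j
    unfolding F_def by (rule Heyde_real(2)[OF fin indepX c eqF[unfolded F_def] that])
  then obtain d0 d1 d2 where F: "\<And>j z. j \<in> I \<Longrightarrow> F j z = exp (d0 j + d1 j * z + d2 j * z ^ 2)"
    by metis
  have G_hol: "G j holomorphic_on UNIV" if "j \<in> I" for j
    unfolding G_def by (rule wlap_holomorphic[OF X[OF that] W[OF that] W1 em[OF that]])
  have rescale: "exp (u0 + u1 * (z / of_real k) + u2 * (z / of_real k) ^ 2)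
      = exp (u0 + (u1 / of_real k) * z + (u2 / of_real k ^ 2) * z ^ 2)" 
    for u0 u1 u2 z :: complex and k :: real
    by (simp add: power_divide)
  have F\<mu>: "wlap (\<mu> j) (\<lambda>_. 1) fst z = exp (d0 j + (d1 j / of_real (a j)) * z + (d2 j / of_real (a j) ^ 2) * z ^ 2)"
    if "j \<in> I" for j z
  proof -
    have "wlap (\<mu> j) (\<lambda>_. 1) fst z = F j (z / of_real (a j))"
      unfolding \<mu>[OF that] F_def X_def by (rule wlap_distr_scale[OF meas[OF that] _ a[OF that]]) simp
    then show ?thesis unfolding F[OF that] rescale .
  qed
  have G\<mu>: "wlap (\<mu> j) (\<lambda>x. of_real (bit_sign (snd x))) fst z = G j (z / of_real (a j))" if "j \<in> I" for j z
    unfolding \<mu>[OF that] G_def X_def W_def by (rule wlap_distr_scale[OF meas[OF that] mW a[OF that]])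
  have Lambda: "\<mu> j \<in> class_Lambda" if "j \<in> I" for j
    by (rule class_LambdaI[OF pd F\<mu>]) (use that in simp_all)
  \<comment> \<open>One identically vanishing \<open>G j\<close> already gives the first
    alternative, because membership in \<Lambda> holds for all \<open>j\<close>. Otherwise no
    \<open>G j\<close> has any zero.\<close>
  show ?thesis
  proof (cases "\<exists>j\<in>I. \<forall>z. G j z = 0")
    case True
    then obtain j where j: "j \<in> I" "\<And>z. G j z = 0" by blast
    define \<gamma> :: "real_z2 measure" where "\<gamma> = distr (distr (\<mu> j) borel fst) borel (\<lambda>t. (t, 0))"
    have "\<gamma> \<in> Gamma_R"
      using Lambda[OF j(1)] unfolding Gamma_R_def class_Lambda_def \<gamma>_def by blast
    moreover have "\<mu> j = group_convolution \<gamma> haar_Z2"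
      unfolding \<gamma>_def by (rule eq_convolution_haar_Z2[OF pd[OF j(1)]]) (simp add: G\<mu>[OF j(1)] j(2))
    ultimately show ?thesis using Lambda j(1) unfolding I_def by blast
  next
    case False
    have nz: "G j z \<noteq> 0" if "j \<in> I" for j z
      by (rule entire_Heyde_nonvanishing[OF fin G_hol c eqG _ that]) (use False in blast)+
    have Theta: "\<mu> j \<in> class_Theta \<and> (\<forall>y. char_fun (\<mu> j) y \<noteq> 0)" if j: "j \<in> I" for j
    proof -
      \<comment> \<open>The growth of \<open>G j\<close> is read off from \<open>F j\<close> at
        \<open>\<i> * Im z\<close>, where \<open>K\<close> controls the quadratic exponent.\<close>
      define K where "K = norm (d0 j) + norm (d1 j) + norm (d2 j)"
      have "norm (G j z) \<le> exp (K * (1 + norm z ^ 2))" for z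
      proof -
        let ?w = "\<i> * of_real (Im z)"
        have "norm (G j z) \<le> (\<integral>\<omega>. exp (- Im z * X j \<omega>) \<partial>M)"
          unfolding G_def by (rule norm_wlap_le[OF X[OF j] W[OF j] W1 em[OF j]])
        also have "\<dots> \<le> norm (F j ?w)" unfolding F_def wlap_imaginary by simp
        also have "\<dots> \<le> exp (norm (d0 j + d1 j * ?w + d2 j * ?w ^ 2))" unfolding F[OF j] by (rule norm_exp)
        also have "\<dots> \<le> exp (K * (1 + norm ?w ^ 2))"
          unfolding exp_le_cancel_iff K_def by (rule norm_quadratic_le)
        also have "\<dots> \<le> exp (K * (1 + norm z ^ 2))"
          unfolding exp_le_cancel_iff
          by (intro mult_left_mono add_left_mono power_mono)
             (auto simp: K_def norm_mult abs_Im_le_cmod)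
        finally show ?thesis .
      qed
      from entire_nonvanishing_eq_exp_quadratic[OF G_hol[OF j] nz[OF j] this]
      obtain e0 e1 e2 where G: "\<And>z. G j z = exp (e0 + e1 * z + e2 * z ^ 2)" by blast
      have em\<mu>: "integrable (\<mu> j) (\<lambda>x. exp (y * fst x))" for y
      proof -
        have "(\<lambda>x :: real_z2. exp (y * fst x)) \<in> borel_measurable borel"
          using mf by (rule measurable_compose) simp
        then have "integrable (\<mu> j) (\<lambda>x. exp (y * fst x)) \<longleftrightarrow> integrable M (\<lambda>\<omega>. exp (y * fst (\<xi> j \<omega>)))"
          unfolding \<mu>[OF j] by (rule integrable_distr_eq[OF meas[OF j]])
        then show ?thesis using em[OF j, of "y / a j"] a[OF j] by (simp add: X_def)
      qed
      have G': "wlap (\<mu> j) (\<lambda>x. of_real (bit_sign (snd x))) fst z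
          = exp (e0 + (e1 / of_real (a j)) * z + (e2 / of_real (a j) ^ 2) * z ^ 2)" for z
        unfolding G\<mu>[OF j] G rescale ..
      show ?thesis using class_ThetaI[OF pd[OF j] em\<mu> F\<mu>[OF j] G'] by blast
    qed
    then show ?thesis unfolding I_def by blast
  qed
qed

end
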